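(* Consider a twin-leader-follower network under the standing assumptions described in the context, in which every follower runs the orientation estimator and the position estimator described in the context, and write the position estimator as the cascade system $\dot{\hat{\mathbf p}}=\mathbf f(\hat{\mathbf p},t)+\mathbf h(\hat{\mathbf p},\hat{\mathbf R})$ as in the context. Then this system is input-to-state stable (with respect to the equilibrium $\hat{\mathbf p}=\mathbf p$ of $\dot{\hat{\mathbf p}}=\mathbf f$) with respect to the input $\mathbf h(\hat{\mathbf p},\hat{\mathbf R})$. Further, $\hat{\mathbf p}(t)\to\mathbf p$ almost globally and asymptotically as $t\to\infty$.
   Context: Notation. For $\omega\in\mathbb R^3$, $\omega^\wedge$ is the skew-symmetric matrix with $\omega^\wedge v=\omega\times v$. For a unit vector $\mathbf b\in\mathbb R^3$, $\mathbf P_{\mathbf b}=\mathbf I_3-\mathbf b\mathbf b^\top$. Setting. A network of agents in $\mathbb R^3$; agent $i$ has a fixed position $\mathbf p_i\in\mathbb R^3$ and a true orientation $\mathbf R_i(t)\in SO(3)$ satisfying $\dot{\mathbf R}_i=\mathbf R_i(\omega_i^i)^\wedge$, where the body angular velocity $\omega_i^i(t)$ (known to agent $i$) and its derivative are bounded. The leader agents (at least two, labelled $1,2$, and possibly redundant leaders $1',2',\dots$) know their true poses, so $\hat{\mathbf R}_j=\mathbf R_j$, $\hat{\mathbf p}_j=\mathbf p_j$ for every leader $j$; the followers are $3,4,\dots,n$. Each follower $i$ has a neighbor set $\mathcal N_i$ of at least two agents, all preceding $i$ in the order $1,2,1',2',\dots,3,4,\dots,n$. No two agents are collocated, and each follower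 has at least one pair of neighbors with which it is not collinear. Follower $i$ measures $\mathbf b_{ij}^i$ for $j\in\mathcal N_i$, and each neighbor $j\in\mathcal N_i$ measures $\mathbf b_{ji}^j$ and transmits $\hat{\mathbf R}_j\mathbf b_{ji}^j$ and $\hat{\mathbf p}_j$ to $i$. $\mathbf p$ and $\hat{\mathbf p}$ are the stacked true and estimated positions. Directions. $\mathbf b_{ij}=(\mathbf p_j-\mathbf p_i)/\|\mathbf p_j-\mathbf p_i\|=-\mathbf b_{ji}$, $\mathbf b_{ij}^i=\mathbf R_i^\top\mathbf b_{ij}$, $\mathbf b_{ij}^j=\mathbf R_j^\top\mathbf b_{ij}$. Orientation estimator. Put $\hat{\mathbf g}_{ij}=\hat{\mathbf R}_j\mathbf b_{ij}^j$. In the orientation estimator only, if $\mathcal N_i=\{j,l\}$ has two elements, a third index $*$ is added to the sums, with $\mathbf b_{i*}=(\mathbf b_{ij}\times\mathbf b_{il})/\|\mathbf b_{ij}\times\mathbf b_{il}\|$, $\mathbf b_{i*}^i=\mathbf R_i^\top\mathbf b_{i*}$, $\hat{\mathbf g}_{i*}=(\hat{\mathbf g}_{ij}\times\hat{\mathbf g}_{il})/\|\mathbf b_{ij}\times\mathbf b_{il}\|$. With gains $k_{ij}>0$, $k_\omega>0$, follower $i$ runs $\dot{\hat{\mathbf R}}_i=\hat{\mathbf R}_i(\omega_i^i-\tilde\Omega_i)^\wedge$, $\dot{\tilde\Omega}_i=-k_\omega\tilde\Omega_i+\sum_{j}k_{ij}(\hat{\mathbf R}_i^\top\hat{\mathbf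 g}_{ij}\times\mathbf b_{ij}^i)$, with initial values in $SO(3)\times\mathbb R^3$. It is assumed that the directions used are non-coplanar, so $\mathbf K_i=\sum_jk_{ij}\mathbf b_{ij}\mathbf b_{ij}^\top$ is positive definite, and that the gains are chosen so that $\mathbf K_i$ has distinct eigenvalues. Position estimator. With gains $k_{p_{ij}}>0$ and arbitrary $\hat{\mathbf p}_i(0)\in\mathbb R^3$, follower $i$ runs $$\dot{\hat{\mathbf p}}_i=-\hat{\mathbf R}_i\sum_{j\in\mathcal N_i}k_{p_{ij}}\mathbf P_{\mathbf b_{ij}^i}\hat{\mathbf R}_i^\top(\hat{\mathbf p}_i-\hat{\mathbf p}_j).$$ It is written $\dot{\hat{\mathbf p}}_i=\mathbf f_i+\mathbf h_i$ with $\mathbf f_i=-\sum_{j\in\mathcal N_i}k_{p_{ij}}\mathbf P_{\mathbf b_{ij}}(\hat{\mathbf p}_i-\mathbf p_j)$ and $$\mathbf h_i=-(\hat{\mathbf R}_i-\mathbf R_i)\sum_{j\in\mathcal N_i}k_{p_{ij}}\mathbf P_{\mathbf b_{ij}^i}\mathbf R_i^\top(\hat{\mathbf p}_i-\hat{\mathbf p}_j)-\hat{\mathbf R}_i\sum_{j\in\mathcal N_i}k_{p_{ij}}\mathbf P_{\mathbf b_{ij}^i}(\hat{\mathbf R}_i^\top-\mathbf R_i^\top)(\hat{\mathbf p}_i-\hat{\mathbf p}_j)-\mathbf R_i\sum_{j\in\mathcal N_i}k_{p_{ij}}\mathbf P_{\mathbf b_{ij}^i}\mathbf R_i^\top(\mathbf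 p_j-\hat{\mathbf p}_j),$$ and $\mathbf f$, $\mathbf h$ stack the $\mathbf f_i$, $\mathbf h_i$ (leader components are zero, since $\hat{\mathbf p}_i=\mathbf p_i$ for leaders). "Almost globally" means for all initial conditions of the coupled estimators (orientation and position) outside a set of measure zero. *)

theory Defs
  imports "HOL-Analysis.Analysis"
begin

section \<open>Input-to-state stability\<close>

definition class_K :: "(real \<Rightarrow> real) \<Rightarrow> bool" where
  "class_K \<gamma> \<longleftrightarrow> continuous_on {0..} \<gamma> \<and> strict_mono_on {0..} \<gamma> \<and> \<gamma> 0 = 0"

definition class_KL :: "(real \<Rightarrow> real \<Rightarrow> real) \<Rightarrow> bool" where
  "class_KL \<beta> \<longleftrightarrow>
     (\<forall>s\<ge>0. class_K (\<lambda>r. \<beta> r s)) \<and>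
     (\<forall>r\<ge>0. antimono_on {0..} (\<beta> r) \<and> (\<beta> r \<longlongrightarrow> 0) at_top)"

definition admissible_input :: "real \<Rightarrow> (real \<Rightarrow> 'a::euclidean_space) \<Rightarrow> bool" where
  "admissible_input t0 u \<longleftrightarrow>
     u \<in> borel_measurable (lebesgue_on {t0..}) \<and> (\<forall>T\<ge>t0. bounded (u ` {t0..T}))"

text \<open>Caratheodory solutions on \<open>[t0, \<infinity>)\<close> of \<open>x' = f(t, x) + u(t)\<close>, so that
  merely measurable inputs are allowed.\<close>

definition forced_solution ::
  "(real \<Rightarrow> 'a \<Rightarrow> 'a) \<Rightarrow> (real \<Rightarrow> 'a) \<Rightarrow> real \<Rightarrow> 'a \<Rightarrow> (real \<Rightarrow> 'a::euclidean_space) \<Rightarrow> bool" where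
  "forced_solution f u t0 x0 x \<longleftrightarrow>
     (\<forall>t\<ge>t0. (\<lambda>s. f s (x s) + u s) absolutely_integrable_on {t0..t} \<and>
             x t = x0 + integral {t0..t} (\<lambda>s. f s (x s) + u s))"

text \<open>Input-to-state stability of \<open>x' = f(t, x) + u\<close> with respect to the input \<open>u\<close>,
  relative to the equilibrium \<open>xe\<close> of the unforced system \<open>x' = f(t, x)\<close>.\<close>

definition input_to_state_stable :: "(real \<Rightarrow> 'a \<Rightarrow> 'a) \<Rightarrow> 'a::euclidean_space \<Rightarrow> bool" where
  "input_to_state_stable f xe \<longleftrightarrow>
     (\<forall>t\<ge>0. f t xe = 0) \<and>
     (\<exists>\<beta> \<gamma>. class_KL \<beta> \<and> class_K \<gamma> \<and>
        (\<forall>t0\<ge>0. \<forall>x0 u. admissible_input t0 u \<longrightarrow>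
           (\<exists>x. forced_solution f u t0 x0 x) \<and>
           (\<forall>x. forced_solution f u t0 x0 x \<longrightarrow>
              (\<forall>t\<ge>t0. norm (x t - xe) \<le>
                 \<beta> (norm (x0 - xe)) (t - t0) + \<gamma> (SUP s\<in>{t0..t}. norm (u s))))))"


unbundle cross3_syntax

section \<open>Networks and directions\<close>

text \<open>Agents are elements of \<open>'l + 'f\<close>: leaders \<open>Inl l\<close> and followers \<open>Inr i\<close>, the latter
  linearly ordered. All leaders precede all followers. Leaders have no neighbor
  sets, so their mutual order plays no role.\<close>

definition hat :: "real^3 \<Rightarrow> real^3^3" where
  "hat w = matrix (\<lambda>v. w \<times> v)"

text \<open>\<open>outer b\<close> is the rank-one matrix \<open>b b\<^sup>T\<close>.\<close>

definition outer :: "real^3 \<Rightarrow> real^3^3" where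
  "outer b = (columnvector b :: real^1^3) ** rowvector b"

definition perp_proj :: "real^3 \<Rightarrow> real^3^3" where
  "perp_proj b = mat 1 - outer b"

definition direction :: "('a \<Rightarrow> real^3) \<Rightarrow> 'a \<Rightarrow> 'a \<Rightarrow> real^3" where
  "direction p i j = (p j - p i) /\<^sub>R norm (p j - p i)"

text \<open>The direction from \<open>i\<close> to \<open>j\<close> expressed in the body frame of agent \<open>a\<close> at time \<open>t\<close>.\<close>

definition body_direction ::
  "('a \<Rightarrow> real^3) \<Rightarrow> ('a \<Rightarrow> real \<Rightarrow> real^3^3) \<Rightarrow> 'a \<Rightarrow> 'a \<Rightarrow> 'a \<Rightarrow> real \<Rightarrow> real^3" where
  "body_direction p R a i j t = transpose (R a t) *v direction p i j"

text \<open>Stacked estimates carry only follower components; the leaders use their true values.\<close>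

definition with_leaders :: "('l \<Rightarrow> 'v) \<Rightarrow> 'v^'f \<Rightarrow> 'l + 'f \<Rightarrow> 'v" where
  "with_leaders u x a = (case a of Inl l \<Rightarrow> u l | Inr i \<Rightarrow> x $ i)"


section \<open>Orientation estimator\<close>

text \<open>Summation indices of the orientation estimator: \<open>Some j\<close> for a neighbor \<open>j\<close>, and \<open>None\<close>
  for the additional direction used when there are exactly two neighbors.\<close>

definition orient_index :: "'a set \<Rightarrow> 'a option set" where
  "orient_index S = Some ` S \<union> (if card S = 2 then {None} else {})"

text \<open>An enumeration of a two-element neighbor set. Swapping the two neighbors changes the sign
  of both the additional direction and its estimate, and these enter only through products
  in which the signs cancel.\<close>

definition nbr_pair :: "'a set \<Rightarrow> 'a \<times> 'a" where
  "nbr_pair S = (SOME (j, l). j \<noteq> l \<and> S = {j, l})"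

definition orient_dir ::
  "('a \<Rightarrow> real^3) \<Rightarrow> 'a set \<Rightarrow> 'a \<Rightarrow> 'a option \<Rightarrow> real^3" where
  "orient_dir p S i c =
     (case c of
        Some j \<Rightarrow> direction p i j
      | None \<Rightarrow> let (j, l) = nbr_pair S; n = direction p i j \<times> direction p i l in n /\<^sub>R norm n)"

text \<open>The estimates of the directions above, where \<open>Q\<close> gives the
  orientation estimates of all agents at time \<open>t\<close>. For \<open>None\<close>, the norm of the true cross
  product is used for the scaling, so the result need not be a unit vector.\<close>

definition orient_dir_est ::
  "('a \<Rightarrow> real^3) \<Rightarrow> ('a \<Rightarrow> real \<Rightarrow> real^3^3) \<Rightarrow> 'a set \<Rightarrow> ('a \<Rightarrow> real^3^3) \<Rightarrow> real \<Rightarrow> 'a \<Rightarrow>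
     'a option \<Rightarrow> real^3" where
  "orient_dir_est p R S Q t i c =
     (let g = (\<lambda>j. Q j *v body_direction p R j i j t) in
      case c of
        Some j \<Rightarrow> g j
      | None \<Rightarrow> let (j, l) = nbr_pair S in
                  (g j \<times> g l) /\<^sub>R norm (direction p i j \<times> direction p i l))"

definition gain_matrix ::
  "('a \<Rightarrow> real^3) \<Rightarrow> 'a set \<Rightarrow> ('a option \<Rightarrow> real) \<Rightarrow> 'a \<Rightarrow> real^3^3" where
  "gain_matrix p S k i =
     (\<Sum>c\<in>orient_index S. k c *\<^sub>R outer (orient_dir p S i c))"

definition orientation_estimator ::
  "('l + 'f \<Rightarrow> real^3) \<Rightarrow> ('l + 'f \<Rightarrow> real \<Rightarrow> real^3^3) \<Rightarrow> ('l + 'f \<Rightarrow> real \<Rightarrow> real^3) \<Rightarrow>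
   ('f \<Rightarrow> ('l + 'f) set) \<Rightarrow> ('f \<Rightarrow> ('l + 'f) option \<Rightarrow> real) \<Rightarrow> real \<Rightarrow>
   (real \<Rightarrow> real^3^3^'f) \<Rightarrow> (real \<Rightarrow> real^3^'f::finite) \<Rightarrow> bool" where
  "orientation_estimator p R \<omega> N k k\<omega> Rh W \<longleftrightarrow>
     (\<forall>i. rotation_matrix (Rh 0 $ i) \<and>
       (\<forall>t\<ge>0.
          ((\<lambda>s. Rh s $ i) has_vector_derivative
             Rh t $ i ** hat (\<omega> (Inr i) t - W t $ i)) (at t within {0..}) \<and>
          ((\<lambda>s. W s $ i) has_vector_derivative
             - k\<omega> *\<^sub>R (W t $ i) +
             (\<Sum>c\<in>orient_index (N i). k i c *\<^sub>R
                ((transpose (Rh t $ i) *v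
                    orient_dir_est p R (N i) (with_leaders (\<lambda>l. R (Inl l) t) (Rh t)) t (Inr i) c)
                 \<times> (transpose (R (Inr i) t) *v orient_dir p (N i) (Inr i) c))))
             (at t within {0..})))"


section \<open>Position estimator\<close>

definition follower_positions :: "('l + 'f \<Rightarrow> real^3) \<Rightarrow> real^3^'f" where
  "follower_positions p = (\<chi> i. p (Inr i))"

definition position_estimator ::
  "('l + 'f \<Rightarrow> real^3) \<Rightarrow> ('l + 'f \<Rightarrow> real \<Rightarrow> real^3^3) \<Rightarrow> ('f \<Rightarrow> ('l + 'f) set) \<Rightarrow>
   ('f \<Rightarrow> 'l + 'f \<Rightarrow> real) \<Rightarrow> (real \<Rightarrow> real^3^3^'f) \<Rightarrow> (real \<Rightarrow> real^3^'f::finite) \<Rightarrow> bool" where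
  "position_estimator p R N kp Rh ph \<longleftrightarrow>
     (\<forall>i. \<forall>t\<ge>0.
        ((\<lambda>s. ph s $ i) has_vector_derivative
           - (Rh t $ i *v
              (\<Sum>j\<in>N i. kp i j *\<^sub>R
                 (perp_proj (body_direction p R (Inr i) (Inr i) j t) *v
                   (transpose (Rh t $ i) *v
                     (ph t $ i - with_leaders (\<lambda>l. p (Inl l)) (ph t) j))))))
        (at t within {0..}))"

definition position_f ::
  "('l + 'f \<Rightarrow> real^3) \<Rightarrow> ('f \<Rightarrow> ('l + 'f) set) \<Rightarrow> ('f \<Rightarrow> 'l + 'f \<Rightarrow> real) \<Rightarrow>
   real^3^'f \<Rightarrow> real^3^'f::finite" where
  "position_f p N kp x =
     (\<chi> i. - (\<Sum>j\<in>N i. kp i j *\<^sub>R (perp_proj (direction p (Inr i) j) *v (x $ i - p j))))"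

definition position_h ::
  "('l + 'f \<Rightarrow> real^3) \<Rightarrow> ('l + 'f \<Rightarrow> real \<Rightarrow> real^3^3) \<Rightarrow> ('f \<Rightarrow> ('l + 'f) set) \<Rightarrow>
   ('f \<Rightarrow> 'l + 'f \<Rightarrow> real) \<Rightarrow> real \<Rightarrow> real^3^'f \<Rightarrow> real^3^3^'f \<Rightarrow> real^3^'f::finite" where
  "position_h p R N kp t x Q =
     (\<chi> i.
        let xa = with_leaders (\<lambda>l. p (Inl l)) x;
            Ri = R (Inr i) t;
            P = (\<lambda>j. perp_proj (body_direction p R (Inr i) (Inr i) j t)) in
        - ((Q $ i - Ri) *v
            (\<Sum>j\<in>N i. kp i j *\<^sub>R (P j *v (transpose Ri *v (x $ i - xa j)))))
        - Q $ i *v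
            (\<Sum>j\<in>N i. kp i j *\<^sub>R (P j *v ((transpose (Q $ i) - transpose Ri) *v (x $ i - xa j))))
        - Ri *v
            (\<Sum>j\<in>N i. kp i j *\<^sub>R (P j *v (transpose Ri *v (p j - xa j)))))"


section \<open>Null sets of initial conditions\<close>

text \<open>Initial conditions (orientation estimates, auxiliary states, position estimates) range over
  the manifold \<open>SO(3)\<^sup>m \<times> \<real>\<^sup>3\<^sup>m \<times> \<real>\<^sup>3\<^sup>m\<close>, \<open>m\<close> being the number of
  followers. As usual on a manifold, a set has measure zero if it is Lebesgue null in the
  charts of an atlas. Here the charts are the inverses of the Cayley
  parametrizations \<open>v \<mapsto> Q (I - hat v)\<^sup>-\<^sup>1 (I + hat v)\<close> of \<open>SO(3)\<close> around every
  rotation \<open>Q\<close>; the matrix \<open>I - hat v\<close> is invertible for every \<open>v\<close>.\<close>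

definition cayley :: "real^3 \<Rightarrow> real^3^3" where
  "cayley v = matrix_inv (mat 1 - hat v) ** (mat 1 + hat v)"

definition null_initial_conditions ::
  "((real^3^3^'f) \<times> (real^3^'f) \<times> (real^3^'f::finite)) set \<Rightarrow> bool" where
  "null_initial_conditions Z \<longleftrightarrow>
     (\<forall>Q :: real^3^3^'f. (\<forall>i. rotation_matrix (Q $ i)) \<longrightarrow>
        negligible {(v :: real^3^'f, w :: real^3^'f, x :: real^3^'f).
          ((\<chi> i. Q $ i ** cayley (v $ i)), w, x) \<in> Z})"

unbundle no cross3_syntax

end

theory Submission
  imports Defs
begin

text \<open>
  The unforced position dynamics is linear and decoupled: the projection orthogonal to a bearing
  annihilates that bearing, so follower \<open>i\<close> obeys \<open>x' = - A (x - p)\<close> where \<open>A\<close> is a weighted sum of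
  projections. \<open>A\<close> is positive definite because no vector is parallel to all bearings of a
  follower. Input-to-state stability is thus that of an exponentially stable linear
  system (\<open>linear_input_to_state_stable\<close>); the inputs are merely measurable, so its estimate is
  derived from a one-sided difference quotient of the norm.

  For the second part, take as errors \<open>Q = Rh R\<^sup>T\<close> and \<open>u = R W\<close>, both in the inertial frame,
  where bearings are constant. They satisfy
  \<open>Q' = - Q hat u\<close> and \<open>u' = om \<times> u - \<kappa> u + \<Sum> k (Q\<^sup>T g) \<times> b\<close>. The body velocity
  survives only in the gyroscopic term \<open>om \<times> u\<close>, which does no work, and the
  estimated directions \<open>g\<close> are Lipschitz functions of the errors of preceding agents, equal to \<open>b\<close>
  when these vanish. So the network is a cascade of damped rotational pendula.

  If the errors of the preceding agents decay exponentially, a strict Lyapunov function and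
  Barbalat's argument show that \<open>u\<close> and the torque of an agent tend to zero
  (\<open>agent_dissipation\<close>). As the gain matrix has distinct positive eigenvalues, the torque vanishes
  only at the identity and at the half turns about the eigenvectors, and \<open>Q\<close> converges to one of
  these (\<open>agent_asymptotics\<close>). The Hessian of the potential is nonsingular at
  each of them and positive definite only at the identity (\<open>hessian_bounds\<close>).

  The rest follows from comparing two solutions. Near a critical orientation with Hessian \<open>H\<close>, let
  \<open>x\<close> be the relative rotation of the two and \<open>d\<close> the difference of their velocities. The form
  \<open>\<bar>d\<bar>\<^sup>2 / 2 + x \<bullet> H x / 2 + \<epsilon> d \<bullet> H x\<close> decreases strictly, up to terms caused by preceding agents
  (\<open>dissipative_form_exists\<close>), and sums of these forms with rapidly decreasing weights
  decrease strictly along the cascade (\<open>cascade_form_decay\<close>). At the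
  identity the forms are positive definite; comparison with the zero solution gives the
  exponential decay needed for the next agent (\<open>exponential_convergence\<close>). At any other critical orientation the form takes negative
  values, and once negative it would tend to \<open>-\<infinity>\<close>, which is absurd while both solutions stay close to
  that orientation. Hence the form is nonnegative on the difference of any two solutions that stay there from time
  \<open>T\<close> on. Their states at time \<open>T\<close> therefore lie on a
  Lipschitz graph over a hyperplane (\<open>unstable_separation\<close>). The flow backwards from \<open>T\<close> to \<open>0\<close> is Lipschitz,
  so their initial states form a null set. Countably many such sets contain every
  solution in which some agent does not converge to the identity; the first such agent
  provides the critical orientation
  (\<open>almost_global_convergence\<close>). In the role of a stable manifold stands here a Lipschitz graph
  that merely contains the exceptional states.

  Once the orientation errors vanish, the position errors satisfy \<open>e' = - A e + o(1) (1 + \<bar>e\<bar>)\<close> along the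
  order of the agents and tend to zero (\<open>position_convergence\<close>).
\<close>

unbundle cross3_syntax

section \<open>Matrices, rotations and the hat map\<close>

text \<open>Transposes are kept on the left of vectors, so that rotations and their inverses cancel syntactically.\<close>

declare transpose_matrix_vector [simp del]

text \<open>The norm on matrices is the Frobenius norm, hence the two Cauchy-Schwarz estimates that follow.\<close>

lemma norm_mult_vec_le: "norm ((A::real^'n^'m) *v x) \<le> norm A * norm x"
proof -
  have "norm (A *v x) = L2_set (\<lambda>i. norm (A $ i \<bullet> x)) UNIV"
    by (simp add: norm_vec_def inner_vec_def matrix_vector_mult_def L2_set_def sum_nonneg)
  also have "\<dots> \<le> L2_set (\<lambda>i. norm (A $ i) * norm x) UNIV"
    by (intro L2_set_mono) (auto intro: Cauchy_Schwarz_ineq2)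
  also have "\<dots> = norm A * norm x"
    by (simp add: norm_vec_def[of A] L2_set_left_distrib)
  finally show ?thesis .
qed

lemma norm_transpose: "norm (transpose (A::real^'n^'m)) = norm A"
proof -
  have "(\<Sum>i\<in>UNIV. \<Sum>j\<in>UNIV. (A $ j $ i)\<^sup>2) = (\<Sum>i\<in>UNIV. \<Sum>j\<in>UNIV. (A $ i $ j)\<^sup>2)"
    by (rule sum.swap)
  then show ?thesis
    by (simp add: norm_vec_def L2_set_def transpose_def sum_nonneg)
qed

lemma norm_matrix_mult_le: "norm ((A::real^'n^'m) ** (B::real^'k^'n)) \<le> norm A * norm B"
proof -
  have row: "(A ** B) $ i = transpose B *v (A $ i)" for i
    by (simp add: vec_eq_iff matrix_matrix_mult_def matrix_vector_mult_def transpose_def mult.commute)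
  have "norm (A ** B) = L2_set (\<lambda>i. norm (transpose B *v (A $ i))) UNIV"
    by (simp add: norm_vec_def[of "A ** B"] row)
  also have "\<dots> \<le> L2_set (\<lambda>i. norm (A $ i) * norm B) UNIV"
    by (intro L2_set_mono) (metis mult.commute norm_mult_vec_le norm_transpose, simp)
  also have "\<dots> = norm A * norm B"
    by (simp add: norm_vec_def[of A] L2_set_left_distrib)
  finally show ?thesis .
qed

lemma bounded_bilinear_matrix_mult:
  "bounded_bilinear ((**) :: real^'n^'m \<Rightarrow> real^'k^'n \<Rightarrow> real^'k^'m)"
proof
  show "\<exists>K. \<forall>(a::real^'n^'m) (b::real^'k^'n). norm (a ** b) \<le> norm a * norm b * K"
    by (intro exI[of _ 1]) (auto simp: norm_matrix_mult_le)
qed (auto simp: vec_eq_iff matrix_matrix_mult_def sum.distrib algebra_simps sum_distrib_left)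

lemma bounded_bilinear_mult_vec:
  "bounded_bilinear ((*v) :: real^'n^'m \<Rightarrow> real^'n \<Rightarrow> real^'m)"
proof
  show "\<exists>K. \<forall>(a::real^'n^'m) (b::real^'n). norm (a *v b) \<le> norm a * norm b * K"
    by (intro exI[of _ 1]) (auto simp: norm_mult_vec_le)
qed (auto simp: vec_eq_iff matrix_vector_mult_def sum.distrib algebra_simps sum_distrib_left)

lemma norm_cross_le: "norm (x \<times> y) \<le> norm x * norm y"
proof -
  have "(norm (x \<times> y))\<^sup>2 \<le> (norm x * norm y)\<^sup>2"
    using norm_cross_dot[of x y] by (smt (verit) zero_le_power2)
  then show ?thesis by (rule power2_le_imp_le) auto
qed

lemma bounded_bilinear_cross: "bounded_bilinear (\<times>)"
proof
  show "\<exists>K. \<forall>a b. norm (a \<times> b) \<le> norm a * norm b * K"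
    by (intro exI[of _ 1]) (auto simp: norm_cross_le)
qed (auto simp: cross3_simps)

lemma bounded_linear_transpose: "bounded_linear (transpose :: real^'n^'m \<Rightarrow> real^'m^'n)"
  by (rule bounded_linear_intro[where K=1])
     (auto simp: transpose_def vec_eq_iff norm_transpose[unfolded transpose_def])

lemmas has_vector_derivative_matrix_mult =
  bounded_bilinear.has_vector_derivative[OF bounded_bilinear_matrix_mult]
lemmas has_vector_derivative_mult_vec =
  bounded_bilinear.has_vector_derivative[OF bounded_bilinear_mult_vec]
lemmas has_vector_derivative_inner =
  bounded_bilinear.has_vector_derivative[OF bounded_bilinear_inner]
lemmas has_vector_derivative_transpose =
  bounded_linear.has_vector_derivative[OF bounded_linear_transpose]
lemmas tendsto_mult_vec = bounded_bilinear.tendsto[OF bounded_bilinear_mult_vec]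
lemmas matrix_diff_left = bounded_bilinear.diff_left[OF bounded_bilinear_matrix_mult]
lemmas matrix_diff_right = bounded_bilinear.diff_right[OF bounded_bilinear_matrix_mult]
lemmas mult_vec_diff_left = bounded_bilinear.diff_left[OF bounded_bilinear_mult_vec]
lemmas mult_vec_diff_right = bounded_bilinear.diff_right[OF bounded_bilinear_mult_vec]
lemmas mult_vec_sum_right = bounded_bilinear.sum_right[OF bounded_bilinear_mult_vec]
lemmas transpose_diff = bounded_linear.linear[OF bounded_linear_transpose, THEN linear_diff]

lemma has_vector_derivative_vec_lambda:
  assumes "\<And>i. ((\<lambda>t. f t $ i) has_vector_derivative f' $ i) (at t within S)"
  shows "((f :: real \<Rightarrow> 'a::euclidean_space^'n) has_vector_derivative f') (at t within S)"
proof -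
  have "((\<lambda>t. f t \<bullet> axis i b) has_vector_derivative f' \<bullet> axis i b) (at t within S)" if "b \<in> Basis" for i b
    using bounded_linear.has_vector_derivative[OF bounded_linear_inner_left assms[of i], of b]
    by (simp add: inner_axis)
  then show ?thesis
    unfolding has_vector_derivative_def
    by (subst has_derivative_componentwise_within) (auto simp: Basis_vec_def inner_axis)
qed

lemma rotation_matrixD:
  assumes "rotation_matrix (R::real^'n^'n)"
  shows "transpose R ** R = mat 1" "R ** transpose R = mat 1"
    "transpose R *v (R *v x) = x" "R *v (transpose R *v x) = x"
  using assms by (auto simp: rotation_matrix_def orthogonal_matrix_def matrix_vector_mul_assoc)

lemma rotation_matrix_transpose: "rotation_matrix R \<Longrightarrow> rotation_matrix (transpose (R::real^'n^'n))"
  by (simp add: rotation_matrix_def det_transpose)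

lemma rotation_matrix_mult:
  "rotation_matrix R \<Longrightarrow> rotation_matrix S \<Longrightarrow> rotation_matrix ((R::real^'n^'n) ** S)"
  by (simp add: rotation_matrix_def orthogonal_matrix_mul det_mul)

lemma rotation_matrix_id: "rotation_matrix (mat 1 :: real^'n^'n)"
  by (simp add: rotation_matrix_def orthogonal_matrix_id)

lemma norm_rotation_mult_vec: "rotation_matrix R \<Longrightarrow> norm ((R::real^'n^'n) *v x) = norm x"
  by (metis orthogonal_transformation_matrix orthogonal_transformation_norm rotation_matrix_def
      matrix_of_matrix_vector_mul matrix_vector_mul_linear)

lemma norm_mult_rotation:
  assumes "rotation_matrix (R::real^'n^'n)" shows "norm (A ** R) = norm (A::real^'n^'m)"
proof -
  have row: "(A ** R) $ i = transpose R *v (A $ i)" for i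
    by (simp add: vec_eq_iff matrix_matrix_mult_def matrix_vector_mult_def transpose_def mult.commute)
  show ?thesis
    by (simp add: norm_vec_def[of "A ** R"] row norm_rotation_mult_vec rotation_matrix_transpose assms)
       (simp add: norm_vec_def[of A])
qed

lemma norm_rotation_mult:
  assumes "rotation_matrix (R::real^'n^'n)" shows "norm (R ** B) = norm (B::real^'k^'n)"
  using norm_mult_rotation[OF rotation_matrix_transpose[OF assms], of "transpose B"]
  by (simp add: norm_transpose flip: matrix_transpose_mul)

lemma norm_mat_1: "norm (mat 1 :: real^3^3) \<le> 2"
proof -
  have "norm (mat 1 :: real^3^3)^2 \<le> 2^2"
    by (simp only: power2_norm_eq_inner) (simp add: inner_vec_def sum_3 mat_def)
  then show ?thesis by (rule power2_le_imp_le) auto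
qed

lemma norm_rotation: "rotation_matrix (R::real^3^3) \<Longrightarrow> norm R \<le> 2"
  using norm_rotation_mult[of R "mat 1 :: real^3^3"] norm_mat_1 by simp

lemma closed_rotation_matrices: "closed {R :: real^3^3. rotation_matrix R}"
proof -
  have "{R :: real^3^3. rotation_matrix R} = {R. transpose R ** R = mat 1} \<inter> {R. det R = 1}"
    by (auto simp: rotation_matrix_def orthogonal_matrix)
  moreover have "closed {R :: real^3^3. transpose R ** R = mat 1}"
    by (intro closed_Collect_eq bounded_bilinear.continuous_on[OF bounded_bilinear_matrix_mult]
        bounded_linear.continuous_on[OF bounded_linear_transpose] continuous_intros)
  moreover have "closed {R :: real^3^3. det R = 1}"
    unfolding det_3 by (intro closed_Collect_eq continuous_intros)
  ultimately show ?thesis by auto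
qed

lemma compact_rotation_matrices: "compact {R :: real^3^3. rotation_matrix R}"
  using closed_rotation_matrices norm_rotation
  by (auto simp: compact_eq_bounded_closed bounded_iff)

lemma hat_expand: "hat w = vector [vector [0, - w$3, w$2], vector [w$3, 0, - w$1], vector [- w$2, w$1, 0]]"
  by (simp add: hat_def matrix_def cross3_def vec_eq_iff forall_3 axis_def)

lemma hat_mult: "hat w *v v = w \<times> v"
  by (simp add: hat_expand cross3_def matrix_vector_mult_def sum_3 vec_eq_iff forall_3)

definition vee :: "real^3^3 \<Rightarrow> real^3" where
  "vee A = vector [(A$3$2 - A$2$3)/2, (A$1$3 - A$3$1)/2, (A$2$1 - A$1$2)/2]"

lemma vee_hat: "vee (hat w) = w"
  by (simp add: vee_def hat_expand vec_eq_iff forall_3)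

lemma hat_vee: "hat (vee A) = (1/2) *\<^sub>R (A - transpose A)"
  by (simp add: vee_def hat_expand vec_eq_iff forall_3 transpose_def field_simps)

lemma transpose_hat: "transpose (hat w) = - hat w"
  by (simp add: hat_expand vec_eq_iff forall_3 transpose_def)

lemma norm_hat: "norm (hat w) \<le> 2 * norm w"
proof -
  have "(norm (hat w))\<^sup>2 \<le> (2 * norm w)\<^sup>2"
    unfolding power_mult_distrib
    by (simp only: power2_norm_eq_inner) (simp add: inner_vec_def sum_3 hat_expand)
  then show ?thesis by (rule power2_le_imp_le) auto
qed

lemma norm_vee: "norm (vee A) \<le> norm A"
proof -
  have *: "(x - y) * (x - y) / (2 * 2) \<le> x * x + y * y" for x y :: real
  proof -
    have "0 \<le> (x + y) * (x + y)" "0 \<le> x * x" "0 \<le> y * y" by auto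
    then have "0 \<le> 3 * (x * x) + 2 * (x * y) + 3 * (y * y)" by (simp only: distrib_left distrib_right mult.commute[of y x])
    then show ?thesis by (simp add: algebra_simps)
  qed
  have "(norm (vee A))\<^sup>2 \<le> (norm A)\<^sup>2"
    using *[of "A$3$2" "A$2$3"] *[of "A$1$3" "A$3$1"] *[of "A$2$1" "A$1$2"]
      zero_le_square[of "A$1$1"] zero_le_square[of "A$2$2"] zero_le_square[of "A$3$3"]
    unfolding power2_norm_eq_inner inner_vec_def sum_3 vee_def vector_3 inner_real_def times_divide_times_eq
    by linarith
  then show ?thesis by (rule power2_le_imp_le) auto
qed

lemma bounded_linear_vee: "bounded_linear vee"
  by (rule bounded_linear_intro[where K=1])
     (auto simp: norm_vee, auto simp: vee_def vec_eq_iff forall_3 field_simps)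

lemma bounded_linear_hat: "bounded_linear hat"
proof (rule bounded_linear_intro[where K=2])
  show "norm (hat w) \<le> norm w * 2" for w using norm_hat[of w] by simp
qed (auto simp: hat_expand vec_eq_iff forall_3 field_simps)

lemmas hat_diff = bounded_linear.linear[OF bounded_linear_hat, THEN linear_diff]
lemmas vee_diff = bounded_linear.linear[OF bounded_linear_vee, THEN linear_diff]
lemmas vee_add = bounded_linear.linear[OF bounded_linear_vee, THEN linear_add]
lemmas has_vector_derivative_vee = bounded_linear.has_vector_derivative[OF bounded_linear_vee]

lemma rotation_hat_conj:
  assumes "rotation_matrix R" shows "R ** hat w ** transpose R = hat (R *v w)"
proof -
  have "(R ** hat w ** transpose R) *v v = hat (R *v w) *v v" for v
    using cross_rotation_matrix[OF assms, of w "transpose R *v v"] assms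
    by (simp add: hat_mult matrix_vector_mul_assoc[symmetric] rotation_matrixD)
  then show ?thesis by (simp add: matrix_eq)
qed

text \<open>Near the identity a rotation is determined by its skew part.\<close>

text \<open>Orthogonality of \<open>G = 1 + B\<close> reads \<open>B + B\<^sup>T = - B\<^sup>T B\<close>: the symmetric part of \<open>B\<close> is of second
  order. So \<open>vee B\<close> is a chart of the rotation group at the identity whose error is quadratic.\<close>

lemma rotation_minus_id:
  assumes "rotation_matrix G" and B: "B = G - mat 1"
  shows "norm (B - hat (vee B)) \<le> (norm B)\<^sup>2 / 2"
    and "norm B \<le> 1/2 \<Longrightarrow> norm B \<le> 3 * norm (vee B)"
proof -
  have "transpose B ** B = - B - transpose B"
    using rotation_matrixD(1)[OF assms(1)]
    by (simp add: B matrix_diff_left matrix_diff_right transpose_diff algebra_simps)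
  then have eq: "B - hat (vee B) = - (1/2) *\<^sub>R (transpose B ** B)"
    by (simp only: hat_vee) (simp add: vec_eq_iff field_simps)
  have "norm (transpose B ** B) \<le> norm B * norm B"
    using norm_matrix_mult_le[of "transpose B" B] by (simp add: norm_transpose)
  then show 1: "norm (B - hat (vee B)) \<le> (norm B)\<^sup>2 / 2"
    by (simp add: eq power2_eq_square)
  assume small: "norm B \<le> 1/2"
  have "norm B \<le> norm (hat (vee B)) + norm (B - hat (vee B))"
    by (metis add.commute diff_add_cancel norm_triangle_ineq)
  also have "\<dots> \<le> 2 * norm (vee B) + norm B * (1/2) / 2"
    using 1 norm_hat[of "vee B"] mult_left_mono[OF small norm_ge_zero[of B]] by (simp add: power2_eq_square)
  finally show "norm B \<le> 3 * norm (vee B)"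
    using norm_ge_zero[of "vee B"] by linarith
qed

section \<open>Differential inequalities\<close>

text \<open>Derivatives are taken within the half line throughout, since solutions live on it and are
  differentiable at its end point only in this sense.\<close>

lemma nonincreasing_on:
  fixes f :: "real \<Rightarrow> real"
  assumes "0 \<le> a" "a \<le> b"
    and "\<And>t. a \<le> t \<Longrightarrow> t \<le> b \<Longrightarrow> \<exists>D. (f has_real_derivative D) (at t within {0..}) \<and> D \<le> 0"
  shows "f b \<le> f a"
proof (rule DERIV_nonpos_imp_decreasing_open[OF assms(2)])
  fix x assume "a < x" "x < b"
  then show "\<exists>y. DERIV f x :> y \<and> y \<le> 0"
    using assms(3)[of x] assms(1) at_within_interior[of x "{0..}"] by auto
next
  have "continuous (at t within {a..b}) f" if t: "t \<in> {a..b}" for t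
  proof -
    obtain D where "(f has_real_derivative D) (at t within {0..})" using assms(3)[of t] t by auto
    then have "(f has_real_derivative D) (at t within {a..b})"
      by (rule DERIV_subset) (use assms(1) in auto)
    then show ?thesis by (rule DERIV_continuous)
  qed
  then show "continuous_on {a..b} f" by (simp add: continuous_on_eq_continuous_within)
qed

lemma exponential_comparison:
  fixes v :: "real \<Rightarrow> real"
  assumes "0 \<le> a" "a \<le> b"
    and d: "\<And>t. a \<le> t \<Longrightarrow> t \<le> b \<Longrightarrow> \<exists>D. (v has_real_derivative D) (at t within {0..}) \<and> D \<le> \<mu> * v t"
  shows "v b \<le> exp (\<mu> * (b - a)) * v a"
proof -
  have "v b * exp (- \<mu> * b) \<le> v a * exp (- \<mu> * a)"
  proof (rule nonincreasing_on[OF assms(1,2)])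
    fix t assume "a \<le> t" "t \<le> b"
    then obtain D where D: "(v has_real_derivative D) (at t within {0..})" "D \<le> \<mu> * v t"
      using d by blast
    have "((\<lambda>t. v t * exp (- \<mu> * t)) has_real_derivative D * exp (- \<mu> * t) + v t * (exp (- \<mu> * t) * (- \<mu>)))
        (at t within {0..})"
      by (auto intro!: derivative_eq_intros D(1))
    moreover have "D * exp (- \<mu> * t) + v t * (exp (- \<mu> * t) * (- \<mu>)) = (D - \<mu> * v t) * exp (- \<mu> * t)"
      by (simp add: algebra_simps)
    then have "D * exp (- \<mu> * t) + v t * (exp (- \<mu> * t) * (- \<mu>)) \<le> 0"
      using D(2) by (simp add: mult_nonpos_nonneg)
    ultimately show "\<exists>D. ((\<lambda>t. v t * exp (- \<mu> * t)) has_real_derivative D) (at t within {0..}) \<and> D \<le> 0"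
      by blast
  qed
  then have "v b * exp (- \<mu> * b) * exp (\<mu> * b) \<le> v a * exp (- \<mu> * a) * exp (\<mu> * b)"
    by (rule mult_right_mono) simp
  then show ?thesis by (simp add: mult.assoc mult.commute algebra_simps flip: exp_add)
qed

lemma backward_comparison:
  fixes v :: "real \<Rightarrow> real"
  assumes "0 \<le> a" "a \<le> b"
    and d: "\<And>t. a \<le> t \<Longrightarrow> t \<le> b \<Longrightarrow> \<exists>D. (v has_real_derivative D) (at t within {0..}) \<and> - C * v t \<le> D"
  shows "v a \<le> exp (C * (b - a)) * v b"
proof -
  have "- v b \<le> exp (- C * (b - a)) * (- v a)"
  proof (rule exponential_comparison[OF assms(1,2)])
    fix t assume "a \<le> t" "t \<le> b"
    then obtain D where "(v has_real_derivative D) (at t within {0..})" "- C * v t \<le> D"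
      using d by blast
    then show "\<exists>D. ((\<lambda>t. - v t) has_real_derivative D) (at t within {0..}) \<and> D \<le> - C * - v t"
      by (intro exI[of _ "- D"]) (auto intro: derivative_intros)
  qed
  then have "exp (C * (b - a)) * (exp (- C * (b - a)) * v a) \<le> exp (C * (b - a)) * v b"
    by (intro mult_left_mono) auto
  then show ?thesis by (simp flip: mult.assoc exp_add)
qed

lemma has_real_derivative_norm_power2:
  assumes "(e has_vector_derivative e') (at t within S)"
  shows "((\<lambda>t. (norm (e t :: 'a::euclidean_space))\<^sup>2) has_real_derivative 2 * (e t \<bullet> e')) (at t within S)"
  using has_vector_derivative_inner[OF assms assms]
  by (simp add: power2_norm_eq_inner has_real_derivative_iff_has_vector_derivative inner_commute)

text \<open>By Young's inequality \<open>\<bar>e\<bar>\<^sup>2 - M\<^sup>2 / \<alpha>\<^sup>2\<close> decays at rate \<open>\<alpha>\<close>; working with the square avoids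
  the points where the norm is not differentiable.\<close>

lemma stable_forced_norm_bound:
  fixes e :: "real \<Rightarrow> 'a::euclidean_space"
  assumes "0 \<le> a" "a \<le> b" "\<alpha> > 0" "M \<ge> 0"
    and d: "\<And>t. a \<le> t \<Longrightarrow> t \<le> b \<Longrightarrow> \<exists>e'. (e has_vector_derivative e') (at t within {0..}) \<and>
          e t \<bullet> e' \<le> - \<alpha> * (norm (e t))\<^sup>2 + M * norm (e t)"
  shows "(norm (e b))\<^sup>2 \<le> exp (- \<alpha> * (b - a)) * (norm (e a))\<^sup>2 + M\<^sup>2 / \<alpha>\<^sup>2"
proof -
  have "(norm (e b))\<^sup>2 - M\<^sup>2 / \<alpha>\<^sup>2 \<le> exp (- \<alpha> * (b - a)) * ((norm (e a))\<^sup>2 - M\<^sup>2 / \<alpha>\<^sup>2)"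
  proof (rule exponential_comparison[OF assms(1,2)])
    fix t assume "a \<le> t" "t \<le> b"
    then obtain e' where e': "(e has_vector_derivative e') (at t within {0..})"
       "e t \<bullet> e' \<le> - \<alpha> * (norm (e t))\<^sup>2 + M * norm (e t)" using d by blast
    have "0 \<le> (\<alpha> * norm (e t) - M)\<^sup>2 / \<alpha>" using assms by simp
    also have "\<dots> = \<alpha> * (norm (e t))\<^sup>2 - 2 * M * norm (e t) + M\<^sup>2 / \<alpha>"
      using assms by (simp add: power2_diff power2_eq_square field_simps)
    finally have "2 * (e t \<bullet> e') \<le> - \<alpha> * (norm (e t))\<^sup>2 + M\<^sup>2 / \<alpha>" using e'(2) by linarith
    also have "\<dots> = - \<alpha> * ((norm (e t))\<^sup>2 - M\<^sup>2 / \<alpha>\<^sup>2)"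
      using assms by (simp add: power2_eq_square field_simps)
    finally show "\<exists>D. ((\<lambda>t. (norm (e t))\<^sup>2 - M\<^sup>2 / \<alpha>\<^sup>2) has_real_derivative D) (at t within {0..}) \<and>
         D \<le> - \<alpha> * ((norm (e t))\<^sup>2 - M\<^sup>2 / \<alpha>\<^sup>2)"
      using DERIV_diff[OF has_real_derivative_norm_power2[OF e'(1)] DERIV_const]
      by (intro exI[of _ "2 * (e t \<bullet> e') - 0"]) simp
  qed
  moreover have "exp (- \<alpha> * (b - a)) * (M\<^sup>2 / \<alpha>\<^sup>2) \<ge> 0" by simp
  ultimately show ?thesis by (simp only: right_diff_distrib)
qed

lemma exp_neg_tendsto_0: "\<alpha> > 0 \<Longrightarrow> ((\<lambda>t::real. exp (- \<alpha> * (t - a))) \<longlongrightarrow> 0) at_top"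
proof -
  assume "\<alpha> > 0"
  have "filterlim (\<lambda>t. - a + t) at_top at_top"
    by (rule filterlim_tendsto_add_at_top[OF tendsto_const filterlim_ident])
  then have "filterlim (\<lambda>t. - \<alpha> * (t - a)) at_bot at_top"
    using \<open>\<alpha> > 0\<close> by (intro filterlim_tendsto_neg_mult_at_bot[OF tendsto_const]) auto
  then show ?thesis by (rule filterlim_compose[OF exp_at_bot])
qed

lemma vanishing_forcing_tendsto_0:
  fixes e :: "real \<Rightarrow> 'a::euclidean_space"
  assumes "\<alpha> > 0" and \<rho>: "(\<rho> \<longlongrightarrow> 0) at_top"
    and d: "eventually (\<lambda>t. \<exists>e'. (e has_vector_derivative e') (at t within {0..}) \<and>
          e t \<bullet> e' \<le> - \<alpha> * (norm (e t))\<^sup>2 + \<rho> t * norm (e t)) at_top"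
  shows "(e \<longlongrightarrow> 0) at_top"
proof (rule tendstoI)
  fix \<epsilon> :: real assume \<epsilon>: "\<epsilon> > 0"
  define M where "M = \<alpha> * \<epsilon> / 2"
  have M: "M > 0" using \<epsilon> assms by (simp add: M_def)
  have "eventually (\<lambda>t. \<bar>\<rho> t\<bar> < M) at_top"
    using tendstoD[OF \<rho> M] by (simp add: dist_real_def)
  with d have "eventually (\<lambda>t. t \<ge> 0 \<and> \<bar>\<rho> t\<bar> < M \<and> (\<exists>e'. (e has_vector_derivative e') (at t within {0..}) \<and>
          e t \<bullet> e' \<le> - \<alpha> * (norm (e t))\<^sup>2 + \<rho> t * norm (e t))) at_top"
    using eventually_ge_at_top[of 0] by eventually_elim auto
  then obtain T0 where T0: "\<And>t. t \<ge> T0 \<Longrightarrow> t \<ge> 0 \<and> \<bar>\<rho> t\<bar> < M \<and> (\<exists>e'. (e has_vector_derivative e') (at t within {0..}) \<and>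
          e t \<bullet> e' \<le> - \<alpha> * (norm (e t))\<^sup>2 + \<rho> t * norm (e t))"
    by (auto simp: eventually_at_top_linorder)
  have bnd: "(norm (e t))\<^sup>2 \<le> exp (- \<alpha> * (t - T0)) * (norm (e T0))\<^sup>2 + \<epsilon>\<^sup>2 / 4" if t: "t \<ge> T0" for t
  proof -
    have "(norm (e t))\<^sup>2 \<le> exp (- \<alpha> * (t - T0)) * (norm (e T0))\<^sup>2 + M\<^sup>2 / \<alpha>\<^sup>2"
    proof (rule stable_forced_norm_bound)
      fix s assume "T0 \<le> s"
      then obtain e' where e': "(e has_vector_derivative e') (at s within {0..})"
          "e s \<bullet> e' \<le> - \<alpha> * (norm (e s))\<^sup>2 + \<rho> s * norm (e s)" "\<bar>\<rho> s\<bar> < M"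
        using T0 by blast
      have "\<rho> s * norm (e s) \<le> M * norm (e s)" using e'(3) by (intro mult_right_mono) auto
      with e' show "\<exists>e'. (e has_vector_derivative e') (at s within {0..}) \<and>
          e s \<bullet> e' \<le> - \<alpha> * (norm (e s))\<^sup>2 + M * norm (e s)" by (intro exI[of _ e']) auto
    qed (use t T0[of T0] assms M in auto)
    also have "M\<^sup>2 / \<alpha>\<^sup>2 = \<epsilon>\<^sup>2 / 4" using assms by (simp add: M_def power_mult_distrib power_divide)
    finally show ?thesis .
  qed
  have "((\<lambda>t. exp (- \<alpha> * (t - T0)) * (norm (e T0))\<^sup>2 + \<epsilon>\<^sup>2 / 4) \<longlongrightarrow> 0 * (norm (e T0))\<^sup>2 + \<epsilon>\<^sup>2 / 4) at_top"
    by (intro tendsto_intros exp_neg_tendsto_0 assms)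
  then have "eventually (\<lambda>t. exp (- \<alpha> * (t - T0)) * (norm (e T0))\<^sup>2 + \<epsilon>\<^sup>2 / 4 < \<epsilon>\<^sup>2) at_top"
    by (rule order_tendstoD) (use \<epsilon> in auto)
  then show "eventually (\<lambda>t. dist (e t) 0 < \<epsilon>) at_top"
    using eventually_ge_at_top[of T0]
  proof eventually_elim
    case (elim t)
    then have "(norm (e t))\<^sup>2 < \<epsilon>\<^sup>2" using bnd[of t] by linarith
    then show ?case using \<epsilon> by (simp add: power2_less_imp_less)
  qed
qed

text \<open>If \<open>g\<close> exceeded \<open>\<epsilon>\<close> at arbitrarily late times, it would, being Lipschitz from below, exceed
  \<open>\<epsilon> / 2\<close> on intervals of a fixed length after these times, on each of which \<open>Y\<close> loses a fixed amount.\<close>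

lemma barbalat_dissipation:
  fixes Y g :: "real \<Rightarrow> real"
  assumes "T0 \<ge> 0" "c > 0" "L > 0"
    and g0: "\<And>t. t \<ge> T0 \<Longrightarrow> g t \<ge> 0"
    and lip: "\<And>s t. T0 \<le> s \<Longrightarrow> s \<le> t \<Longrightarrow> g s - L * (t - s) \<le> g t"
    and bdd: "\<And>t. t \<ge> T0 \<Longrightarrow> Y t \<ge> m"
    and d: "\<And>t. t \<ge> T0 \<Longrightarrow> \<exists>D. (Y has_real_derivative D) (at t within {0..}) \<and> D \<le> - c * g t"
  shows "(g \<longlongrightarrow> 0) at_top"
proof (rule tendstoI)
  fix \<epsilon> :: real assume \<epsilon>: "\<epsilon> > 0"
  have dec: "Y t \<le> Y s" if "T0 \<le> s" "s \<le> t" for s t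
  proof (rule nonincreasing_on[of s t Y])
    fix r assume "s \<le> r" "r \<le> t"
    then show "\<exists>D. (Y has_real_derivative D) (at r within {0..}) \<and> D \<le> 0"
      using d[of r] g0[of r] that assms(2)
      by (smt (verit, ccfv_threshold) mult_minus_left mult_nonneg_nonneg)
  qed (use that assms(1) in auto)
  define I where "I = Inf (Y ` {T0..})"
  have bb: "bdd_below (Y ` {T0..})" using bdd by (auto intro!: bdd_belowI2[of _ m])
  define h where "h = \<epsilon> / (2 * L)"
  define \<eta> where "\<eta> = c * (\<epsilon> / 2) * h"
  have pos: "h > 0" "\<eta> > 0" using assms(2,3) \<epsilon> by (auto simp: h_def \<eta>_def)
  have "I < I + \<eta>" using pos by simp
  then obtain T1 where T1: "T1 \<ge> T0" "Y T1 < I + \<eta>"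
    using cInf_lessD[of "Y ` {T0..}" "I + \<eta>"] by (auto simp: I_def)
  have "g t < \<epsilon>" if t: "t \<ge> T1" for t
  proof (rule ccontr)
    assume "\<not> g t < \<epsilon>"
    then have gt: "g t \<ge> \<epsilon>" by simp
    \<comment> \<open>While \<open>g\<close> stays above \<open>\<epsilon>/2\<close>, the function \<open>Y\<close> loses more than it still can.\<close>
    have "Y (t + h) + c * (\<epsilon> / 2) * (t + h) \<le> Y t + c * (\<epsilon> / 2) * t"
    proof (rule nonincreasing_on[of t "t + h" "\<lambda>s. Y s + c * (\<epsilon> / 2) * s"])
      fix r assume r: "t \<le> r" "r \<le> t + h"
      have "L * (r - t) \<le> L * h" using r assms(3) by (intro mult_left_mono) auto
      also have "\<dots> = \<epsilon> / 2" using assms(3) by (simp add: h_def)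
      finally have "g r \<ge> \<epsilon> / 2" using lip[of t r] r gt t T1 by auto
      then have "c * g r \<ge> c * (\<epsilon> / 2)" using assms(2) by (intro mult_left_mono) auto
      moreover obtain D where "(Y has_real_derivative D) (at r within {0..})" "D \<le> - c * g r"
        using d[of r] r t T1 by auto
      ultimately show "\<exists>D. ((\<lambda>s. Y s + c * (\<epsilon> / 2) * s) has_real_derivative D) (at r within {0..}) \<and> D \<le> 0"
        by (intro exI[of _ "D + c * (\<epsilon> / 2)"]) (auto intro!: derivative_eq_intros)
    qed (use assms(1) T1 t pos in auto)
    then have "Y (t + h) \<le> Y t - \<eta>"
      unfolding \<eta>_def by (simp only: distrib_left)
    also have "\<dots> < I" using dec[of T1 t] T1 t by auto
    also have "I \<le> Y (t + h)" unfolding I_def using T1 t pos bb by (intro cInf_lower) auto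
    finally show False by simp
  qed
  then show "eventually (\<lambda>t. dist (g t) 0 < \<epsilon>) at_top"
    using g0 T1 unfolding eventually_at_top_linorder by (intro exI[of _ T1]) (auto simp: abs_of_nonneg)
qed

section \<open>Linear systems are input-to-state stable\<close>

text \<open>The set of times up to which the increase of \<open>f\<close> is at most \<open>\<epsilon>\<close> per unit time has a greatest
  element, which cannot lie before \<open>b\<close>.\<close>

lemma dini_nonincreasing:
  fixes f :: "real \<Rightarrow> real"
  assumes ab: "a \<le> b" and cont: "continuous_on {a..b} f"
    and dini: "\<And>t \<epsilon>. a \<le> t \<Longrightarrow> t < b \<Longrightarrow> \<epsilon> > 0 \<Longrightarrow> \<exists>\<delta>>0. \<forall>h. 0 < h \<and> h < \<delta> \<and> t + h \<le> b \<longrightarrow> f (t + h) \<le> f t + \<epsilon> * h"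
  shows "f b \<le> f a"
proof -
  have "f b \<le> f a + \<epsilon> * (b - a)" if \<epsilon>: "\<epsilon> > 0" for \<epsilon>
  proof -
    define S where "S = {t \<in> {a..b}. f t - \<epsilon> * t \<le> f a - \<epsilon> * a}"
    have "closed S" unfolding S_def
      by (intro continuous_on_closed_Collect_le cont continuous_intros closed_real_atLeastAtMost)
    moreover have aS: "a \<in> S" using ab by (simp add: S_def)
    moreover have bb: "bdd_above S" by (auto simp: S_def intro: bdd_aboveI[of _ b])
    ultimately have s: "Sup S \<in> S" using closed_contains_Sup by blast
    have "Sup S = b"
    proof (rule ccontr)
      assume "Sup S \<noteq> b"
      with s have lt: "a \<le> Sup S" "Sup S < b" by (auto simp: S_def)
      then obtain \<delta> where \<delta>: "\<delta> > 0" "\<And>h. 0 < h \<Longrightarrow> h < \<delta> \<Longrightarrow> Sup S + h \<le> b \<Longrightarrow> f (Sup S + h) \<le> f (Sup S) + \<epsilon> * h"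
        using dini[of "Sup S" \<epsilon>] \<epsilon> by blast
      define h where "h = min (\<delta>/2) (b - Sup S)"
      have h: "0 < h" "h < \<delta>" "Sup S + h \<le> b" using \<delta>(1) lt by (auto simp: h_def min_def)
      then have "Sup S + h \<in> S" using \<delta>(2)[OF h] s lt by (auto simp: S_def algebra_simps)
      then show False using cSup_upper[OF _ bb] h by fastforce
    qed
    then show ?thesis using s by (simp add: S_def algebra_simps)
  qed
  then have "f b \<le> f a + \<epsilon>" if "\<epsilon> > 0" for \<epsilon>
  proof (cases "a = b")
    case False
    then have "b - a > 0" using ab by simp
    then show ?thesis using \<open>\<And>\<epsilon>. \<epsilon> > 0 \<Longrightarrow> _\<close>[of "\<epsilon> / (b - a)"] that by simp
  qed (use that in auto)
  then show ?thesis by (rule field_le_epsilon)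
qed

lemma continuous_on_atLeast:
  fixes g :: "real \<Rightarrow> 'a::topological_space"
  assumes "\<And>T. continuous_on {a..T} g"
  shows "continuous_on {a..} g"
proof -
  have "continuous (at t within {a..}) g" if t: "t \<ge> a" for t
  proof -
    have "continuous (at t within {a..t+1}) g"
      using assms[of "t+1"] t by (simp add: continuous_on_eq_continuous_within)
    moreover have "at t within {a..t+1} = at t within {a..}"
      by (rule at_within_nhd[of t "{..<t+1}"]) auto
    ultimately show ?thesis by simp
  qed
  then show ?thesis by (simp add: continuous_on_eq_continuous_within)
qed

text \<open>Picard iteration. It is done for the integral equation, in which a measurable input enters only through
  its continuous primitive.\<close>

lemma volterra_solution:
  fixes A :: "'a::euclidean_space \<Rightarrow> 'a" and c :: "real \<Rightarrow> 'a"
  assumes A: "bounded_linear A" and c: "continuous_on {a..} c"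
  obtains z where "continuous_on {a..} z" "\<And>t. t \<ge> a \<Longrightarrow> z t = c t - integral {a..t} (\<lambda>s. A (z s))"
proof -
  obtain K where K: "K > 0" "\<And>x. norm (A x) \<le> norm x * K"
    using bounded_linear.pos_bounded[OF A] by blast
  have contA: "continuous_on S (\<lambda>s. A (g s))" if "continuous_on S g" for S :: "real set" and g
    by (rule bounded_linear.continuous_on[OF A that])
  define step where "step = (\<lambda>(z :: real \<Rightarrow> 'a) t. c t - integral {a..t} (\<lambda>s. A (z s)))"
  define Z where "Z n = (step ^^ n) c" for n
  have Z_Suc: "Z (Suc n) t = c t - integral {a..t} (\<lambda>s. A (Z n s))" for n t
    by (simp add: Z_def step_def)
  have sub: "continuous_on {a..t} g" if "continuous_on {a..} g" for t :: real and g :: "real \<Rightarrow> 'a"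
    by (rule continuous_on_subset[OF that]) auto
  have cont_int: "continuous_on {a..} (\<lambda>t. integral {a..t} g)" if "continuous_on {a..} g" for g :: "real \<Rightarrow> 'a"
  proof -
    have "continuous_on {a..T} (\<lambda>t. integral {a..t} g)" for T
      by (intro indefinite_integral_continuous_1 integrable_continuous_real sub that)
    then show ?thesis by (rule continuous_on_atLeast)
  qed
  have Zc: "continuous_on {a..} (Z n)" for n
  proof (induction n)
    case (Suc n)
    have "continuous_on {a..} (\<lambda>t. c t - integral {a..t} (\<lambda>s. A (Z n s)))"
      by (intro continuous_intros c cont_int contA Suc)
    then show ?case by (simp add: Z_Suc[abs_def] fun_eq_iff cong: continuous_on_cong)
  qed (simp add: Z_def c)
  have Zi: "(\<lambda>s. A (Z n s)) integrable_on {a..t}" for n t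
    by (intro integrable_continuous_real sub contA Zc)
  define D where "D n t = Z (Suc n) t - Z n t" for n t
  have D_eq: "D (Suc n) t = - integral {a..t} (\<lambda>s. A (D n s))" for n t
    using integral_diff[OF Zi[of "Suc n" t] Zi[of n t]]
    by (simp add: D_def Z_Suc linear_diff[OF bounded_linear.linear[OF A]])
  have Dc: "continuous_on {a..} (D n)" for n
    unfolding D_def by (intro continuous_intros Zc)
  \<comment> \<open>In the norm weighted by \<open>exp (2 K (t - a))\<close> each iteration halves the difference.\<close>
  have D_le: "norm (D n t) \<le> M * (1/2)^n * exp (2 * K * (t - a))"
    if M: "\<And>t. a \<le> t \<Longrightarrow> t \<le> T \<Longrightarrow> norm (D 0 t) \<le> M" "M \<ge> 0" and t: "a \<le> t" "t \<le> T" for M T n t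
    using t
  proof (induction n arbitrary: t)
    case 0
    have "M * 1 \<le> M * exp (2 * K * (t - a))" using M(2) 0 K by (intro mult_left_mono) auto
    then show ?case using M(1)[OF 0] by simp
  next
    case (Suc n)
    let ?F = "\<lambda>s. M * (1/2)^(Suc n) * exp (2 * K * (s - a))"
    have F: "((\<lambda>s. K * (M * (1/2)^n * exp (2 * K * (s - a)))) has_integral ?F t - ?F a) {a..t}"
      by (rule fundamental_theorem_of_calculus)
         (use Suc.prems in \<open>auto intro!: derivative_eq_intros simp flip: has_real_derivative_iff_has_vector_derivative\<close>)
    have "norm (D (Suc n) t) = norm (integral {a..t} (\<lambda>s. A (D n s)))" by (simp add: D_eq)
    also have "\<dots> \<le> integral {a..t} (\<lambda>s. K * (M * (1/2)^n * exp (2 * K * (s - a))))"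
    proof (rule integral_norm_bound_integral)
      show "(\<lambda>s. A (D n s)) integrable_on {a..t}"
        by (intro integrable_continuous_real sub contA Dc)
      show "(\<lambda>s. K * (M * (1/2)^n * exp (2 * K * (s - a)))) integrable_on {a..t}" using F by blast
      fix s assume s: "s \<in> {a..t}"
      have "norm (A (D n s)) \<le> norm (D n s) * K" by (rule K)
      also have "\<dots> \<le> (M * (1/2)^n * exp (2 * K * (s - a))) * K"
        using s Suc.prems K by (intro mult_right_mono Suc.IH) auto
      finally show "norm (A (D n s)) \<le> K * (M * (1/2)^n * exp (2 * K * (s - a)))" by (simp add: mult.commute)
    qed
    also have "\<dots> = ?F t - ?F a" using F by (rule integral_unique)
    also have "\<dots> \<le> ?F t" using M by simp
    finally show ?case .
  qed
  define z where "z t = c t + (\<Sum>n. D n t)" for t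
  have Z_sum: "Z n t = c t + (\<Sum>i<n. D i t)" for n t
    by (induction n) (auto simp: D_def Z_def)
  have unif: "uniform_limit {a..T} Z z sequentially" for T
  proof -
    have "compact (D 0 ` {a..T})" by (intro compact_continuous_image sub Dc) auto
    then have "bounded (D 0 ` {a..T})" by (rule compact_imp_bounded)
    then obtain M where M: "M > 0" "\<And>t. a \<le> t \<Longrightarrow> t \<le> T \<Longrightarrow> norm (D 0 t) \<le> M"
      unfolding bounded_pos by auto
    have "uniform_limit {a..T} (\<lambda>n t. \<Sum>i<n. D i t) (\<lambda>t. \<Sum>i. D i t) sequentially"
    proof (rule Weierstrass_m_test)
      fix n t assume t: "t \<in> {a..T}"
      have "norm (D n t) \<le> M * (1/2)^n * exp (2 * K * (t - a))" using D_le[of T M t n] M t by auto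
      also have "\<dots> \<le> M * (1/2)^n * exp (2 * K * (T - a))" using M t K by (intro mult_left_mono) auto
      finally show "norm (D n t) \<le> M * (1/2)^n * exp (2 * K * (T - a))" .
    next
      show "summable (\<lambda>n. M * (1/2::real)^n * exp (2 * K * (T - a)))"
        by (intro summable_mult summable_mult2 summable_geometric) auto
    qed
    then show ?thesis
      unfolding z_def[abs_def] Z_sum[abs_def] by (intro uniform_limit_add uniform_limit_const)
  qed
  have zc: "continuous_on {a..} z"
  proof -
    have "continuous_on {a..T} z" for T
      by (rule uniform_limit_theorem[OF _ unif]) (auto intro!: always_eventually sub Zc)
    then show ?thesis by (rule continuous_on_atLeast)
  qed
  moreover have "z t = c t - integral {a..t} (\<lambda>s. A (z s))" if t: "t \<ge> a" for t
  proof -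
    have "uniform_limit {a..t} (\<lambda>n s. A (Z n s)) (\<lambda>s. A (z s)) sequentially"
      by (rule bounded_linear.uniform_limit[OF A unif])
    then obtain I J where I: "\<And>n. ((\<lambda>s. A (Z n s)) has_integral I n) {a..t}"
        "((\<lambda>s. A (z s)) has_integral J) {a..t}" "I \<longlonglongrightarrow> J"
      by (rule uniform_limit_integral) (auto intro: sub contA Zc)
    then have "(\<lambda>n. integral {a..t} (\<lambda>s. A (Z n s))) \<longlonglongrightarrow> integral {a..t} (\<lambda>s. A (z s))"
      by (simp add: integral_unique[OF I(1)] integral_unique[OF I(2)])
    then have "(\<lambda>n. Z (Suc n) t) \<longlonglongrightarrow> c t - integral {a..t} (\<lambda>s. A (z s))"
      unfolding Z_Suc by (intro tendsto_intros)
    moreover have "(\<lambda>n. Z (Suc n) t) \<longlonglongrightarrow> z t"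
      using tendsto_uniform_limitI[OF unif, of t t] t by (intro LIMSEQ_Suc) auto
    ultimately show ?thesis using LIMSEQ_unique by blast
  qed
  ultimately show ?thesis using that by blast
qed

lemma admissible_input_absolutely_integrable:
  assumes "admissible_input a u"
  shows "u absolutely_integrable_on {a..t}"
proof (cases "a \<le> t")
  case True
  then obtain M where M: "\<And>s. s \<in> {a..t} \<Longrightarrow> norm (u s) \<le> M"
    using assms unfolding admissible_input_def bounded_iff by blast
  have "u \<in> borel_measurable (lebesgue_on {a..t})"
    using assms unfolding admissible_input_def by (auto intro: measurable_restrict_mono)
  then show ?thesis
    by (rule measurable_bounded_by_integrable_imp_absolutely_integrable[where g="\<lambda>_. M"])
       (use M in auto)
qed (simp add: absolutely_integrable_on_def)

text \<open>One explicit Euler step of \<open>z' = - A z\<close> contracts at a rate that loses an arbitrary part of the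
  exact one; half of it is kept.\<close>

lemma strongly_monotone_step:
  fixes A :: "'a::euclidean_space \<Rightarrow> 'a"
  assumes A: "bounded_linear A" and "\<beta> > 0" and mono: "\<And>x. 2 * \<beta> * (norm x)\<^sup>2 \<le> x \<bullet> A x"
  obtains h0 where "h0 > 0" "\<And>h. 0 < h \<Longrightarrow> h < h0 \<Longrightarrow> 0 \<le> 1 - \<beta> * h"
    "\<And>h x. 0 < h \<Longrightarrow> h < h0 \<Longrightarrow> norm (x - h *\<^sub>R A x) \<le> (1 - \<beta> * h) * norm x"
proof -
  obtain K where K: "K > 0" "\<And>x. norm (A x) \<le> norm x * K"
    using bounded_linear.pos_bounded[OF A] by blast
  define h0 where "h0 = min (1 / \<beta>) (2 * \<beta> / K\<^sup>2)"
  show ?thesis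
  proof (rule that[of h0])
    show "h0 > 0" using K assms by (simp add: h0_def)
    fix h x assume h: "0 < h" "h < h0"
    then show pos: "0 \<le> 1 - \<beta> * h" using assms by (simp add: h0_def field_simps)
    have hK: "h * K\<^sup>2 \<le> 2 * \<beta>" using h K by (simp add: h0_def field_simps)
    have "(norm (x - h *\<^sub>R A x))\<^sup>2 = (norm x)\<^sup>2 - 2 * h * (x \<bullet> A x) + h\<^sup>2 * (norm (A x))\<^sup>2"
      unfolding power2_norm_eq_inner by (simp add: inner_diff algebra_simps inner_commute power2_eq_square)
    also have "\<dots> \<le> (norm x)\<^sup>2 - 2 * h * (2 * \<beta> * (norm x)\<^sup>2) + h\<^sup>2 * (norm x * K)\<^sup>2"
      using mono[of x] h K by (intro add_mono diff_mono mult_left_mono power_mono) auto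
    also have "\<dots> = (norm x)\<^sup>2 * (1 - 4 * \<beta> * h + h * (h * K\<^sup>2))"
      by (simp add: power2_eq_square algebra_simps)
    also have "\<dots> \<le> (norm x)\<^sup>2 * (1 - 4 * \<beta> * h + h * (2 * \<beta>))"
      using hK h by (intro mult_left_mono add_mono) auto
    also have "\<dots> \<le> (norm x)\<^sup>2 * (1 - \<beta> * h)\<^sup>2"
      by (intro mult_left_mono) (auto simp: power2_diff)
    finally have "(norm (x - h *\<^sub>R A x))\<^sup>2 \<le> ((1 - \<beta> * h) * norm x)\<^sup>2"
      by (simp add: power_mult_distrib mult.commute)
    then show "norm (x - h *\<^sub>R A x) \<le> (1 - \<beta> * h) * norm x"
      by (rule power2_le_imp_le) (use pos in auto)
  qed
qed

text \<open>A Caratheodory solution need not be differentiable, but over a short interval it differs from an Euler step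
  by at most \<open>M h + o(h)\<close>. This bounds the upper right derivative of
  \<open>exp (\<beta> t) (\<bar>z\<bar> - M / \<beta>)\<close> by zero.\<close>

lemma linear_forced_bound:
  fixes A :: "'a::euclidean_space \<Rightarrow> 'a"
  assumes A: "bounded_linear A" and \<beta>: "\<beta> > 0" and mono: "\<And>x. 2 * \<beta> * (norm x)\<^sup>2 \<le> x \<bullet> A x"
    and le: "a \<le> b" and M: "\<And>s. a \<le> s \<Longrightarrow> s \<le> b \<Longrightarrow> norm (u s) \<le> M"
    and int: "(\<lambda>s. u s - A (z s)) integrable_on {a..b}"
    and z: "\<And>t. a \<le> t \<Longrightarrow> t \<le> b \<Longrightarrow> z t = z a + integral {a..t} (\<lambda>s. u s - A (z s))"
  shows "norm (z b) \<le> exp (- \<beta> * (b - a)) * norm (z a) + M / \<beta>"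
proof -
  obtain h0 where h0: "h0 > 0" "\<And>h. 0 < h \<Longrightarrow> h < h0 \<Longrightarrow> 0 \<le> 1 - \<beta> * h"
    "\<And>h x. 0 < h \<Longrightarrow> h < h0 \<Longrightarrow> norm (x - h *\<^sub>R A x) \<le> (1 - \<beta> * h) * norm x"
    by (rule strongly_monotone_step[OF A \<beta> mono]) blast
  have "continuous_on {a..b} (\<lambda>t. z a + integral {a..t} (\<lambda>s. u s - A (z s)))"
    by (intro continuous_intros indefinite_integral_continuous_1 int)
  then have zc: "continuous_on {a..b} z" by (rule continuous_on_eq) (simp add: z[symmetric])
  have M0: "M \<ge> 0" using M[of a] le norm_ge_zero[of "u a"] by linarith
  let ?\<psi> = "\<lambda>t. exp (\<beta> * t) * norm (z t) - exp (\<beta> * t) * (M / \<beta>)"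
  have "?\<psi> b \<le> ?\<psi> a"
  proof (rule dini_nonincreasing[OF le])
    show "continuous_on {a..b} ?\<psi>" by (intro continuous_intros zc)
    fix t \<epsilon> :: real assume t: "a \<le> t" "t < b" and \<epsilon>: "\<epsilon> > 0"
    define E where "E = exp (\<beta> * b)"
    define \<epsilon>1 where "\<epsilon>1 = \<epsilon> / (2 * E)"
    define \<epsilon>2 where "\<epsilon>2 = \<epsilon> / (2 * (M + 1))"
    have pos: "\<epsilon>1 > 0" "\<epsilon>2 > 0" "E > 0" using \<epsilon> M0 by (auto simp: \<epsilon>1_def \<epsilon>2_def E_def)
    have "continuous_on {a..b} (\<lambda>s. A (z s))" by (rule bounded_linear.continuous_on[OF A zc])
    then obtain d1 where d1: "d1 > 0" "\<And>s. s \<in> {a..b} \<Longrightarrow> dist s t < d1 \<Longrightarrow> dist (A (z s)) (A (z t)) < \<epsilon>1"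
      using t pos(1) unfolding continuous_on_iff by (metis atLeastAtMost_iff less_imp_le)
    have "continuous_on UNIV (\<lambda>s. exp (\<beta> * s))" by (intro continuous_intros)
    then obtain d2 where d2: "d2 > 0" "\<And>s. dist s t < d2 \<Longrightarrow> dist (exp (\<beta> * s)) (exp (\<beta> * t)) < \<epsilon>2"
      using pos(2) unfolding continuous_on_iff by (metis UNIV_I)
    define \<delta> where "\<delta> = min h0 (min d1 d2)"
    have "?\<psi> (t + h) \<le> ?\<psi> t + \<epsilon> * h" if h: "0 < h" "h < \<delta>" "t + h \<le> b" for h
    proof -
      have hh: "h < h0" "h < d1" "h < d2" using h by (auto simp: \<delta>_def)
      have iab: "(\<lambda>s. u s - A (z s)) integrable_on {c..d}" if "a \<le> c" "d \<le> b" for c d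
        by (rule integrable_on_subinterval[OF int]) (use that in auto)
      have comb: "integral {a..t} (\<lambda>s. u s - A (z s)) + integral {t..t+h} (\<lambda>s. u s - A (z s))
          = integral {a..t+h} (\<lambda>s. u s - A (z s))"
        by (rule Henstock_Kurzweil_Integration.integral_combine) (use t h iab in auto)
      have i2: "((\<lambda>s. u s - A (z s) + A (z t)) has_integral (integral {t..t+h} (\<lambda>s. u s - A (z s)) + h *\<^sub>R A (z t))) {t..t+h}"
        using has_integral_add[OF integrable_integral[OF iab[of t "t+h"]] has_integral_const_real[of "A (z t)" t "t+h"]]
          t h by simp
      have "norm (integral {t..t+h} (\<lambda>s. u s - A (z s)) + h *\<^sub>R A (z t)) \<le> (M + \<epsilon>1) * Henstock_Kurzweil_Integration.content (cbox t (t+h))"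
      proof (rule has_integral_bound)
        show "((\<lambda>s. u s - A (z s) + A (z t)) has_integral (integral {t..t+h} (\<lambda>s. u s - A (z s)) + h *\<^sub>R A (z t))) (cbox t (t+h))"
          using i2 by simp
        fix s assume s: "s \<in> cbox t (t+h)"
        then have "norm (u s) \<le> M" using t h by (intro M) auto
        moreover have "norm (A (z s) - A (z t)) < \<epsilon>1"
          using d1(2)[of s] s t h hh by (auto simp: dist_norm)
        moreover have "norm (u s - A (z s) + A (z t)) \<le> norm (u s) + norm (A (z s) - A (z t))"
          using norm_triangle_ineq4[of "u s" "A (z s) - A (z t)"] by (simp add: algebra_simps)
        ultimately show "norm (u s - A (z s) + A (z t)) \<le> M + \<epsilon>1" by linarith
      qed (use M0 pos in auto)
      then have incr: "norm (integral {t..t+h} (\<lambda>s. u s - A (z s)) + h *\<^sub>R A (z t)) \<le> (M + \<epsilon>1) * h"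
        using h by simp
      have "z (t + h) = (z t - h *\<^sub>R A (z t)) + (integral {t..t+h} (\<lambda>s. u s - A (z s)) + h *\<^sub>R A (z t))"
        using z[of t] z[of "t+h"] comb t h by (simp add: algebra_simps)
      then have "norm (z (t+h)) \<le> norm (z t - h *\<^sub>R A (z t)) + (M + \<epsilon>1) * h"
        using incr norm_triangle_ineq by (smt (verit))
      also have "\<dots> \<le> (1 - \<beta> * h) * norm (z t) + (M + \<epsilon>1) * h" using h0(3)[of h "z t"] h hh by auto
      finally have step: "norm (z (t+h)) \<le> (1 - \<beta> * h) * norm (z t) + (M + \<epsilon>1) * h" .
      let ?e = "exp (\<beta> * (t+h))"
      have e_split: "?e = exp (\<beta> * t) * exp (\<beta> * h)" by (simp add: distrib_left exp_add)
      have "exp (\<beta> * h) * (1 - \<beta> * h) \<le> exp (\<beta> * h) * exp (- (\<beta> * h))"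
        using exp_ge_add_one_self[of "- (\<beta> * h)"] by (intro mult_left_mono) (linarith, simp)
      then have c1: "exp (\<beta> * h) * (1 - \<beta> * h) \<le> 1" by (simp flip: exp_add)
      have "?e * ((1 - \<beta> * h) * norm (z t)) = (exp (\<beta> * h) * (1 - \<beta> * h)) * (exp (\<beta> * t) * norm (z t))"
        by (simp add: e_split)
      also have "\<dots> \<le> 1 * (exp (\<beta> * t) * norm (z t))" using c1 by (intro mult_right_mono) auto
      finally have c2: "?e * ((1 - \<beta> * h) * norm (z t)) \<le> exp (\<beta> * t) * norm (z t)" by simp
      have "?e * (\<epsilon>1 * h) \<le> E * (\<epsilon>1 * h)" using h t \<beta> pos by (intro mult_right_mono) (auto simp: E_def)
      then have c3: "?e * (\<epsilon>1 * h) \<le> \<epsilon> * h / 2" using pos by (simp add: \<epsilon>1_def)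
      have "\<beta> * h \<le> exp (\<beta> * h) - 1" using exp_ge_add_one_self[of "\<beta> * h"] by linarith
      then have "exp (\<beta> * t) * (\<beta> * h) \<le> exp (\<beta> * t) * (exp (\<beta> * h) - 1)"
        by (intro mult_left_mono) auto
      then have "(M / \<beta>) * (exp (\<beta> * t) * (\<beta> * h)) \<le> (M / \<beta>) * (?e - exp (\<beta> * t))"
        using M0 \<beta> by (intro mult_left_mono) (simp_all only: e_split right_diff_distrib mult_1_right divide_nonneg_pos)
      then have c4: "exp (\<beta> * t) * (M * h) - ?e * (M / \<beta>) \<le> - exp (\<beta> * t) * (M / \<beta>)"
        using \<beta> by (simp add: algebra_simps)
      have "?e - exp (\<beta> * t) \<le> \<epsilon>2" using d2(2)[of "t+h"] h hh by (simp add: dist_real_def)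
      then have "(?e - exp (\<beta> * t)) * (M * h) \<le> \<epsilon>2 * (M * h)" using M0 h by (intro mult_right_mono) auto
      also have "\<dots> \<le> \<epsilon>2 * ((M + 1) * h)" using h pos by (intro mult_left_mono mult_right_mono) auto
      also have "\<dots> = \<epsilon> * h / 2" using M0 by (simp add: \<epsilon>2_def field_simps)
      finally have c5: "?e * (M * h) \<le> exp (\<beta> * t) * (M * h) + \<epsilon> * h / 2" by (simp add: algebra_simps)
      have "?e * norm (z (t+h)) \<le> ?e * ((1 - \<beta> * h) * norm (z t) + (M + \<epsilon>1) * h)"
        using step by (intro mult_left_mono) auto
      also have "\<dots> = ?e * ((1 - \<beta> * h) * norm (z t)) + ?e * (M * h) + ?e * (\<epsilon>1 * h)"
        by (simp only: distrib_left distrib_right)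
      finally show ?thesis using c2 c3 c4 c5 by linarith
    qed
    then show "\<exists>\<delta>>0. \<forall>h. 0 < h \<and> h < \<delta> \<and> t + h \<le> b \<longrightarrow> ?\<psi> (t + h) \<le> ?\<psi> t + \<epsilon> * h"
      using h0 d1 d2 by (intro exI[of _ \<delta>]) (auto simp: \<delta>_def)
  qed
  then have "exp (- \<beta> * b) * (exp (\<beta> * b) * (norm (z b) - M / \<beta>)) \<le> exp (- \<beta> * b) * (exp (\<beta> * a) * (norm (z a) - M / \<beta>))"
    by (intro mult_left_mono) (auto simp: right_diff_distrib)
  moreover have "exp (- \<beta> * b) * exp (\<beta> * b) = 1" "exp (- \<beta> * b) * exp (\<beta> * a) = exp (- \<beta> * (b - a))"
    by (simp_all add: algebra_simps flip: exp_add)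
  ultimately have "norm (z b) - M / \<beta> \<le> exp (- \<beta> * (b - a)) * (norm (z a) - M / \<beta>)"
    by (simp only: mult.assoc[symmetric]) simp
  moreover have "exp (- \<beta> * (b - a)) * (M / \<beta>) \<ge> 0" using M0 \<beta> by simp
  ultimately show ?thesis by (simp only: right_diff_distrib)
qed

theorem linear_input_to_state_stable:
  fixes A :: "'a::euclidean_space \<Rightarrow> 'a"
  assumes A: "bounded_linear A" and \<alpha>: "\<alpha> > 0" and mono: "\<And>x. \<alpha> * (norm x)\<^sup>2 \<le> x \<bullet> A x"
  shows "input_to_state_stable (\<lambda>t x. - A (x - xe)) xe"
  unfolding input_to_state_stable_def
proof (intro conjI allI impI)
  show "- A (xe - xe) = 0" by (simp add: linear_0[OF bounded_linear.linear[OF A]])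
  define \<beta> where "\<beta> = \<alpha> / 2"
  have \<beta>: "\<beta> > 0" and mono': "\<And>x. 2 * \<beta> * (norm x)\<^sup>2 \<le> x \<bullet> A x" using \<alpha> mono by (auto simp: \<beta>_def)
  show "\<exists>B \<gamma>. class_KL B \<and> class_K \<gamma> \<and> (\<forall>t0\<ge>0. \<forall>x0 u. admissible_input t0 u \<longrightarrow>
           (\<exists>x. forced_solution (\<lambda>t x. - A (x - xe)) u t0 x0 x) \<and>
           (\<forall>x. forced_solution (\<lambda>t x. - A (x - xe)) u t0 x0 x \<longrightarrow>
              (\<forall>t\<ge>t0. norm (x t - xe) \<le> B (norm (x0 - xe)) (t - t0) + \<gamma> (SUP s\<in>{t0..t}. norm (u s)))))"
  proof (rule exI, rule exI, intro conjI allI impI)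
    show "class_KL (\<lambda>r s. exp (- \<beta> * s) * r)"
      unfolding class_KL_def class_K_def
    proof (intro conjI allI impI)
      fix s :: real show "strict_mono_on {0..} (\<lambda>r. exp (- \<beta> * s) * r)" by (auto intro!: strict_mono_onI)
      show "continuous_on {0..} (\<lambda>r. exp (- \<beta> * s) * r)" by (intro continuous_intros)
    next
      fix r :: real assume "r \<ge> 0"
      then show "antimono_on {0..} (\<lambda>s. exp (- \<beta> * s) * r)"
        using \<beta> by (auto intro!: monotone_onI mult_right_mono)
      have "((\<lambda>s. exp (- \<beta> * (s - 0)) * r) \<longlongrightarrow> 0 * r) at_top"
        by (intro tendsto_intros exp_neg_tendsto_0 \<beta>)
      then show "((\<lambda>s. exp (- \<beta> * s) * r) \<longlongrightarrow> 0) at_top" by simp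
    qed simp
    show "class_K (\<lambda>r. r / \<beta>)"
      using \<beta> by (auto simp: class_K_def intro!: strict_mono_onI divide_strict_right_mono continuous_intros)
  next
    fix t0 :: real and x0 and u :: "real \<Rightarrow> 'a" assume u: "admissible_input t0 u"
    have ui: "u absolutely_integrable_on {t0..t}" for t by (rule admissible_input_absolutely_integrable[OF u])
    then have ui': "u integrable_on {t0..t}" for t by (simp add: absolutely_integrable_on_def)
    have "continuous_on {t0..} (\<lambda>t. (x0 - xe) + integral {t0..t} u)"
      by (intro continuous_on_atLeast continuous_intros indefinite_integral_continuous_1 ui')
    then obtain z where z: "continuous_on {t0..} z"
        "\<And>t. t \<ge> t0 \<Longrightarrow> z t = (x0 - xe) + integral {t0..t} u - integral {t0..t} (\<lambda>s. A (z s))"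
      using volterra_solution[OF A] by blast
    have Ai: "(\<lambda>s. A (z s)) absolutely_integrable_on {t0..t}" for t
      by (intro absolutely_integrable_continuous_real bounded_linear.continuous_on[OF A] continuous_on_subset[OF z(1)]) auto
    then have Ai': "(\<lambda>s. A (z s)) integrable_on {t0..t}" for t by (simp add: absolutely_integrable_on_def)
    have "forced_solution (\<lambda>t x. - A (x - xe)) u t0 x0 (\<lambda>t. z t + xe)"
      unfolding forced_solution_def
    proof (intro allI impI conjI)
      fix t assume t: "t \<ge> t0"
      show "(\<lambda>s. - A (z s + xe - xe) + u s) absolutely_integrable_on {t0..t}"
        using set_integral_diff(1)[OF ui Ai] by (simp add: algebra_simps)
      show "z t + xe = x0 + integral {t0..t} (\<lambda>s. - A (z s + xe - xe) + u s)"
        using integral_diff[OF ui'[of t] Ai'[of t]] z(2)[OF t] by simp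
    qed
    then show "\<exists>x. forced_solution (\<lambda>t x. - A (x - xe)) u t0 x0 x" by blast
    fix x t assume x: "forced_solution (\<lambda>t x. - A (x - xe)) u t0 x0 x" and t: "t0 \<le> t"
    have xt: "(\<lambda>s. u s - A (x s - xe)) absolutely_integrable_on {t0..t} \<and>
          x t = x0 + integral {t0..t} (\<lambda>s. u s - A (x s - xe))" if "t0 \<le> t" for t
      using x that by (simp add: forced_solution_def algebra_simps)
    have x0: "x t0 = x0" using xt[of t0] by simp
    have bnd: "bdd_above ((\<lambda>s. norm (u s)) ` {t0..t})"
      using u t unfolding admissible_input_def by (metis bdd_above_norm image_image)
    have "norm (x t - xe) \<le> exp (- \<beta> * (t - t0)) * norm (x t0 - xe) + (SUP s\<in>{t0..t}. norm (u s)) / \<beta>"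
    proof (rule linear_forced_bound[OF A \<beta> mono' t, where u=u and z="\<lambda>t. x t - xe"])
      show "norm (u s) \<le> (SUP s\<in>{t0..t}. norm (u s))" if "t0 \<le> s" "s \<le> t" for s
        by (rule cSUP_upper[OF _ bnd]) (use that in auto)
      show "(\<lambda>s. u s - A (x s - xe)) integrable_on {t0..t}"
        using xt[OF t] by (simp add: absolutely_integrable_on_def)
      show "x s - xe = x t0 - xe + integral {t0..s} (\<lambda>s. u s - A (x s - xe))" if "t0 \<le> s" "s \<le> t" for s
        using xt[of s] that x0 by simp
    qed
    then show "norm (x t - xe) \<le> exp (- \<beta> * (t - t0)) * norm (x0 - xe) + (SUP s\<in>{t0..t}. norm (u s)) / \<beta>"
      by (simp add: x0)
  qed
qed

section \<open>Critical orientations and their Hessians\<close>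

text \<open>For \<open>g = b\<close> this is minus the gradient of \<open>- \<Sum> k (b \<bullet> Q b)\<close> on the rotation group.\<close>

definition torque :: "'c set \<Rightarrow> ('c \<Rightarrow> real) \<Rightarrow> ('c \<Rightarrow> real^3) \<Rightarrow> ('c \<Rightarrow> real^3) \<Rightarrow> real^3^3 \<Rightarrow> real^3" where
  "torque C k b g Q = (\<Sum>c\<in>C. k c *\<^sub>R ((transpose Q *v g c) \<times> b c))"

text \<open>Linearization of minus the torque at \<open>D\<close> with respect to the axis of a relative rotation.\<close>

definition hessian :: "'c set \<Rightarrow> ('c \<Rightarrow> real) \<Rightarrow> ('c \<Rightarrow> real^3) \<Rightarrow> real^3^3 \<Rightarrow> real^3 \<Rightarrow> real^3" where
  "hessian C k b D x = (\<Sum>c\<in>C. k c *\<^sub>R (b c \<times> (x \<times> (transpose D *v b c))))"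

definition critical :: "'c set \<Rightarrow> ('c \<Rightarrow> real) \<Rightarrow> ('c \<Rightarrow> real^3) \<Rightarrow> (real^3^3) set" where
  "critical C k b = {D. rotation_matrix D \<and> torque C k b b D = 0}"

lemma linear_hessian: "linear (hessian C k b D)"
  by (rule linearI)
     (auto simp: hessian_def cross_add_left cross_add_right cross_mult_left cross_mult_right
       scaleR_right_distrib sum.distrib scaleR_sum_right mult.commute intro!: sum.cong)

text \<open>With \<open>M = D\<^sup>T K\<close> this is \<open>trace M - M\<close>, where \<open>K\<close> is the gain matrix.\<close>

lemma hessian_eq:
  "hessian C k b D x = (\<Sum>c\<in>C. k c * (b c \<bullet> (transpose D *v b c))) *\<^sub>R x
     - transpose D *v (\<Sum>c\<in>C. k c *\<^sub>R ((b c \<bullet> x) *\<^sub>R b c))"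
  by (simp add: hessian_def Lagrange scaleR_right_diff_distrib sum_subtractf scaleR_left.sum
      mult_vec_sum_right matrix_vector_mult_scaleR)

text \<open>The torque is the axial vector of the skew part of \<open>D\<^sup>T K\<close>, so both vanish together.\<close>

lemma hessian_symmetric:
  assumes "torque C k b b D = 0"
  shows "y \<bullet> hessian C k b D x = x \<bullet> hessian C k b D y"
proof -
  have "0 = (x \<times> y) \<bullet> torque C k b b D" using assms by simp
  also have "\<dots> = (\<Sum>c\<in>C. k c * ((x \<times> y) \<bullet> ((transpose D *v b c) \<times> b c)))"
    by (simp add: torque_def inner_sum_right)
  also have "\<dots> = (\<Sum>c\<in>C. k c * (y \<bullet> (b c \<times> (x \<times> (transpose D *v b c))))) -
      (\<Sum>c\<in>C. k c * (x \<bullet> (b c \<times> (y \<times> (transpose D *v b c)))))"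
    unfolding sum_subtractf[symmetric] right_diff_distrib[symmetric]
    by (intro sum.cong arg_cong[of _ _ "(*) _"] refl) (simp add: cross3_simps)
  finally show ?thesis by (simp add: hessian_def inner_sum_right)
qed

lemma orthonormal_expansion:
  fixes e :: "3 \<Rightarrow> real^3"
  assumes "\<And>i j. e i \<bullet> e j = (if i = j then 1 else 0)"
  shows "x = (\<Sum>i\<in>UNIV. (x \<bullet> e i) *\<^sub>R e i)"
proof -
  define E :: "real^3^3" where "E = (\<chi> i. e i)"
  have "E ** transpose E = mat 1"
    using assms by (simp add: E_def matrix_matrix_mult_def transpose_def mat_def vec_eq_iff inner_vec_def)
  then have "transpose E ** E = mat 1" by (simp add: matrix_left_right_inverse)
  then have "x = transpose E *v (E *v x)" by (simp add: matrix_vector_mul_assoc)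
  also have "\<dots> = (\<Sum>i\<in>UNIV. (x \<bullet> e i) *\<^sub>R e i)"
    by (simp add: vec_eq_iff matrix_vector_mult_def transpose_def E_def inner_vec_def mult.commute)
  finally show ?thesis .
qed

lemma orthonormal_norm:
  fixes e :: "3 \<Rightarrow> real^3"
  assumes "\<And>i j. e i \<bullet> e j = (if i = j then 1 else 0)"
  shows "x \<bullet> y = (\<Sum>i\<in>UNIV. (x \<bullet> e i) * (y \<bullet> e i))"
  by (subst orthonormal_expansion[OF assms, of y]) (simp add: inner_sum_right mult.commute)

locale gain_eigenbasis =
  fixes C :: "'c set" and k :: "'c \<Rightarrow> real" and b :: "'c \<Rightarrow> real^3"
    and e :: "3 \<Rightarrow> real^3" and l :: "3 \<Rightarrow> real"
  assumes orthonormal: "e i \<bullet> e j = (if i = j then 1 else 0)"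
    and eigen: "(\<Sum>c\<in>C. k c *\<^sub>R ((b c \<bullet> e i) *\<^sub>R b c)) = l i *\<^sub>R e i"
    and l_pos: "l i > 0" and l_inj: "inj l"
begin

text \<open>At a critical orientation \<open>M = D\<^sup>T K\<close> is symmetric, and \<open>M\<^sup>2 = M\<^sup>T M = K\<^sup>2\<close>. So \<open>M\<close> commutes with \<open>K\<^sup>2\<close>,
  whose eigenvalues are distinct; thus \<open>M\<close>, and with it \<open>D\<^sup>T\<close>, preserves every eigenline of \<open>K\<close>. Being
  orthogonal, \<open>D\<^sup>T\<close> acts on them by signs, and \<open>det D = 1\<close> leaves an even number of minus signs.\<close>

lemma critical_axes:
  assumes "D \<in> critical C k b"
  obtains \<sigma> where "\<And>i. \<sigma> i \<in> {1, -1::real}" "\<And>i. transpose D *v e i = \<sigma> i *\<^sub>R e i" "\<sigma> 3 = \<sigma> 1 * \<sigma> 2"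
proof -
  have rot: "rotation_matrix D" and tq: "torque C k b b D = 0" using assms by (auto simp: critical_def)
  have rotT: "rotation_matrix (transpose D)" using rot by (rule rotation_matrix_transpose)
  define M where "M x = transpose D *v (\<Sum>c\<in>C. k c *\<^sub>R ((b c \<bullet> x) *\<^sub>R b c))" for x
  have M_eq: "M x = (\<Sum>c\<in>C. k c * (b c \<bullet> (transpose D *v b c))) *\<^sub>R x - hessian C k b D x" for x
    by (simp add: M_def hessian_eq)
  have sym: "y \<bullet> M x = M y \<bullet> x" for x y
    using hessian_symmetric[OF tq, of x y] by (simp add: M_eq inner_diff inner_commute)
  have linM: "M (a *\<^sub>R x) = a *\<^sub>R M x" for a x
    by (simp add: M_eq linear_cmul[OF linear_hessian] algebra_simps)
  have Me: "M (e i) = l i *\<^sub>R (transpose D *v e i)" for i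
    by (simp only: M_def eigen matrix_vector_mult_scaleR)
  have iso: "(transpose D *v x) \<bullet> (transpose D *v y) = x \<bullet> y" for x y
    by (metis rotT orthogonal_transformation_def orthogonal_transformation_matrix
        matrix_of_matrix_vector_mul matrix_vector_mul_linear rotation_matrix_def)
  have MM: "M (M (e i)) = (l i)\<^sup>2 *\<^sub>R e i" for i
  proof -
    have "M (M (e i)) \<bullet> e j = (if i = j then (l i)\<^sup>2 else 0)" for j
    proof -
      have "M (M (e i)) \<bullet> e j = M (e i) \<bullet> M (e j)" using sym[of "M (e i)" "e j"] by simp
      also have "\<dots> = l i * l j * (e i \<bullet> e j)" by (simp add: Me iso)
      finally show ?thesis by (simp add: orthonormal power2_eq_square)
    qed
    then have "M (M (e i)) = (\<Sum>j\<in>UNIV. (if i = j then (l i)\<^sup>2 else 0) *\<^sub>R e j)"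
      by (subst orthonormal_expansion[OF orthonormal, of "M (M (e i))"]) simp
    then show ?thesis by (simp add: if_distrib[of "\<lambda>a. a *\<^sub>R _"] cong: if_cong)
  qed
  have off: "(transpose D *v e i) \<bullet> e j = 0" if "i \<noteq> j" for i j
  proof -
    have "(l i)\<^sup>2 * (M (e i) \<bullet> e j) = M (M (M (e i))) \<bullet> e j" by (simp add: MM linM)
    also have "\<dots> = M (e i) \<bullet> M (M (e j))" by (metis sym inner_commute)
    also have "\<dots> = (l j)\<^sup>2 * (M (e i) \<bullet> e j)" by (simp add: MM)
    finally have "(l i)\<^sup>2 = (l j)\<^sup>2 \<or> M (e i) \<bullet> e j = 0" by auto
    moreover have "l i \<noteq> l j" using that l_inj by (auto dest: injD)
    then have "(l i)\<^sup>2 \<noteq> (l j)\<^sup>2" using l_pos[of i] l_pos[of j] by (simp add: power2_eq_iff)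
    ultimately show ?thesis using l_pos[of i] by (simp add: Me)
  qed
  define \<sigma> where "\<sigma> i = (transpose D *v e i) \<bullet> e i" for i
  have De: "transpose D *v e i = \<sigma> i *\<^sub>R e i" for i
  proof -
    have "(\<Sum>j\<in>UNIV. ((transpose D *v e i) \<bullet> e j) *\<^sub>R e j) = (\<Sum>j\<in>UNIV. if j = i then \<sigma> i *\<^sub>R e i else 0)"
      by (intro sum.cong) (auto simp: \<sigma>_def off)
    then show ?thesis by (subst orthonormal_expansion[OF orthonormal, of "transpose D *v e i"]) simp
  qed
  have "\<sigma> i * \<sigma> i = 1" for i using iso[of "e i" "e i"] by (simp add: De orthonormal)
  then have \<sigma>: "\<sigma> i \<in> {1, -1}" for i by (auto simp: square_eq_1_iff)
  have "norm (e 1 \<times> e 2) = 1"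
    using norm_cross_dot[of "e 1" "e 2"] by (simp add: norm_eq_sqrt_inner orthonormal)
  define s where "s = (e 1 \<times> e 2) \<bullet> e 3"
  have c12: "e 1 \<times> e 2 = s *\<^sub>R e 3"
    by (subst orthonormal_expansion[OF orthonormal, of "e 1 \<times> e 2"]) (simp add: sum_3 dot_cross_self s_def)
  then have s0: "s \<noteq> 0" using \<open>norm (e 1 \<times> e 2) = 1\<close> by auto
  have "(\<sigma> 1 * \<sigma> 2) *\<^sub>R (e 1 \<times> e 2) = (transpose D *v e 1) \<times> (transpose D *v e 2)"
    by (simp add: De cross_mult_left cross_mult_right)
  also have "\<dots> = transpose D *v (e 1 \<times> e 2)" by (rule cross_rotation_matrix[OF rotT])
  also have "\<dots> = (s * \<sigma> 3) *\<^sub>R e 3" by (simp add: c12 matrix_vector_mult_scaleR De)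
  finally have "(\<sigma> 1 * \<sigma> 2 * s) *\<^sub>R e 3 = (s * \<sigma> 3) *\<^sub>R e 3" by (simp add: c12)
  moreover have "e 3 \<noteq> 0" using orthonormal[of 3 3] by auto
  ultimately have "\<sigma> 3 = \<sigma> 1 * \<sigma> 2" using s0 by simp
  with De \<sigma> show ?thesis using that by blast
qed

lemma finite_critical: "finite (critical C k b)"
proof -
  let ?f = "\<lambda>\<sigma>::3\<Rightarrow>real. transpose (matrix (\<lambda>x. \<Sum>i\<in>UNIV. (x \<bullet> e i) *\<^sub>R (\<sigma> i *\<^sub>R e i)))"
  have "critical C k b \<subseteq> ?f ` (UNIV \<rightarrow> {1, -1})"
  proof
    fix D assume "D \<in> critical C k b"
    then obtain \<sigma> where \<sigma>: "\<And>i. \<sigma> i \<in> {1, -1::real}" "\<And>i. transpose D *v e i = \<sigma> i *\<^sub>R e i"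
      by (rule critical_axes) blast
    have "transpose D *v x = (\<Sum>i\<in>UNIV. (x \<bullet> e i) *\<^sub>R (\<sigma> i *\<^sub>R e i))" for x
      by (subst orthonormal_expansion[OF orthonormal, of x])
         (simp add: mult_vec_sum_right matrix_vector_mult_scaleR \<sigma>)
    then have "transpose D = matrix (\<lambda>x. \<Sum>i\<in>UNIV. (x \<bullet> e i) *\<^sub>R (\<sigma> i *\<^sub>R e i))"
      by (metis (no_types, lifting) ext matrix_of_matrix_vector_mul)
    then have "D = ?f \<sigma>" by (metis transpose_transpose)
    with \<sigma>(1) show "D \<in> ?f ` (UNIV \<rightarrow> {1, -1})" by (intro image_eqI[of _ _ \<sigma>]) auto
  qed
  moreover have "finite (UNIV \<rightarrow> {1, -1::real} :: (3 \<Rightarrow> real) set)"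
    using finite_PiE[of "UNIV :: 3 set" "\<lambda>_. {1, -1::real}"] by (simp add: PiE_def)
  ultimately show ?thesis by (meson finite_surj)
qed

text \<open>The Hessian has the eigenvalues \<open>\<sigma> 2 * l 2 + \<sigma> 3 * l 3\<close> and its cyclic analogues. They are nonzero since
  the \<open>l i\<close> are positive and distinct. If two signs are negative, the eigenvalue formed from these two is negative.\<close>

lemma hessian_eigenvalues:
  assumes "D \<in> critical C k b"
  obtains h where "\<And>i. hessian C k b D (e i) = h i *\<^sub>R e i" "\<And>i. h i \<noteq> 0"
    "D \<noteq> mat 1 \<Longrightarrow> \<exists>i. h i < 0" "D = mat 1 \<Longrightarrow> \<forall>i. h i > 0"
proof -
  obtain \<sigma> where \<sigma>: "\<And>i. \<sigma> i \<in> {1, -1::real}" "\<And>i. transpose D *v e i = \<sigma> i *\<^sub>R e i" "\<sigma> 3 = \<sigma> 1 * \<sigma> 2"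
    using critical_axes[OF assms] by blast
  have De: "(transpose D *v x) \<bullet> e i = \<sigma> i * (x \<bullet> e i)" for x i
  proof -
    have "transpose D *v x = (\<Sum>i\<in>UNIV. (x \<bullet> e i) *\<^sub>R (\<sigma> i *\<^sub>R e i))"
      by (subst orthonormal_expansion[OF orthonormal, of x])
         (simp add: mult_vec_sum_right matrix_vector_mult_scaleR \<sigma>)
    then have "(transpose D *v x) \<bullet> e i = (\<Sum>j\<in>UNIV. x \<bullet> e j * \<sigma> j * (if j = i then 1 else 0))"
      by (simp add: inner_sum_left orthonormal)
    also have "\<dots> = (\<Sum>j\<in>UNIV. if j = i then \<sigma> i * (x \<bullet> e i) else 0)" by (intro sum.cong) auto
    finally show ?thesis by simp
  qed
  have Ke: "(\<Sum>c\<in>C. k c * ((b c \<bullet> e i) * (b c \<bullet> e i))) = l i" for i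
  proof -
    have "(\<Sum>c\<in>C. k c * ((b c \<bullet> e i) * (b c \<bullet> e i))) = (\<Sum>c\<in>C. k c *\<^sub>R ((b c \<bullet> e i) *\<^sub>R b c)) \<bullet> e i"
      by (simp add: inner_sum_left mult.assoc)
    then show ?thesis by (simp only: eigen) (simp add: orthonormal)
  qed
  have "(\<Sum>c\<in>C. k c * (b c \<bullet> (transpose D *v b c))) =
      (\<Sum>c\<in>C. \<Sum>i\<in>UNIV. \<sigma> i * (k c * ((b c \<bullet> e i) * (b c \<bullet> e i))))"
    by (intro sum.cong refl, subst orthonormal_norm[OF orthonormal])
       (simp add: De sum_distrib_left algebra_simps)
  also have "\<dots> = (\<Sum>i\<in>UNIV. \<sigma> i * l i)"
    by (subst sum.swap) (simp add: Ke flip: sum_distrib_left)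
  finally have tr: "(\<Sum>c\<in>C. k c * (b c \<bullet> (transpose D *v b c))) = (\<Sum>i\<in>UNIV. \<sigma> i * l i)" .
  define h where "h i = (\<Sum>j\<in>UNIV. \<sigma> j * l j) - \<sigma> i * l i" for i
  have 1: "hessian C k b D (e i) = h i *\<^sub>R e i" for i
    unfolding hessian_eq tr eigen by (simp add: matrix_vector_mult_scaleR \<sigma>(2) h_def algebra_simps)
  have h3: "h 1 = \<sigma> 2 * l 2 + \<sigma> 3 * l 3" "h 2 = \<sigma> 1 * l 1 + \<sigma> 3 * l 3" "h 3 = \<sigma> 1 * l 1 + \<sigma> 2 * l 2"
    by (auto simp: h_def sum_3)
  have ne: "l 1 \<noteq> l 2" "l 1 \<noteq> l 3" "l 2 \<noteq> l 3" by (simp_all add: inj_eq[OF l_inj])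
  have pos: "l 1 > 0" "l 2 > 0" "l 3 > 0" by (auto simp: l_pos)
  have s: "\<sigma> 1 = 1 \<or> \<sigma> 1 = -1" "\<sigma> 2 = 1 \<or> \<sigma> 2 = -1" using \<sigma>(1) by auto
  have 2: "h i \<noteq> 0" for i
  proof -
    have "h 1 \<noteq> 0 \<and> h 2 \<noteq> 0 \<and> h 3 \<noteq> 0" using s ne pos unfolding h3 \<sigma>(3) by auto
    then show ?thesis using exhaust_3[of i] by auto
  qed
  have triv: "D = mat 1 \<longleftrightarrow> (\<forall>i. \<sigma> i = 1)"
  proof
    assume "D = mat 1"
    then have "e i = \<sigma> i *\<^sub>R e i" for i using \<sigma>(2)[of i] by (simp add: transpose_mat)
    then have "e i \<bullet> e i = \<sigma> i * (e i \<bullet> e i)" for i by (metis inner_scaleR_left)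
    then show "\<forall>i. \<sigma> i = 1" by (simp add: orthonormal)
  next
    assume "\<forall>i. \<sigma> i = 1"
    then have "transpose D *v x = mat 1 *v x" for x
      by (subst (1 2) orthonormal_expansion[OF orthonormal, of x])
         (simp add: mult_vec_sum_right matrix_vector_mult_scaleR \<sigma>(2))
    then have "transpose D = mat 1" unfolding matrix_eq by blast
    then show "D = mat 1" by (metis transpose_mat transpose_transpose)
  qed
  have 3: "\<exists>i. h i < 0" if "D \<noteq> mat 1"
  proof -
    have "\<not> (\<sigma> 1 = 1 \<and> \<sigma> 2 = 1)" using that triv \<sigma>(3) by (auto simp: forall_3)
    then have "h 1 < 0 \<or> h 2 < 0 \<or> h 3 < 0" using s pos unfolding h3 \<sigma>(3) by auto
    then show ?thesis by blast
  qed
  have 4: "\<forall>i. h i > 0" if "D = mat 1"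
    using that triv pos by (simp add: forall_3 h3)
  show ?thesis using that 1 2 3 4 by blast
qed

lemma hessian_bounds:
  assumes "D \<in> critical C k b"
  obtains h \<Lambda> where "h > 0" "\<Lambda> > 0"
    "\<And>x. h * norm x \<le> norm (hessian C k b D x)" "\<And>x. norm (hessian C k b D x) \<le> \<Lambda> * norm x"
    "D = mat 1 \<Longrightarrow> \<forall>x. h * (norm x)\<^sup>2 \<le> x \<bullet> hessian C k b D x"
    "D \<noteq> mat 1 \<Longrightarrow> \<exists>v. norm v = 1 \<and> (\<exists>m>0. hessian C k b D v = - m *\<^sub>R v)"
proof -
  obtain h where h: "\<And>i. hessian C k b D (e i) = h i *\<^sub>R e i" "\<And>i. h i \<noteq> 0"
    "D \<noteq> mat 1 \<Longrightarrow> \<exists>i. h i < 0" "D = mat 1 \<Longrightarrow> \<forall>i. h i > 0"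
    by (rule hessian_eigenvalues[OF assms]) blast
  have tq: "torque C k b b D = 0" using assms by (simp add: critical_def)
  define m where "m = Min (range (\<lambda>i. \<bar>h i\<bar>))"
  have m: "m > 0" "\<And>i. m \<le> \<bar>h i\<bar>" using h(2) by (auto simp: m_def Min_gr_iff)
  have He: "hessian C k b D x \<bullet> e i = h i * (x \<bullet> e i)" for x i
    using hessian_symmetric[OF tq, of "e i" x] h(1)[of i] by (simp add: inner_commute)
  have norm2: "(norm x)\<^sup>2 = (\<Sum>i\<in>UNIV. (x \<bullet> e i)\<^sup>2)" for x
    by (subst power2_norm_eq_inner, subst orthonormal_norm[OF orthonormal]) (simp add: power2_eq_square)
  obtain \<Lambda> where \<Lambda>: "\<Lambda> > 0" "\<And>x. norm (hessian C k b D x) \<le> \<Lambda> * norm x"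
    using linear_bounded_pos[OF linear_hessian] by blast
  show ?thesis
  proof (rule that[OF m(1) \<Lambda>(1) _ \<Lambda>(2)])
    fix x
    have "(m * norm x)\<^sup>2 = (\<Sum>i\<in>UNIV. m\<^sup>2 * (x \<bullet> e i)\<^sup>2)"
      by (simp add: power_mult_distrib norm2 sum_distrib_left)
    also have "\<dots> \<le> (\<Sum>i\<in>UNIV. (h i * (x \<bullet> e i))\<^sup>2)"
    proof (rule sum_mono)
      fix i show "m\<^sup>2 * (x \<bullet> e i)\<^sup>2 \<le> (h i * (x \<bullet> e i))\<^sup>2"
        using m(1) m(2)[of i] unfolding power_mult_distrib
        by (intro mult_right_mono) (metis abs_ge_zero abs_le_square_iff abs_of_pos, simp)
    qed
    also have "\<dots> = (norm (hessian C k b D x))\<^sup>2" by (simp add: norm2 He)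
    finally show "m * norm x \<le> norm (hessian C k b D x)" by (rule power2_le_imp_le) simp
  next
    assume "D = mat 1"
    then have "h i \<ge> m" for i using h(4) m(2)[of i] by (auto simp: abs_of_pos)
    then have "(\<Sum>i\<in>UNIV. m * (x \<bullet> e i)\<^sup>2) \<le> (\<Sum>i\<in>UNIV. h i * (x \<bullet> e i)\<^sup>2)" for x
      by (intro sum_mono mult_right_mono) auto
    moreover have "x \<bullet> hessian C k b D x = (\<Sum>i\<in>UNIV. h i * (x \<bullet> e i)\<^sup>2)" for x
      by (subst orthonormal_norm[OF orthonormal]) (simp add: He power2_eq_square algebra_simps)
    ultimately show "\<forall>x. m * (norm x)\<^sup>2 \<le> x \<bullet> hessian C k b D x" by (simp add: norm2 sum_distrib_left)
  next
    assume "D \<noteq> mat 1"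
    then obtain i where "h i < 0" using h(3) by blast
    moreover have "norm (e i) = 1" by (simp add: norm_eq_sqrt_inner orthonormal)
    ultimately show "\<exists>v. norm v = 1 \<and> (\<exists>m>0. hessian C k b D v = - m *\<^sub>R v)"
      using h(1)[of i] by (intro exI[of _ "e i"] conjI exI[of _ "- h i"]) auto
  qed
qed

end

section \<open>Comparing two trajectories near a critical orientation\<close>

text \<open>The energy \<open>\<bar>d\<bar>\<^sup>2 / 2 + x \<bullet> H x / 2\<close> of \<open>x' = d, d' = om \<times> d - \<kappa> d - H x\<close> dissipates only \<open>\<kappa> \<bar>d\<bar>\<^sup>2\<close>. The cross term
  \<open>\<epsilon> d \<bullet> H x\<close> contributes \<open>- \<epsilon> \<bar>H x\<bar>\<^sup>2\<close>, which controls \<open>x\<close> as \<open>H\<close> is nonsingular, whatever its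
  signature. The remainder \<open>r1\<close> and the part of \<open>r2\<close> of order \<open>\<eta>\<close> come from linearization, \<open>\<gamma>\<close> from other agents.\<close>

lemma energy_form_decay:
  fixes H :: "real^3 \<Rightarrow> real^3"
  assumes \<kappa>: "\<kappa> > 0" and w: "w \<ge> 0" and C0: "C0 \<ge> 0" and h: "h > 0" and \<Lambda>: "\<Lambda> > 0" and \<epsilon>1: "\<epsilon>1 > 0"
    and sym: "\<And>x y. y \<bullet> H x = x \<bullet> H y"
    and Hl: "\<And>x. h * norm x \<le> norm (H x)" and Hu: "\<And>x. norm (H x) \<le> \<Lambda> * norm x"
  obtains \<epsilon> c \<eta> Cg where "0 < \<epsilon>" "\<epsilon> \<le> \<epsilon>1" "c > 0" "\<eta> > 0" "Cg > 0"
    "\<And>x d r1 r2 om \<gamma>. norm om \<le> w \<Longrightarrow> norm r1 \<le> \<eta> * (norm x + norm d) \<Longrightarrow>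
       norm r2 \<le> \<eta> * norm x + C0 * \<gamma> \<Longrightarrow> \<gamma> \<ge> 0 \<Longrightarrow>
       d \<bullet> (om \<times> d - \<kappa> *\<^sub>R d - H x + r2) + H x \<bullet> (d + r1)
         + \<epsilon> * ((om \<times> d - \<kappa> *\<^sub>R d - H x + r2) \<bullet> H x + d \<bullet> H (d + r1))
       \<le> - c * ((norm x)\<^sup>2 + (norm d)\<^sup>2) + Cg * \<gamma>\<^sup>2"
proof -
  \<comment> \<open>The third bound keeps half of the damping of \<open>d\<close>, the fourth half of the new damping of \<open>x\<close>.\<close>
  define \<epsilon> where "\<epsilon> = Min {\<epsilon>1, 1, \<kappa> / (4 * \<Lambda>), \<kappa> * h\<^sup>2 / (2 * ((w + \<kappa>) * \<Lambda>)\<^sup>2)}"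
  define c where "c = min (\<kappa> / 4) (\<epsilon> * h\<^sup>2 / 4)"
  define \<eta> where "\<eta> = c / (2 * (1 + 5 * \<Lambda>))"
  define G where "G = C0 * (1 + \<Lambda>)"
  define Cg where "Cg = 2 * G\<^sup>2 / c + 1"
  have \<epsilon>: "0 < \<epsilon>" "\<epsilon> \<le> \<epsilon>1" "\<epsilon> \<le> 1" "\<epsilon> \<le> \<kappa> / (4 * \<Lambda>)" "\<epsilon> \<le> \<kappa> * h\<^sup>2 / (2 * ((w + \<kappa>) * \<Lambda>)\<^sup>2)"
    using \<kappa> w h \<Lambda> \<epsilon>1 by (auto simp: \<epsilon>_def Min_gr_iff)
  have c: "c > 0" "2 * c \<le> \<kappa> / 2" "2 * c \<le> \<epsilon> * h\<^sup>2 / 2" using \<kappa> \<epsilon> h by (auto simp: c_def)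
  have \<eta>: "\<eta> > 0" using c \<Lambda> by (simp add: \<eta>_def)
  have Cg: "Cg > 0" using c by (simp add: Cg_def add_nonneg_pos)
  have e\<Lambda>: "\<epsilon> * \<Lambda> \<le> \<kappa> / 4" using \<epsilon>(4) \<Lambda> by (simp add: field_simps)
  have e2: "\<epsilon>\<^sup>2 * ((w + \<kappa>) * \<Lambda>)\<^sup>2 / \<kappa> \<le> \<epsilon> * h\<^sup>2 / 2"
  proof -
    have p: "((w + \<kappa>) * \<Lambda>)\<^sup>2 > 0" using w \<kappa> \<Lambda> by simp
    have "\<epsilon> * (2 * ((w + \<kappa>) * \<Lambda>)\<^sup>2) \<le> \<kappa> * h\<^sup>2"
      using mult_right_mono[OF \<epsilon>(5), of "2 * ((w + \<kappa>) * \<Lambda>)\<^sup>2"] p by simp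
    then have "\<epsilon> * (\<epsilon> * (2 * ((w + \<kappa>) * \<Lambda>)\<^sup>2)) \<le> \<epsilon> * (\<kappa> * h\<^sup>2)" using \<epsilon>(1) by (intro mult_left_mono) auto
    then show ?thesis using \<kappa> by (simp add: field_simps power2_eq_square)
  qed
  have G0: "G \<ge> 0" using C0 \<Lambda> by (simp add: G_def)
  show ?thesis
  proof (rule that[OF \<epsilon>(1,2) c(1) \<eta> Cg])
    fix x d r1 r2 om :: "real^3" and \<gamma> :: real
    assume om: "norm om \<le> w" and r1: "norm r1 \<le> \<eta> * (norm x + norm d)"
      and r2: "norm r2 \<le> \<eta> * norm x + C0 * \<gamma>" and \<gamma>: "\<gamma> \<ge> 0"
    define a b where "a = norm x" and "b = norm d"
    have ab: "a \<ge> 0" "b \<ge> 0" by (auto simp: a_def b_def)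
    have "\<epsilon> * (\<Lambda> * z) \<le> 1 * (\<Lambda> * z)" if "z \<ge> 0" for z
      using \<epsilon>(3) \<Lambda> that by (intro mult_right_mono) auto
    then have e1: "\<epsilon> * (\<Lambda> * z) \<le> \<Lambda> * z" if "z \<ge> 0" for z using that by simp
    have CS: "u \<bullet> v \<le> norm u * norm v" for u v :: "real^3" by (rule norm_cauchy_schwarz)
    have bnd: "u \<bullet> v \<le> p * q" if "norm u \<le> p" "norm v \<le> q" for u v :: "real^3" and p q
      using CS[of u v] mult_mono[OF that order_trans[OF norm_ge_zero that(1)] norm_ge_zero] by linarith
    have Hx: "norm (H x) \<le> \<Lambda> * a" by (simp add: a_def Hu)
    have Hd: "norm (H d) \<le> \<Lambda> * b" by (simp add: b_def Hu)
    have Hr: "norm (H r1) \<le> \<Lambda> * (\<eta> * (a + b))"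
      using order_trans[OF Hu mult_left_mono[OF r1, of \<Lambda>]] \<Lambda> by (simp add: a_def b_def)
    have t1: "d \<bullet> r2 \<le> b * (\<eta> * a + C0 * \<gamma>)" by (rule bnd) (use r2 in \<open>auto simp: a_def b_def\<close>)
    have t2: "H x \<bullet> r1 \<le> (\<Lambda> * a) * (\<eta> * (a + b))" by (rule bnd) (use r1 Hx in \<open>auto simp: a_def b_def\<close>)
    have "norm (om \<times> d) \<le> w * b"
      using norm_cross_le[of om d] mult_right_mono[OF om, of b] ab by (simp add: b_def)
    then have t3: "(om \<times> d) \<bullet> H x \<le> (w * b) * (\<Lambda> * a)" by (rule bnd) (rule Hx)
    have t4: "(- \<kappa> *\<^sub>R d) \<bullet> H x \<le> (\<kappa> * b) * (\<Lambda> * a)" by (rule bnd) (use Hx \<kappa> in \<open>auto simp: b_def\<close>)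
    have "(h * a)\<^sup>2 \<le> (norm (H x))\<^sup>2" by (rule power_mono) (use Hl[of x] h ab in \<open>auto simp: a_def\<close>)
    then have t5: "h\<^sup>2 * a\<^sup>2 \<le> H x \<bullet> H x" by (simp add: power_mult_distrib power2_norm_eq_inner)
    have t6: "r2 \<bullet> H x \<le> (\<eta> * a + C0 * \<gamma>) * (\<Lambda> * a)" by (rule bnd) (use r2 Hx in \<open>auto simp: a_def\<close>)
    have t7: "d \<bullet> H d \<le> b * (\<Lambda> * b)" by (rule bnd) (use Hd in \<open>auto simp: b_def\<close>)
    have t8: "d \<bullet> H r1 \<le> b * (\<Lambda> * (\<eta> * (a + b)))" by (rule bnd) (use Hr in \<open>auto simp: b_def\<close>)
    have linH: "H (d + r1) \<bullet> d = H d \<bullet> d + H r1 \<bullet> d"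
      by (metis inner_add_left inner_commute sym)
    have eq: "d \<bullet> (om \<times> d - \<kappa> *\<^sub>R d - H x + r2) + H x \<bullet> (d + r1)
         + \<epsilon> * ((om \<times> d - \<kappa> *\<^sub>R d - H x + r2) \<bullet> H x + d \<bullet> H (d + r1))
        = - \<kappa> * b\<^sup>2 + d \<bullet> r2 + H x \<bullet> r1 + \<epsilon> * ((om \<times> d) \<bullet> H x + (- \<kappa> *\<^sub>R d) \<bullet> H x - H x \<bullet> H x + r2 \<bullet> H x + d \<bullet> H d + d \<bullet> H r1)"
      using linH by (simp add: inner_diff inner_add dot_cross_self b_def power2_norm_eq_inner inner_commute[of d "H _"])
    have "\<epsilon> * ((om \<times> d) \<bullet> H x + (- \<kappa> *\<^sub>R d) \<bullet> H x - H x \<bullet> H x + r2 \<bullet> H x + d \<bullet> H d + d \<bullet> H r1)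
       \<le> \<epsilon> * ((w * b) * (\<Lambda> * a) + (\<kappa> * b) * (\<Lambda> * a) - h\<^sup>2 * a\<^sup>2 + (\<eta> * a + C0 * \<gamma>) * (\<Lambda> * a) + b * (\<Lambda> * b)
          + b * (\<Lambda> * (\<eta> * (a + b))))"
      using t3 t4 t5 t6 t7 t8 \<epsilon>(1) by (intro mult_left_mono) linarith+
    also have "\<dots> = (\<epsilon> * ((w + \<kappa>) * \<Lambda>)) * a * b - \<epsilon> * h\<^sup>2 * a\<^sup>2 + (\<epsilon> * \<Lambda>) * b\<^sup>2
         + \<eta> * (\<epsilon> * (\<Lambda> * (a\<^sup>2))) + C0 * \<gamma> * (\<epsilon> * (\<Lambda> * a)) + \<eta> * (\<epsilon> * (\<Lambda> * (a * b + b\<^sup>2)))"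
      by (simp add: algebra_simps power2_eq_square)
    also have "(\<epsilon> * ((w + \<kappa>) * \<Lambda>)) * a * b \<le> \<kappa> / 4 * b\<^sup>2 + \<epsilon>\<^sup>2 * ((w + \<kappa>) * \<Lambda>)\<^sup>2 / \<kappa> * a\<^sup>2"
    proof -
      let ?s = "\<epsilon> * ((w + \<kappa>) * \<Lambda>)"
      have "0 \<le> (\<kappa> / 2 * b - ?s * a)\<^sup>2 / \<kappa>" using \<kappa> by simp
      also have "\<dots> = \<kappa> / 4 * b\<^sup>2 + ?s\<^sup>2 / \<kappa> * a\<^sup>2 - ?s * a * b"
        using \<kappa> by (simp add: power2_diff power_mult_distrib power_divide) (simp add: field_simps power2_eq_square)
      finally show ?thesis by (simp add: power_mult_distrib)
    qed
    also have "\<epsilon>\<^sup>2 * ((w + \<kappa>) * \<Lambda>)\<^sup>2 / \<kappa> * a\<^sup>2 \<le> \<epsilon> * h\<^sup>2 / 2 * a\<^sup>2"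
      using e2 by (intro mult_right_mono) auto
    also have "(\<epsilon> * \<Lambda>) * b\<^sup>2 \<le> \<kappa> / 4 * b\<^sup>2" using e\<Lambda> by (intro mult_right_mono) auto
    also have "\<eta> * (\<epsilon> * (\<Lambda> * a\<^sup>2)) \<le> \<eta> * (\<Lambda> * a\<^sup>2)" using e1 \<eta> by (intro mult_left_mono) auto
    also have "C0 * \<gamma> * (\<epsilon> * (\<Lambda> * a)) \<le> C0 * \<gamma> * (\<Lambda> * a)" using e1 C0 \<gamma> ab by (intro mult_left_mono) auto
    also have "\<eta> * (\<epsilon> * (\<Lambda> * (a * b + b\<^sup>2))) \<le> \<eta> * (\<Lambda> * (a * b + b\<^sup>2))" using e1 \<eta> ab by (intro mult_left_mono) auto
    finally have E: "\<epsilon> * ((om \<times> d) \<bullet> H x + (- \<kappa> *\<^sub>R d) \<bullet> H x - H x \<bullet> H x + r2 \<bullet> H x + d \<bullet> H d + d \<bullet> H r1)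
      \<le> \<kappa> / 4 * b\<^sup>2 + \<epsilon> * h\<^sup>2 / 2 * a\<^sup>2 - \<epsilon> * h\<^sup>2 * a\<^sup>2 + \<kappa> / 4 * b\<^sup>2 + \<eta> * (\<Lambda> * a\<^sup>2) + C0 * \<gamma> * (\<Lambda> * a)
        + \<eta> * (\<Lambda> * (a * b + b\<^sup>2))" by simp
    have abs2: "a * b \<le> a\<^sup>2 + b\<^sup>2"
      using sum_squares_bound[of a b] mult_nonneg_nonneg[OF ab] by (simp only: mult.assoc)
    have gen: "z \<le> p + q \<Longrightarrow> 0 \<le> p \<Longrightarrow> 0 \<le> q \<Longrightarrow> 2 * p + 2 * z + q \<le> 5 * (p + q)" for p q z :: real
      by (simp add: distrib_left)
    have main: "2 * c * (a\<^sup>2 + b\<^sup>2) \<le> \<kappa> / 2 * b\<^sup>2 + \<epsilon> * h\<^sup>2 / 2 * a\<^sup>2"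
      using mult_right_mono[OF c(2), of "b\<^sup>2"] mult_right_mono[OF c(3), of "a\<^sup>2"] by (simp add: distrib_left)
    have "\<eta> * (a * b + \<Lambda> * (a\<^sup>2 + a * b) + \<Lambda> * a\<^sup>2 + \<Lambda> * (a * b + b\<^sup>2)) \<le> \<eta> * ((1 + 5 * \<Lambda>) * (a\<^sup>2 + b\<^sup>2))"
    proof (intro mult_left_mono)
      have "a * b + \<Lambda> * (a\<^sup>2 + a * b) + \<Lambda> * a\<^sup>2 + \<Lambda> * (a * b + b\<^sup>2) = a * b + \<Lambda> * (2 * a\<^sup>2 + 2 * (a * b) + b\<^sup>2)"
        by (simp add: algebra_simps)
      also have "\<dots> \<le> (a\<^sup>2 + b\<^sup>2) + \<Lambda> * (5 * (a\<^sup>2 + b\<^sup>2))"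
      proof -
        have "2 * a\<^sup>2 + 2 * (a * b) + b\<^sup>2 \<le> 5 * (a\<^sup>2 + b\<^sup>2)"
          using gen[OF abs2] by simp
        then show "a * b + \<Lambda> * (2 * a\<^sup>2 + 2 * (a * b) + b\<^sup>2) \<le> (a\<^sup>2 + b\<^sup>2) + \<Lambda> * (5 * (a\<^sup>2 + b\<^sup>2))"
        using abs2 \<Lambda> by (intro add_mono mult_left_mono) auto
      qed
      finally show "a * b + \<Lambda> * (a\<^sup>2 + a * b) + \<Lambda> * a\<^sup>2 + \<Lambda> * (a * b + b\<^sup>2) \<le> (1 + 5 * \<Lambda>) * (a\<^sup>2 + b\<^sup>2)"
        by (simp add: algebra_simps)
    qed (use \<eta> in auto)
    also have "\<dots> = (\<eta> * (1 + 5 * \<Lambda>)) * (a\<^sup>2 + b\<^sup>2)" by (simp only: mult.assoc)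
    also have "\<eta> * (1 + 5 * \<Lambda>) = c / 2" using \<Lambda> by (simp add: \<eta>_def field_simps)
    finally have small: "\<eta> * (a * b + \<Lambda> * (a\<^sup>2 + a * b) + \<Lambda> * a\<^sup>2 + \<Lambda> * (a * b + b\<^sup>2)) \<le> c / 2 * (a\<^sup>2 + b\<^sup>2)" .
    have young: "G * \<gamma> * z \<le> c / 4 * z\<^sup>2 + G\<^sup>2 / c * \<gamma>\<^sup>2" for z
    proof -
      have "0 \<le> (c / 2 * z - G * \<gamma>)\<^sup>2 / c" using c by simp
      also have "\<dots> = c / 4 * z\<^sup>2 + G\<^sup>2 / c * \<gamma>\<^sup>2 - G * \<gamma> * z"
        using c(1) by (simp add: power2_diff power_mult_distrib power_divide) (simp add: field_simps power2_eq_square)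
      finally show ?thesis by simp
    qed
    have "C0 * \<gamma> * b + C0 * \<gamma> * (\<Lambda> * a) \<le> G * \<gamma> * b + G * \<gamma> * a"
      using C0 \<Lambda> \<gamma> ab by (simp add: G_def algebra_simps)
    also have "\<dots> \<le> c / 4 * (a\<^sup>2 + b\<^sup>2) + 2 * (G\<^sup>2 / c * \<gamma>\<^sup>2)"
      using young[of a] young[of b] by (simp add: distrib_left)
    finally have gam: "C0 * \<gamma> * b + C0 * \<gamma> * (\<Lambda> * a) \<le> c / 4 * (a\<^sup>2 + b\<^sup>2) + 2 * (G\<^sup>2 / c * \<gamma>\<^sup>2)" .
    have t1': "d \<bullet> r2 \<le> \<eta> * (a * b) + C0 * \<gamma> * b" using t1 by (simp add: algebra_simps)
    have t2': "H x \<bullet> r1 \<le> \<eta> * (\<Lambda> * (a\<^sup>2 + a * b))" using t2 by (simp add: algebra_simps power2_eq_square)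
    have small': "\<eta> * (a * b) + \<eta> * (\<Lambda> * (a\<^sup>2 + a * b)) + \<eta> * (\<Lambda> * a\<^sup>2) + \<eta> * (\<Lambda> * (a * b + b\<^sup>2)) \<le> c / 2 * (a\<^sup>2 + b\<^sup>2)"
      using small by (simp only: distrib_left[of \<eta>])
    have Cg': "Cg * \<gamma>\<^sup>2 = 2 * (G\<^sup>2 / c * \<gamma>\<^sup>2) + \<gamma>\<^sup>2" by (simp add: Cg_def algebra_simps)
    have ca: "c * (a\<^sup>2 + b\<^sup>2) \<ge> 0" using c by simp
    have "d \<bullet> (om \<times> d - \<kappa> *\<^sub>R d - H x + r2) + H x \<bullet> (d + r1)
         + \<epsilon> * ((om \<times> d - \<kappa> *\<^sub>R d - H x + r2) \<bullet> H x + d \<bullet> H (d + r1))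
       \<le> - \<kappa> * b\<^sup>2 + \<kappa> / 2 * b\<^sup>2 - \<epsilon> * h\<^sup>2 / 2 * a\<^sup>2 + c / 2 * (a\<^sup>2 + b\<^sup>2) + (c / 4 * (a\<^sup>2 + b\<^sup>2) + 2 * (G\<^sup>2 / c * \<gamma>\<^sup>2))"
    proof -
      have "\<kappa> / 4 * b\<^sup>2 = (\<kappa> * b\<^sup>2) / 4" "\<kappa> / 2 * b\<^sup>2 = (\<kappa> * b\<^sup>2) / 2"
        "\<epsilon> * h\<^sup>2 / 2 * a\<^sup>2 = (\<epsilon> * h\<^sup>2 * a\<^sup>2) / 2" "- \<kappa> * b\<^sup>2 = - (\<kappa> * b\<^sup>2)" by simp_all
      then show ?thesis unfolding eq using E t1' t2' small' gam by linarith
    qed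
    also have "\<dots> \<le> - c * (a\<^sup>2 + b\<^sup>2) + Cg * \<gamma>\<^sup>2"
    proof -
      have "\<kappa> / 2 * b\<^sup>2 = (\<kappa> * b\<^sup>2) / 2" "- \<kappa> * b\<^sup>2 = - (\<kappa> * b\<^sup>2)"
        "2 * c * (a\<^sup>2 + b\<^sup>2) = 2 * (c * (a\<^sup>2 + b\<^sup>2))" "- c * (a\<^sup>2 + b\<^sup>2) = - (c * (a\<^sup>2 + b\<^sup>2))"
        "c / 2 * (a\<^sup>2 + b\<^sup>2) = (c * (a\<^sup>2 + b\<^sup>2)) / 2" "c / 4 * (a\<^sup>2 + b\<^sup>2) = (c * (a\<^sup>2 + b\<^sup>2)) / 4" by simp_all
      then show ?thesis unfolding Cg' using main ca zero_le_power2[of \<gamma>] by linarith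
    qed
    finally show "d \<bullet> (om \<times> d - \<kappa> *\<^sub>R d - H x + r2) + H x \<bullet> (d + r1)
         + \<epsilon> * ((om \<times> d - \<kappa> *\<^sub>R d - H x + r2) \<bullet> H x + d \<bullet> H (d + r1))
       \<le> - c * ((norm x)\<^sup>2 + (norm d)\<^sup>2) + Cg * \<gamma>\<^sup>2" by (simp add: a_def b_def)
  qed
qed

definition energy_form :: "real \<Rightarrow> (real^3 \<Rightarrow> real^3) \<Rightarrow> real^3 \<Rightarrow> real^3 \<Rightarrow> real" where
  "energy_form \<epsilon> H x d = d \<bullet> d / 2 + x \<bullet> H x / 2 + \<epsilon> * (d \<bullet> H x)"

lemma energy_form_le:
  assumes "\<And>x. norm (H x) \<le> \<Lambda> * norm x" "\<epsilon> \<ge> 0" "\<Lambda> \<ge> 0"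
  shows "\<bar>energy_form \<epsilon> H x d\<bar> \<le> (1 + \<Lambda> + \<epsilon> * \<Lambda>) * ((norm x)\<^sup>2 + (norm d)\<^sup>2)"
proof -
  have "\<bar>u \<bullet> H x\<bar> \<le> norm u * (\<Lambda> * norm x)" for u
    using Cauchy_Schwarz_ineq2[of u "H x"] mult_left_mono[OF assms(1)[of x], of "norm u"] by simp
  note this[of x] this[of d]
  moreover have "norm d * norm x \<le> (norm x)\<^sup>2 + (norm d)\<^sup>2"
    using sum_squares_bound[of "norm d" "norm x"] mult_nonneg_nonneg[OF norm_ge_zero[of d] norm_ge_zero[of x]]
    by (simp only: mult.assoc)
  then have "\<Lambda> * (norm d * norm x) \<le> \<Lambda> * ((norm x)\<^sup>2 + (norm d)\<^sup>2)"
    using assms by (intro mult_left_mono) auto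
  ultimately have 1: "\<bar>x \<bullet> H x\<bar> \<le> \<Lambda> * (norm x)\<^sup>2" "\<bar>d \<bullet> H x\<bar> \<le> \<Lambda> * ((norm x)\<^sup>2 + (norm d)\<^sup>2)"
    by (auto simp: power2_eq_square algebra_simps)
  have "\<bar>energy_form \<epsilon> H x d\<bar> \<le> (norm d)\<^sup>2 / 2 + \<bar>x \<bullet> H x\<bar> / 2 + \<epsilon> * \<bar>d \<bullet> H x\<bar>"
  proof -
    have "energy_form \<epsilon> H x d = (norm d)\<^sup>2 / 2 + (x \<bullet> H x) / 2 + \<epsilon> * (d \<bullet> H x)"
      by (simp add: energy_form_def power2_norm_eq_inner)
    moreover have "\<bar>\<epsilon> * (d \<bullet> H x)\<bar> = \<epsilon> * \<bar>d \<bullet> H x\<bar>" using assms(2) by (simp add: abs_mult)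
    ultimately show ?thesis using zero_le_power2[of "norm d"] by linarith
  qed
  also have "\<dots> \<le> (norm d)\<^sup>2 / 2 + \<Lambda> * (norm x)\<^sup>2 / 2 + \<epsilon> * (\<Lambda> * ((norm x)\<^sup>2 + (norm d)\<^sup>2))"
    using 1 assms by (intro add_mono mult_left_mono) auto
  also have "\<dots> \<le> (1 + \<Lambda> + \<epsilon> * \<Lambda>) * ((norm x)\<^sup>2 + (norm d)\<^sup>2)"
  proof -
    have "0 \<le> \<Lambda> * (norm x)\<^sup>2" "0 \<le> \<Lambda> * (norm d)\<^sup>2" using assms by auto
    then have "(norm d)\<^sup>2 / 2 + \<Lambda> * (norm x)\<^sup>2 / 2 \<le> (1 + \<Lambda>) * ((norm x)\<^sup>2 + (norm d)\<^sup>2)"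
      using zero_le_power2[of "norm x"] zero_le_power2[of "norm d"]
      unfolding distrib_left distrib_right mult_1_left by linarith
    then show ?thesis by (simp add: distrib_right)
  qed
  finally show ?thesis .
qed

lemma energy_form_ge:
  assumes "\<And>x. norm (H x) \<le> \<Lambda> * norm x" and pos: "\<And>x. h * (norm x)\<^sup>2 \<le> x \<bullet> H x" and "\<Lambda> > 0" "h > 0"
    and "0 \<le> \<epsilon>" "\<epsilon> \<le> 1" "\<epsilon> \<le> h / (4 * \<Lambda>\<^sup>2)"
  shows "min (1/4) (h/4) * ((norm x)\<^sup>2 + (norm d)\<^sup>2) \<le> energy_form \<epsilon> H x d"
proof -
  have "- (d \<bullet> H x) \<le> norm d * (\<Lambda> * norm x)"
    using norm_cauchy_schwarz[of "- d" "H x"] mult_left_mono[OF assms(1)[of x], of "norm d"] by simp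
  then have "- \<epsilon> * (d \<bullet> H x) \<le> \<epsilon> * (norm d * (\<Lambda> * norm x))"
    using mult_left_mono[of "- (d \<bullet> H x)" _ \<epsilon>] assms by simp
  also have "\<dots> \<le> (norm d)\<^sup>2 / 4 + (\<epsilon> * \<Lambda> * norm x)\<^sup>2"
  proof -
    have "0 \<le> (norm d / 2 - \<epsilon> * \<Lambda> * norm x)\<^sup>2" by simp
    then show ?thesis by (simp add: power2_diff power_divide algebra_simps)
  qed
  also have "(\<epsilon> * \<Lambda> * norm x)\<^sup>2 = \<epsilon> * (\<epsilon> * \<Lambda>\<^sup>2) * (norm x)\<^sup>2" by (simp add: power2_eq_square)
  also have "\<dots> \<le> 1 * (h / 4) * (norm x)\<^sup>2"
    using assms by (intro mult_right_mono mult_mono) (auto simp: field_simps)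
  finally have "- \<epsilon> * (d \<bullet> H x) \<le> (norm d)\<^sup>2 / 4 + h / 4 * (norm x)\<^sup>2" by simp
  moreover have "min (1/4) (h/4) * (norm x)\<^sup>2 \<le> h / 4 * (norm x)\<^sup>2" "min (1/4) (h/4) * (norm d)\<^sup>2 \<le> 1 / 4 * (norm d)\<^sup>2"
    by (intro mult_right_mono; simp)+
  ultimately show ?thesis
    using pos[of x] unfolding energy_form_def by (simp add: power2_norm_eq_inner distrib_left)
qed

lemma energy_form_has_derivative:
  assumes "linear H" and sym: "\<And>x y. y \<bullet> H x = x \<bullet> H y"
    and x: "(x has_vector_derivative x') (at t within S)" and d: "(d has_vector_derivative d') (at t within S)"
  shows "((\<lambda>t. energy_form \<epsilon> H (x t) (d t)) has_real_derivative
     d t \<bullet> d' + H (x t) \<bullet> x' + \<epsilon> * (d' \<bullet> H (x t) + d t \<bullet> H x')) (at t within S)"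
proof -
  have H: "bounded_linear H" using assms(1) by (simp add: linear_conv_bounded_linear)
  note Hx = bounded_linear.has_vector_derivative[OF H x]
  have "((\<lambda>t. d t \<bullet> d t) has_real_derivative (d t \<bullet> d' + d' \<bullet> d t)) (at t within S)"
       "((\<lambda>t. x t \<bullet> H (x t)) has_real_derivative (x' \<bullet> H (x t) + x' \<bullet> H (x t))) (at t within S)"
       "((\<lambda>t. d t \<bullet> H (x t)) has_real_derivative (d t \<bullet> H x' + d' \<bullet> H (x t))) (at t within S)"
    using has_vector_derivative_inner[OF d d] has_vector_derivative_inner[OF x Hx] has_vector_derivative_inner[OF d Hx]
      sym[of "x t" x'] by (simp_all add: has_real_derivative_iff_has_vector_derivative)
  then show ?thesis
    unfolding energy_form_def
    by (auto intro!: derivative_eq_intros simp: inner_commute algebra_simps)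
qed

text \<open>The relative rotation \<open>G = Q1\<^sup>T Q2\<close> obeys \<open>G' = hat u1 G - G hat u2\<close>; to first order its axis moves with the
  velocity difference.\<close>

lemma relative_rotation_rate:
  assumes "rotation_matrix G" and B: "B = G - mat 1"
  shows "norm (vee (hat u1 ** G - G ** hat u2) - (u1 - u2)) \<le> 2 * (norm u1 + norm u2) * norm B"
proof -
  have "hat u1 ** G - G ** hat u2 = hat (u1 - u2) + (hat u1 ** B - B ** hat u2)"
    by (simp add: B matrix_diff_left matrix_diff_right hat_diff)
  then have eq: "vee (hat u1 ** G - G ** hat u2) - (u1 - u2) = vee (hat u1 ** B - B ** hat u2)"
    by (simp add: vee_add vee_hat)
  have "norm (vee (hat u1 ** B - B ** hat u2)) \<le> norm (hat u1) * norm B + norm B * norm (hat u2)"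
    using norm_vee[of "hat u1 ** B - B ** hat u2"] norm_triangle_ineq4[of "hat u1 ** B" "B ** hat u2"]
      norm_matrix_mult_le[of "hat u1" B] norm_matrix_mult_le[of B "hat u2"] by linarith
  moreover have "norm (hat u1) * norm B + norm B * norm (hat u2) \<le> 2 * (norm u1 + norm u2) * norm B"
    using mult_right_mono[OF norm_hat[of u1], of "norm B"] mult_left_mono[OF norm_hat[of u2], of "norm B"]
    by (simp add: algebra_simps)
  ultimately show ?thesis unfolding eq by linarith
qed

text \<open>As \<open>Q1\<^sup>T = (1 + B) Q2\<^sup>T\<close>, moving from \<open>Q2\<close> to \<open>Q1\<close> changes the torque by \<open>- H (vee B)\<close> up to the
  discrepancy of the directions and second-order terms.\<close>

lemma torque_difference:
  assumes "finite C" and k: "\<And>c. c \<in> C \<Longrightarrow> k c > 0"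
    and rot: "rotation_matrix Q1" "rotation_matrix Q2" "rotation_matrix D"
    and B: "B = transpose Q1 ** Q2 - mat 1" "norm B \<le> \<eta>"
    and near: "norm (Q2 - D) \<le> \<eta>" "\<And>c. c \<in> C \<Longrightarrow> norm (g2 c - b c) \<le> \<eta>" "\<eta> \<le> 1/2"
  shows "norm (torque C k b g1 Q1 - torque C k b g2 Q2 + hessian C k b D (vee B))
     \<le> (\<Sum>c\<in>C. k c * norm (b c)) * (\<Sum>c\<in>C. norm (g1 c - g2 c))
       + (\<Sum>c\<in>C. k c * norm (b c) * (5 * norm (b c) + 6)) * (\<eta> * norm (vee B))"
proof -
  let ?x = "vee B"
  have rotG: "rotation_matrix (transpose Q1 ** Q2)"
    by (intro rotation_matrix_mult rotation_matrix_transpose rot)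
  have \<eta>0: "\<eta> \<ge> 0" using B(2) norm_ge_zero[of B] by linarith
  have Bx: "norm (B - hat ?x) \<le> (norm B)\<^sup>2 / 2" "norm B \<le> 3 * norm ?x"
    using rotation_minus_id[OF rotG B(1)] B(2) near(3) by auto
  have Q1: "transpose Q1 = transpose Q2 + B ** transpose Q2"
    using rot by (simp add: B matrix_diff_left matrix_mul_assoc[symmetric] rotation_matrixD)
  have bound: "norm ((transpose Q1 *v g1 c - transpose Q2 *v g2 c) - hat ?x *v (transpose D *v b c))
     \<le> norm (g1 c - g2 c) + (5 * norm (b c) + 6) * (\<eta> * norm ?x)" if c: "c \<in> C" for c
  proof -
    have eq: "(transpose Q1 *v g1 c - transpose Q2 *v g2 c) - hat ?x *v (transpose D *v b c)
      = transpose Q1 *v (g1 c - g2 c) + (B - hat ?x) *v (transpose Q2 *v g2 c)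
        + hat ?x *v (transpose (Q2 - D) *v g2 c + transpose D *v (g2 c - b c))" (is "_ = ?a + ?b + ?c")
      unfolding Q1
      by (simp add: mult_vec_diff_right mult_vec_diff_left matrix_vector_mult_add_rdistrib transpose_diff
          matrix_vector_mul_assoc[symmetric] matrix_vector_right_distrib)
    have "norm ?a = norm (g1 c - g2 c)"
      by (simp add: norm_rotation_mult_vec rotation_matrix_transpose rot)
    moreover have g2: "norm (g2 c) \<le> norm (b c) + 1"
      using near(2)[OF c] near(3) norm_triangle_sub[of "g2 c" "b c"] by linarith
    moreover have "norm ?b \<le> (3 * norm ?x * \<eta>) / 2 * (norm (b c) + 1)"
    proof -
      have "(norm B)\<^sup>2 / 2 \<le> (3 * norm ?x * \<eta>) / 2"
        using mult_mono[OF Bx(2) B(2)] \<eta>0 by (simp add: power2_eq_square)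
      then have "norm (B - hat ?x) \<le> (3 * norm ?x * \<eta>) / 2" using Bx(1) by linarith
      moreover have "norm (transpose Q2 *v g2 c) \<le> norm (b c) + 1"
        using g2 by (simp add: norm_rotation_mult_vec rotation_matrix_transpose rot)
      ultimately have "norm (B - hat ?x) * norm (transpose Q2 *v g2 c) \<le> (3 * norm ?x * \<eta>) / 2 * (norm (b c) + 1)"
        using \<eta>0 by (intro mult_mono) auto
      then show ?thesis using norm_mult_vec_le[of "B - hat ?x" "transpose Q2 *v g2 c"] by linarith
    qed
    moreover have "norm ?c \<le> (2 * norm ?x) * (\<eta> * (norm (b c) + 1) + \<eta>)"
    proof -
      have "norm (transpose (Q2 - D) *v g2 c) \<le> \<eta> * (norm (b c) + 1)"
        using order_trans[OF norm_mult_vec_le mult_mono[OF _ g2]] near(1) \<eta>0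
        by (metis norm_ge_zero norm_transpose)
      moreover have "norm (transpose D *v (g2 c - b c)) \<le> \<eta>"
        using near(2)[OF c] by (simp add: norm_rotation_mult_vec rotation_matrix_transpose rot)
      ultimately have "norm (transpose (Q2 - D) *v g2 c + transpose D *v (g2 c - b c)) \<le> \<eta> * (norm (b c) + 1) + \<eta>"
        using norm_triangle_ineq by (smt (verit))
      then have "norm (hat ?x) * norm (transpose (Q2 - D) *v g2 c + transpose D *v (g2 c - b c))
         \<le> (2 * norm ?x) * (\<eta> * (norm (b c) + 1) + \<eta>)"
        using norm_hat[of ?x] by (intro mult_mono) auto
      then show ?thesis using norm_mult_vec_le order_trans by blast
    qed
    moreover have "(3 * norm ?x * \<eta>) / 2 * (norm (b c) + 1) + (2 * norm ?x) * (\<eta> * (norm (b c) + 1) + \<eta>)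
        \<le> (5 * norm (b c) + 6) * (\<eta> * norm ?x)"
    proof -
      have "0 \<le> (\<eta> * norm ?x) * norm (b c)" "0 \<le> \<eta> * norm ?x" using \<eta>0 by auto
      then show ?thesis by (simp add: algebra_simps)
    qed
    moreover have "norm (?a + ?b + ?c) \<le> norm ?a + norm ?b + norm ?c" by (rule norm_triangle_le[OF add_mono[OF norm_triangle_ineq order_refl]])
    ultimately show ?thesis unfolding eq by linarith
  qed
  have hes: "hessian C k b D ?x = - (\<Sum>c\<in>C. k c *\<^sub>R ((hat ?x *v (transpose D *v b c)) \<times> b c))"
    unfolding hessian_def sum_negf[symmetric] by (intro sum.cong refl) (simp add: hat_mult cross_skew[of "b _"])
  have "torque C k b g1 Q1 - torque C k b g2 Q2 + hessian C k b D ?x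
     = (\<Sum>c\<in>C. k c *\<^sub>R (((transpose Q1 *v g1 c - transpose Q2 *v g2 c) - hat ?x *v (transpose D *v b c)) \<times> b c))"
    unfolding hes torque_def
    by (simp add: Cross3.left_diff_distrib scaleR_right_diff_distrib sum_subtractf)
  also have "norm \<dots> \<le> (\<Sum>c\<in>C. k c * ((norm (g1 c - g2 c) + (5 * norm (b c) + 6) * (\<eta> * norm ?x)) * norm (b c)))"
  proof (rule sum_norm_le)
    fix c assume c: "c \<in> C"
    show "norm (k c *\<^sub>R (((transpose Q1 *v g1 c - transpose Q2 *v g2 c) - hat ?x *v (transpose D *v b c)) \<times> b c))
      \<le> k c * ((norm (g1 c - g2 c) + (5 * norm (b c) + 6) * (\<eta> * norm ?x)) * norm (b c))"
      using k[OF c] order_trans[OF norm_cross_le mult_right_mono[OF bound[OF c] norm_ge_zero[of "b c"]]]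
      by (simp add: mult_left_mono)
  qed
  also have "\<dots> = (\<Sum>c\<in>C. (k c * norm (b c)) * norm (g1 c - g2 c)) + (\<Sum>c\<in>C. k c * norm (b c) * (5 * norm (b c) + 6)) * (\<eta> * norm ?x)"
    unfolding sum_distrib_right sum.distrib[symmetric] by (intro sum.cong refl) (simp add: algebra_simps)
  also have "(\<Sum>c\<in>C. (k c * norm (b c)) * norm (g1 c - g2 c)) \<le> (\<Sum>c\<in>C. (k c * norm (b c)) * (\<Sum>c\<in>C. norm (g1 c - g2 c)))"
    using k assms(1) by (intro sum_mono mult_left_mono member_le_sum) (auto intro!: mult_nonneg_nonneg simp: less_imp_le)
  also have "\<dots> = (\<Sum>c\<in>C. k c * norm (b c)) * (\<Sum>c\<in>C. norm (g1 c - g2 c))" by (simp add: sum_distrib_right)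
  finally show ?thesis by simp
qed

section \<open>The cascade of orientation errors\<close>

type_synonym 'f orientations = "(real^3^3, 'f) vec"
type_synonym 'f velocities = "(real^3, 'f) vec"

locale orientation_cascade =
  fixes C :: "'f::{finite,linorder} \<Rightarrow> 'c set" and k :: "'f \<Rightarrow> 'c \<Rightarrow> real" and b :: "'f \<Rightarrow> 'c \<Rightarrow> real^3"
    and g :: "'f \<Rightarrow> 'c \<Rightarrow> 'f orientations \<Rightarrow> real^3" and om :: "'f \<Rightarrow> real \<Rightarrow> real^3" and \<kappa> L :: real
    and e :: "'f \<Rightarrow> 3 \<Rightarrow> real^3" and l :: "'f \<Rightarrow> 3 \<Rightarrow> real"
  assumes finite_C: "finite (C i)" and k_pos: "c \<in> C i \<Longrightarrow> k i c > 0" and \<kappa>_pos: "\<kappa> > 0"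
    and eigenbasis: "gain_eigenbasis (C i) (k i) (b i) (e i) (l i)"
    and om_bounded: "bounded (om i ` {0..})"
    and g_id: "c \<in> C i \<Longrightarrow> g i c (\<chi> j. mat 1) = b i c"
    and L_nonneg: "L \<ge> 0"
    and g_lipschitz: "c \<in> C i \<Longrightarrow> (\<And>j. rotation_matrix (Q $ j)) \<Longrightarrow> (\<And>j. rotation_matrix (Q' $ j)) \<Longrightarrow>
        norm (g i c Q - g i c Q') \<le> L * (\<Sum>j\<in>{..<i}. norm (Q $ j - Q' $ j))"
begin

abbreviation crit :: "'f \<Rightarrow> (real^3^3) set" where "crit i \<equiv> critical (C i) (k i) (b i)"
abbreviation hess :: "'f \<Rightarrow> real^3^3 \<Rightarrow> real^3 \<Rightarrow> real^3" where "hess i \<equiv> hessian (C i) (k i) (b i)"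
abbreviation drive :: "'f \<Rightarrow> 'f orientations \<Rightarrow> real^3" where
  "drive i Q \<equiv> torque (C i) (k i) (b i) (\<lambda>c. g i c Q) (Q $ i)"

definition solution :: "(real \<Rightarrow> 'f orientations) \<Rightarrow> (real \<Rightarrow> 'f velocities) \<Rightarrow> bool" where
  "solution Q u \<longleftrightarrow> (\<forall>i. \<forall>t\<ge>0. rotation_matrix (Q t $ i) \<and>
     ((\<lambda>s. Q s $ i) has_vector_derivative - (Q t $ i ** hat (u t $ i))) (at t within {0..}) \<and>
     ((\<lambda>s. u s $ i) has_vector_derivative om i t \<times> u t $ i - \<kappa> *\<^sub>R (u t $ i) + drive i (Q t)) (at t within {0..}))"

lemma solutionD:
  assumes "solution Q u" "t \<ge> 0"
  shows "rotation_matrix (Q t $ i)"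
    "((\<lambda>s. Q s $ i) has_vector_derivative - (Q t $ i ** hat (u t $ i))) (at t within {0..})"
    "((\<lambda>s. u s $ i) has_vector_derivative om i t \<times> u t $ i - \<kappa> *\<^sub>R (u t $ i) + drive i (Q t)) (at t within {0..})"
  using assms by (auto simp: solution_def)

lemma torque_critical: "D \<in> crit i \<Longrightarrow> torque (C i) (k i) (b i) (b i) D = 0"
  by (simp add: critical_def)

lemma id_critical: "mat 1 \<in> crit i"
  by (simp add: critical_def torque_def rotation_matrix_id transpose_mat)

text \<open>The true trajectory is itself a solution of the error equations, so contraction between
  solutions includes convergence to it.\<close>

lemma trivial_solution: "solution (\<lambda>_. \<chi> j. mat 1) (\<lambda>_. 0)"
proof -
  have "drive i (\<chi> j. mat 1) = 0" for i
    by (simp add: torque_def g_id transpose_mat)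
  moreover have "hat 0 = 0" by (simp add: hat_expand vec_eq_iff forall_3)
  ultimately show ?thesis
    by (simp add: solution_def rotation_matrix_id)
qed

text \<open>Vanishes for equal attitudes; its skew part is the coordinate in which solutions are compared.\<close>

definition rel :: "'f orientations \<Rightarrow> 'f orientations \<Rightarrow> 'f \<Rightarrow> real^3^3" where
  "rel Q Q' i = transpose (Q $ i) ** Q' $ i - mat 1"

definition gap :: "'f orientations \<Rightarrow> 'f velocities \<Rightarrow> 'f orientations \<Rightarrow> 'f velocities \<Rightarrow> 'f \<Rightarrow> real" where
  "gap Q u Q' u' i = (norm (vee (rel Q Q' i)))\<^sup>2 + (norm (u $ i - u' $ i))\<^sup>2"

lemma gap_nonneg: "gap Q u Q' u' i \<ge> 0" by (simp add: gap_def)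

text \<open>Differences of rotations and relative rotations are interchangeable, as rotations act
  isometrically on matrices.\<close>

lemma norm_rel:
  assumes "rotation_matrix (Q $ i)" shows "norm (rel Q Q' i) = norm (Q $ i - Q' $ i)"
proof -
  have "rel Q Q' i = transpose (Q $ i) ** (Q' $ i - Q $ i)"
    using assms by (simp add: rel_def matrix_diff_right rotation_matrixD)
  then show ?thesis
    using assms by (simp add: norm_rotation_mult rotation_matrix_transpose norm_minus_commute)
qed

lemma norm_rel_le:
  assumes "rotation_matrix (Q $ i)" "rotation_matrix (Q' $ i)" "norm (Q $ i - Q' $ i) \<le> 1/2"
  shows "norm (Q $ i - Q' $ i) \<le> 3 * norm (vee (rel Q Q' i))"
  using rotation_minus_id(2)[of "transpose (Q $ i) ** Q' $ i" "rel Q Q' i"] assms norm_rel[of Q i Q']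
  by (simp add: rel_def rotation_matrix_mult rotation_matrix_transpose)

text \<open>Closeness of the agents in \<open>J\<close> to prescribed orientations and to rest.\<close>

definition near :: "real \<Rightarrow> ('f \<Rightarrow> real^3^3) \<Rightarrow> 'f set \<Rightarrow> 'f orientations \<Rightarrow> 'f velocities \<Rightarrow> bool" where
  "near \<eta> D J Q u \<longleftrightarrow> (\<forall>j\<in>J. norm (Q $ j - D j) \<le> \<eta> \<and> norm (u $ j) \<le> \<eta>)"

definition agent_form where
  "agent_form \<epsilon> i D Q u Q' u' = energy_form \<epsilon> (hess i D) (vee (rel Q Q' i)) (u $ i - u' $ i)"

text \<open>The form of agent \<open>i\<close> at \<open>D\<close> is bounded by \<open>A\<close>, positive definite with constant \<open>c\<close> if \<open>D\<close> is the identity, and decays at rate \<open>c\<close>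
  up to the influence of its predecessors. A single pair \<open>c\<close>, \<open>A\<close> serves all purposes, and
  the property is monotone in \<open>c\<close>, \<open>\<eta>\<close> and \<open>A\<close>, so constants can be shared among agents.\<close>

definition dissipative_form :: "'f \<Rightarrow> real^3^3 \<Rightarrow> real \<Rightarrow> real \<Rightarrow> real \<Rightarrow> real \<Rightarrow> bool" where
  "dissipative_form i D \<epsilon> c \<eta> A \<longleftrightarrow>
    (\<forall>x d. \<bar>energy_form \<epsilon> (hess i D) x d\<bar> \<le> A * ((norm x)\<^sup>2 + (norm d)\<^sup>2)) \<and>
    (D = mat 1 \<longrightarrow> (\<forall>x d. c * ((norm x)\<^sup>2 + (norm d)\<^sup>2) \<le> energy_form \<epsilon> (hess i D) x d)) \<and>
    (\<forall>Q u Q' u' t. solution Q u \<longrightarrow> solution Q' u' \<longrightarrow> t \<ge> 0 \<longrightarrow>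
      near \<eta> (\<lambda>j. if j = i then D else mat 1) {..i} (Q t) (u t) \<longrightarrow>
      near \<eta> (\<lambda>j. if j = i then D else mat 1) {..i} (Q' t) (u' t) \<longrightarrow>
      (\<exists>P. ((\<lambda>t. agent_form \<epsilon> i D (Q t) (u t) (Q' t) (u' t)) has_real_derivative P) (at t within {0..}) \<and>
        P \<le> - c * gap (Q t) (u t) (Q' t) (u' t) i + A * (\<Sum>j\<in>{..<i}. gap (Q t) (u t) (Q' t) (u' t) j)))"

lemma nearD:
  assumes "near \<eta> D J Q u" "j \<in> J" shows "norm (Q $ j - D j) \<le> \<eta>" "norm (u $ j) \<le> \<eta>"
  using assms unfolding near_def by blast+

lemma near_mono: "near \<eta> D J Q u \<Longrightarrow> \<eta> \<le> \<eta>' \<Longrightarrow> near \<eta>' D J Q u"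
  unfolding near_def by force

lemma dissipative_form_mono:
  assumes "dissipative_form i D \<epsilon> c \<eta> A" "c' \<le> c" "\<eta>' \<le> \<eta>" "A \<le> A'"
  shows "dissipative_form i D \<epsilon> c' \<eta>' A'"
  unfolding dissipative_form_def
proof (intro conjI allI impI)
  fix x d :: "real^3"
  have "A * ((norm x)\<^sup>2 + (norm d)\<^sup>2) \<le> A' * ((norm x)\<^sup>2 + (norm d)\<^sup>2)"
    using assms by (intro mult_right_mono) auto
  then show "\<bar>energy_form \<epsilon> (hess i D) x d\<bar> \<le> A' * ((norm x)\<^sup>2 + (norm d)\<^sup>2)"
    using assms(1) unfolding dissipative_form_def by (meson order_trans)
  assume "D = mat 1"
  moreover have "c' * ((norm x)\<^sup>2 + (norm d)\<^sup>2) \<le> c * ((norm x)\<^sup>2 + (norm d)\<^sup>2)"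
    using assms by (intro mult_right_mono) auto
  ultimately show "c' * ((norm x)\<^sup>2 + (norm d)\<^sup>2) \<le> energy_form \<epsilon> (hess i D) x d"
    using assms(1) unfolding dissipative_form_def by (meson order_trans)
next
  fix Q u Q' u' t
  assume *: "solution Q u" "solution Q' u'" "t \<ge> (0::real)"
      "near \<eta>' (\<lambda>j. if j = i then D else mat 1) {..i} (Q t) (u t)"
      "near \<eta>' (\<lambda>j. if j = i then D else mat 1) {..i} (Q' t) (u' t)"
  then obtain P where P: "((\<lambda>t. agent_form \<epsilon> i D (Q t) (u t) (Q' t) (u' t)) has_real_derivative P) (at t within {0..})"
        "P \<le> - c * gap (Q t) (u t) (Q' t) (u' t) i + A * (\<Sum>j\<in>{..<i}. gap (Q t) (u t) (Q' t) (u' t) j)"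
    using assms(1) near_mono[OF _ assms(3)] unfolding dissipative_form_def by meson
  have "c' * gap (Q t) (u t) (Q' t) (u' t) i \<le> c * gap (Q t) (u t) (Q' t) (u' t) i"
    using assms by (intro mult_right_mono gap_nonneg)
  moreover have "A * (\<Sum>j\<in>{..<i}. gap (Q t) (u t) (Q' t) (u' t) j) \<le> A' * (\<Sum>j\<in>{..<i}. gap (Q t) (u t) (Q' t) (u' t) j)"
    using assms by (intro mult_right_mono sum_nonneg gap_nonneg)
  ultimately have "P \<le> - c' * gap (Q t) (u t) (Q' t) (u' t) i + A' * (\<Sum>j\<in>{..<i}. gap (Q t) (u t) (Q' t) (u' t) j)"
    using P(2) by simp
  with P(1) show "\<exists>P. ((\<lambda>t. agent_form \<epsilon> i D (Q t) (u t) (Q' t) (u' t)) has_real_derivative P) (at t within {0..}) \<and>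
        P \<le> - c' * gap (Q t) (u t) (Q' t) (u' t) i + A' * (\<Sum>j\<in>{..<i}. gap (Q t) (u t) (Q' t) (u' t) j)" by blast
qed

lemma om_bound: obtains w where "w \<ge> 0" "\<And>i t. t \<ge> 0 \<Longrightarrow> norm (om i t) \<le> w"
proof -
  have "bounded (\<Union>i. om i ` {0..})" using om_bounded by (intro bounded_UN) auto
  then obtain w where w: "\<And>i t. t \<ge> 0 \<Longrightarrow> norm (om i t) \<le> w" unfolding bounded_iff by auto
  then show ?thesis using that[of w] norm_ge_zero order_trans by (metis order_refl)
qed

lemma rel_derivative:
  assumes "solution Q u" "solution Q' u'" "t \<ge> 0"
  shows "((\<lambda>t. vee (rel (Q t) (Q' t) i)) has_vector_derivative
     vee (hat (u t $ i) ** (transpose (Q t $ i) ** Q' t $ i) - (transpose (Q t $ i) ** Q' t $ i) ** hat (u' t $ i))) (at t within {0..})"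
proof -
  have "((\<lambda>t. transpose (Q t $ i) ** Q' t $ i) has_vector_derivative
      (transpose (Q t $ i) ** (- (Q' t $ i ** hat (u' t $ i))) + transpose (- (Q t $ i ** hat (u t $ i))) ** Q' t $ i)) (at t within {0..})"
    by (intro has_vector_derivative_matrix_mult has_vector_derivative_transpose solutionD assms)
  also have "transpose (Q t $ i) ** (- (Q' t $ i ** hat (u' t $ i))) + transpose (- (Q t $ i ** hat (u t $ i))) ** Q' t $ i
     = hat (u t $ i) ** (transpose (Q t $ i) ** Q' t $ i) - (transpose (Q t $ i) ** Q' t $ i) ** hat (u' t $ i)"
  proof -
    have "transpose (- (Q t $ i ** hat (u t $ i))) = hat (u t $ i) ** transpose (Q t $ i)"
      by (simp add: bounded_linear.linear[OF bounded_linear_transpose, THEN linear_neg] matrix_transpose_mul transpose_hat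
          bounded_bilinear.minus_left[OF bounded_bilinear_matrix_mult])
    then show ?thesis
      by (simp add: bounded_bilinear.minus_right[OF bounded_bilinear_matrix_mult] matrix_mul_assoc)
  qed
  finally show ?thesis
    unfolding rel_def by (intro has_vector_derivative_vee) (auto intro!: derivative_eq_intros)
qed

text \<open>The constants are chosen so that closeness \<open>\<eta>\<close> to the critical orientations makes the linearization error absorbable.
  The directions used by agent \<open>i\<close> are Lipschitz in the preceding attitudes, hence the sum over \<open>j < i\<close>.\<close>

lemma dissipative_form_exists:
  assumes D: "D \<in> crit i"
  shows "\<exists>\<epsilon> c \<eta> A. \<epsilon> > 0 \<and> c > 0 \<and> \<eta> > 0 \<and> A > 0 \<and> dissipative_form i D \<epsilon> c \<eta> A"
proof -
  interpret gain_eigenbasis "C i" "k i" "b i" "e i" "l i" by (rule eigenbasis)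
  have rotD: "rotation_matrix D" using D by (simp add: critical_def)
  obtain h \<Lambda> where h: "h > 0" "\<Lambda> > 0"
    "\<And>x. h * norm x \<le> norm (hess i D x)" "\<And>x. norm (hess i D x) \<le> \<Lambda> * norm x"
    "D = mat 1 \<Longrightarrow> \<forall>x. h * (norm x)\<^sup>2 \<le> x \<bullet> hess i D x"
    by (rule hessian_bounds[OF D]) blast
  obtain w where w: "w \<ge> 0" "\<And>t. t \<ge> 0 \<Longrightarrow> norm (om i t) \<le> w" using om_bound by metis
  define K1 where "K1 = (\<Sum>c\<in>C i. k i c * norm (b i c))"
  define K2 where "K2 = (\<Sum>c\<in>C i. k i c * norm (b i c) * (5 * norm (b i c) + 6))"
  have K: "K1 \<ge> 0" "K2 \<ge> 0" using k_pos[of _ i] by (auto simp: K1_def K2_def less_imp_le intro!: sum_nonneg mult_nonneg_nonneg)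
  note sym = hessian_symmetric[OF torque_critical[OF D]]
  obtain \<epsilon> c \<eta>0 Cg where \<epsilon>: "0 < \<epsilon>" "\<epsilon> \<le> min 1 (h / (4 * \<Lambda>\<^sup>2))" "c > 0" "\<eta>0 > 0" "Cg > 0" and decay:
    "\<And>x d r1 r2 om \<gamma>. norm om \<le> w \<Longrightarrow> norm r1 \<le> \<eta>0 * (norm x + norm d) \<Longrightarrow>
       norm r2 \<le> \<eta>0 * norm x + K1 * \<gamma> \<Longrightarrow> \<gamma> \<ge> 0 \<Longrightarrow>
       d \<bullet> (om \<times> d - \<kappa> *\<^sub>R d - hess i D x + r2) + hess i D x \<bullet> (d + r1)
         + \<epsilon> * ((om \<times> d - \<kappa> *\<^sub>R d - hess i D x + r2) \<bullet> hess i D x + d \<bullet> hess i D (d + r1))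
       \<le> - c * ((norm x)\<^sup>2 + (norm d)\<^sup>2) + Cg * \<gamma>\<^sup>2"
    by (rule energy_form_decay[OF \<kappa>_pos w(1) K(1) h(1,2) _ sym h(3,4), of "min 1 (h / (4 * \<Lambda>\<^sup>2))"])
       (use h in auto)
  define N where "N = real CARD('f)"
  have N: "N \<ge> 1" by (simp add: N_def Suc_leI)
  \<comment> \<open>At distance \<open>\<eta>\<close> from the targets, relative rotations and estimated directions are off by at most \<open>z * \<eta>\<close>.\<close>
  define z where "z = 2 + L * N"
  have z: "z \<ge> 2" using L_nonneg N by (simp add: z_def)
  define \<eta> where "\<eta> = Min {\<eta>0 / 12, \<eta>0 / ((K2 + 1) * z), 1 / (2 * z)}"
  have "\<eta> > 0" using \<epsilon> K z by (auto simp: \<eta>_def Min_gr_iff)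
  moreover have "\<eta> \<le> \<eta>0 / 12" "\<eta> \<le> \<eta>0 / ((K2 + 1) * z)" "\<eta> \<le> 1 / (2 * z)"
    unfolding \<eta>_def by (rule Min_le; simp)+
  ultimately have \<eta>: "\<eta> > 0" "12 * \<eta> \<le> \<eta>0" "K2 * (z * \<eta>) \<le> \<eta>0" "z * \<eta> \<le> 1 / 2"
  proof -
    have "(K2 + 1) * z > 0" "2 * z > 0" using z K by (auto intro!: mult_pos_pos)
    then have "\<eta> * ((K2 + 1) * z) \<le> \<eta>0" "\<eta> * (2 * z) \<le> 1"
      using \<open>\<eta> \<le> \<eta>0 / ((K2 + 1) * z)\<close> \<open>\<eta> \<le> 1 / (2 * z)\<close> by (simp_all only: pos_le_divide_eq)
    then have "(K2 + 1) * (z * \<eta>) \<le> \<eta>0" "z * \<eta> \<le> 1 / 2" "0 \<le> z * \<eta>"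
      using \<open>\<eta> > 0\<close> z by (auto simp: mult_ac)
    then show "K2 * (z * \<eta>) \<le> \<eta>0" "z * \<eta> \<le> 1 / 2" by (auto simp: distrib_right)
  qed auto
  define S where "S = real (card (C i)) * L * 3"
  have S: "S \<ge> 0" using L_nonneg by (simp add: S_def)
  define c1 where "c1 = min c (min (1/4) (h/4))"
  define A where "A = max (1 + \<Lambda> + \<epsilon> * \<Lambda>) (Cg * S\<^sup>2 * N + 1)"
  have c1: "c1 > 0" and A: "A > 0" using \<epsilon> h by (auto simp: c1_def A_def intro!: less_max_iff_disj[THEN iffD2] add_pos_pos)
  have "dissipative_form i D \<epsilon> c1 \<eta> A"
    unfolding dissipative_form_def
  proof (intro conjI allI impI)
    fix x d :: "real^3"
    have "\<bar>energy_form \<epsilon> (hess i D) x d\<bar> \<le> (1 + \<Lambda> + \<epsilon> * \<Lambda>) * ((norm x)\<^sup>2 + (norm d)\<^sup>2)"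
      by (rule energy_form_le) (use h \<epsilon> in auto)
    also have "\<dots> \<le> A * ((norm x)\<^sup>2 + (norm d)\<^sup>2)" by (intro mult_right_mono) (auto simp: A_def)
    finally show "\<bar>energy_form \<epsilon> (hess i D) x d\<bar> \<le> A * ((norm x)\<^sup>2 + (norm d)\<^sup>2)" .
    assume "D = mat 1"
    then have "min (1/4) (h/4) * ((norm x)\<^sup>2 + (norm d)\<^sup>2) \<le> energy_form \<epsilon> (hess i D) x d"
      using h \<epsilon> by (intro energy_form_ge[where \<Lambda>=\<Lambda>]) auto
    moreover have "c1 * ((norm x)\<^sup>2 + (norm d)\<^sup>2) \<le> min (1/4) (h/4) * ((norm x)\<^sup>2 + (norm d)\<^sup>2)"
      by (intro mult_right_mono) (auto simp: c1_def)
    ultimately show "c1 * ((norm x)\<^sup>2 + (norm d)\<^sup>2) \<le> energy_form \<epsilon> (hess i D) x d" by linarith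
  next
    fix Q u Q' u' t
    assume sol: "solution Q u" "solution Q' u'" and t: "t \<ge> (0::real)"
      and nr: "near \<eta> (\<lambda>j. if j = i then D else mat 1) {..i} (Q t) (u t)"
      "near \<eta> (\<lambda>j. if j = i then D else mat 1) {..i} (Q' t) (u' t)"
    note rot = solutionD(1)[OF sol(1) t] solutionD(1)[OF sol(2) t]
    let ?G = "transpose (Q t $ i) ** Q' t $ i" and ?B = "rel (Q t) (Q' t) i"
    let ?x = "vee ?B" and ?d = "u t $ i - u' t $ i"
    define r1 where "r1 = vee (hat (u t $ i) ** ?G - ?G ** hat (u' t $ i)) - ?d"
    define r2 where "r2 = drive i (Q t) - drive i (Q' t) + hess i D ?x"
    define \<gamma> where "\<gamma> = (\<Sum>c\<in>C i. norm (g i c (Q t) - g i c (Q' t)))"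
    have rotG: "rotation_matrix ?G" by (intro rotation_matrix_mult rotation_matrix_transpose rot)
    have ni: "norm (Q t $ i - D) \<le> \<eta>" "norm (Q' t $ i - D) \<le> \<eta>" "norm (u t $ i) \<le> \<eta>" "norm (u' t $ i) \<le> \<eta>"
      using nearD[OF nr(1), of i] nearD[OF nr(2), of i] by auto
    have nj: "norm (Q t $ j - mat 1) \<le> \<eta>" "norm (Q' t $ j - mat 1) \<le> \<eta>" if "j < i" for j
      using nearD[OF nr(1), of j] nearD[OF nr(2), of j] that by (cases "j = i"; simp add: less_imp_le)+
    have tri: "norm (a - b') \<le> 2 * \<eta>" if "norm (a - d) \<le> \<eta>" "norm (b' - d) \<le> \<eta>" for a b' d :: "real^3^3"
      using norm_triangle_ineq4[of "a - d" "b' - d"] that by simp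
    have \<eta>z: "2 * \<eta> \<le> z * \<eta>" "\<eta> \<le> z * \<eta>" using mult_right_mono[OF z, of \<eta>] \<eta>(1) by auto
    have Bn: "norm ?B \<le> 2 * \<eta>" using norm_rel[of "Q t" i "Q' t"] rot tri[OF ni(1,2)] by simp
    have B3: "norm ?B \<le> 3 * norm ?x"
      using rotation_minus_id(2)[OF rotG, of ?B] Bn \<eta>z \<eta>(4) by (simp add: rel_def)
    have r1: "norm r1 \<le> \<eta>0 * (norm ?x + norm ?d)"
    proof -
      have "norm r1 \<le> 2 * (norm (u t $ i) + norm (u' t $ i)) * norm ?B"
        unfolding r1_def by (rule relative_rotation_rate[OF rotG]) (simp add: rel_def)
      also have "\<dots> \<le> 2 * (\<eta> + \<eta>) * (3 * norm ?x)" using ni B3 \<eta>(1) by (intro mult_mono add_mono) auto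
      also have "\<dots> = 12 * \<eta> * norm ?x" by simp
      also have "\<dots> \<le> \<eta>0 * norm ?x" using \<eta>(2) by (intro mult_right_mono) auto
      also have "\<dots> \<le> \<eta>0 * (norm ?x + norm ?d)" using \<epsilon> by (intro mult_left_mono) auto
      finally show ?thesis .
    qed
    have r2: "norm r2 \<le> \<eta>0 * norm ?x + K1 * \<gamma>"
    proof -
      have "norm r2 \<le> K1 * \<gamma> + K2 * (z * \<eta> * norm ?x)"
        unfolding r2_def \<gamma>_def K1_def K2_def
      proof (rule torque_difference[OF finite_C k_pos rot rotD])
        show "norm ?B \<le> z * \<eta>" using Bn \<eta>z by linarith
        show "norm (Q' t $ i - D) \<le> z * \<eta>" using ni \<eta>z by linarith
        fix c assume c: "c \<in> C i"
        have "norm (g i c (Q' t) - b i c) \<le> L * (\<Sum>j\<in>{..<i}. norm (Q' t $ j - mat 1))"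
          using g_lipschitz[OF c, of "Q' t" "\<chi> j. mat 1"] rot rotation_matrix_id by (simp add: g_id[OF c])
        also have "\<dots> \<le> L * (\<Sum>j\<in>{..<i}. \<eta>)" using nj L_nonneg by (intro mult_left_mono sum_mono) auto
        also have "\<dots> \<le> L * (N * \<eta>)"
          using L_nonneg \<eta> by (intro mult_left_mono) (auto simp: N_def intro!: mult_right_mono card_mono)
        also have "\<dots> \<le> z * \<eta>" using \<eta> by (simp add: z_def algebra_simps)
        finally show "norm (g i c (Q' t) - b i c) \<le> z * \<eta>" .
      qed (use \<eta> in \<open>auto simp: rel_def\<close>)
      also have "K2 * (z * \<eta> * norm ?x) \<le> \<eta>0 * norm ?x"
        using mult_right_mono[OF \<eta>(3), of "norm ?x"] by (simp add: mult.assoc)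
      finally show ?thesis by simp
    qed
    have \<gamma>0: "\<gamma> \<ge> 0" by (simp add: \<gamma>_def sum_nonneg)
    have \<gamma>: "\<gamma>\<^sup>2 \<le> S\<^sup>2 * N * (\<Sum>j\<in>{..<i}. gap (Q t) (u t) (Q' t) (u' t) j)"
    proof -
      have "\<gamma> \<le> (\<Sum>c\<in>C i. L * (\<Sum>j\<in>{..<i}. norm (Q t $ j - Q' t $ j)))"
        unfolding \<gamma>_def by (intro sum_mono g_lipschitz rot)
      also have "\<dots> \<le> (\<Sum>c\<in>C i. L * (\<Sum>j\<in>{..<i}. 3 * norm (vee (rel (Q t) (Q' t) j))))"
      proof (intro sum_mono mult_left_mono norm_rel_le rot L_nonneg)
        fix j assume "j \<in> {..<i}"
        then show "norm (Q t $ j - Q' t $ j) \<le> 1/2" using tri[OF nj[of j]] \<eta>z \<eta>(4) by simp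
      qed
      also have "\<dots> = S * (\<Sum>j\<in>{..<i}. norm (vee (rel (Q t) (Q' t) j)))"
        by (simp add: S_def sum_distrib_left mult_ac)
      finally have "\<gamma>\<^sup>2 \<le> (S * (\<Sum>j\<in>{..<i}. norm (vee (rel (Q t) (Q' t) j))))\<^sup>2" using \<gamma>0 by (rule power_mono)
      also have "\<dots> = S\<^sup>2 * (\<Sum>j\<in>{..<i}. norm (vee (rel (Q t) (Q' t) j)))\<^sup>2" by (simp add: power_mult_distrib)
      also have "\<dots> \<le> S\<^sup>2 * ((\<Sum>j\<in>{..<i}. (norm (vee (rel (Q t) (Q' t) j)))\<^sup>2) * card {..<i})"
        by (intro mult_left_mono sum_squared_le_sum_of_squares) auto
      also have "\<dots> \<le> S\<^sup>2 * ((\<Sum>j\<in>{..<i}. gap (Q t) (u t) (Q' t) (u' t) j) * N)"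
        by (intro mult_left_mono mult_mono sum_mono) (auto simp: gap_def N_def sum_nonneg intro!: card_mono)
      finally show ?thesis by (simp add: mult_ac)
    qed
    have x': "((\<lambda>t. vee (rel (Q t) (Q' t) i)) has_vector_derivative ?d + r1) (at t within {0..})"
      using rel_derivative[OF sol t, of i] by (simp add: r1_def)
    have d': "((\<lambda>t. u t $ i - u' t $ i) has_vector_derivative (om i t \<times> ?d - \<kappa> *\<^sub>R ?d - hess i D ?x + r2)) (at t within {0..})"
      using has_vector_derivative_diff[OF solutionD(3)[OF sol(1) t, of i] solutionD(3)[OF sol(2) t, of i]]
      by (simp add: r2_def Cross3.right_diff_distrib algebra_simps)
    let ?P = "?d \<bullet> (om i t \<times> ?d - \<kappa> *\<^sub>R ?d - hess i D ?x + r2) + hess i D ?x \<bullet> (?d + r1)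
         + \<epsilon> * ((om i t \<times> ?d - \<kappa> *\<^sub>R ?d - hess i D ?x + r2) \<bullet> hess i D ?x + ?d \<bullet> hess i D (?d + r1))"
    have "((\<lambda>t. agent_form \<epsilon> i D (Q t) (u t) (Q' t) (u' t)) has_real_derivative ?P) (at t within {0..})"
      unfolding agent_form_def by (rule energy_form_has_derivative[OF linear_hessian sym x' d'])
    moreover have "?P \<le> - c1 * gap (Q t) (u t) (Q' t) (u' t) i + A * (\<Sum>j\<in>{..<i}. gap (Q t) (u t) (Q' t) (u' t) j)"
    proof -
      have "?P \<le> - c * gap (Q t) (u t) (Q' t) (u' t) i + Cg * \<gamma>\<^sup>2"
        unfolding gap_def by (rule decay[OF w(2)[OF t] r1 r2 \<gamma>0])
      moreover have "c1 * gap (Q t) (u t) (Q' t) (u' t) i \<le> c * gap (Q t) (u t) (Q' t) (u' t) i"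
        by (intro mult_right_mono gap_nonneg) (simp add: c1_def)
      moreover have "Cg * \<gamma>\<^sup>2 \<le> Cg * (S\<^sup>2 * N * (\<Sum>j\<in>{..<i}. gap (Q t) (u t) (Q' t) (u' t) j))"
        using \<gamma> \<epsilon> by (intro mult_left_mono) auto
      moreover have "Cg * (S\<^sup>2 * N) * (\<Sum>j\<in>{..<i}. gap (Q t) (u t) (Q' t) (u' t) j) \<le> A * (\<Sum>j\<in>{..<i}. gap (Q t) (u t) (Q' t) (u' t) j)"
        by (intro mult_right_mono sum_nonneg gap_nonneg) (simp add: A_def)
      ultimately show ?thesis by (simp add: mult.assoc)
    qed
    ultimately show "\<exists>P. ((\<lambda>t. agent_form \<epsilon> i D (Q t) (u t) (Q' t) (u' t)) has_real_derivative P) (at t within {0..}) \<and>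
        P \<le> - c1 * gap (Q t) (u t) (Q' t) (u' t) i + A * (\<Sum>j\<in>{..<i}. gap (Q t) (u t) (Q' t) (u' t) j)" by blast
  qed
  then show ?thesis using \<epsilon>(1) c1 \<eta>(1) A by blast
qed

end

section \<open>Contraction along the cascade\<close>

text \<open>The path eventually stays in the union of small balls around the zeros. These are disjoint, so by
  connectedness it stays in one of them.\<close>

lemma tendsto_some_zero:
  fixes q :: "real \<Rightarrow> 'a::metric_space" and f :: "'a \<Rightarrow> 'b::real_normed_vector"
  assumes S: "compact S" and f: "continuous_on S f" and fin: "finite {x \<in> S. f x = 0}"
    and q: "continuous_on {0..} q" "\<And>t. t \<ge> 0 \<Longrightarrow> q t \<in> S" and lim: "((\<lambda>t. f (q t)) \<longlongrightarrow> 0) at_top"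
  obtains D where "D \<in> S" "f D = 0" "(q \<longlongrightarrow> D) at_top"
proof -
  define Z where "Z = {x \<in> S. f x = 0}"
  have close: "eventually (\<lambda>t. \<exists>D\<in>Z. dist D (q t) < r) at_top" if r: "r > 0" for r
  proof -
    let ?K = "S - (\<Union>D\<in>Z. ball D r)"
    have "compact ?K" by (intro compact_diff S open_UN) auto
    show ?thesis
    proof (cases "?K = {}")
      case True
      then have "\<exists>D\<in>Z. dist D (q t) < r" if "t \<ge> 0" for t
        using subsetD[of S "\<Union>D\<in>Z. ball D r", OF _ q(2)[OF that]] by auto
      then show ?thesis using eventually_ge_at_top[of 0] by (rule eventually_mono[rotated])
    next
      case False
      have cont: "continuous_on ?K (\<lambda>x. norm (f x))" by (intro continuous_intros continuous_on_subset[OF f]) auto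
      obtain x where x: "x \<in> ?K" "\<forall>y\<in>?K. norm (f x) \<le> norm (f y)"
        using continuous_attains_inf[OF \<open>compact ?K\<close> False cont] ..
      have "f x \<noteq> 0" using x(1) r by (auto simp: Z_def)
      then have "eventually (\<lambda>t. dist (f (q t)) 0 < norm (f x)) at_top" by (intro tendstoD[OF lim]) auto
      then show ?thesis using eventually_ge_at_top[of 0]
      proof eventually_elim
        case (elim t)
        have "q t \<in> (\<Union>D\<in>Z. ball D r)"
        proof (rule ccontr)
          assume "q t \<notin> (\<Union>D\<in>Z. ball D r)"
          then have "q t \<in> ?K" using q(2)[OF elim(2)] by blast
          then show False using bspec[OF x(2)] elim(1) by fastforce
        qed
        then show ?case by auto
      qed
    qed
  qed
  have finZ: "finite Z" using fin by (simp add: Z_def)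
  have "\<forall>D\<in>Z. \<exists>d>0. \<forall>x\<in>Z. x \<noteq> D \<longrightarrow> d \<le> dist D x" using finite_set_avoid[OF finZ] by blast
  then obtain d where d: "\<And>D. D \<in> Z \<Longrightarrow> d D > 0" "\<And>D x. D \<in> Z \<Longrightarrow> x \<in> Z \<Longrightarrow> x \<noteq> D \<Longrightarrow> d D \<le> dist D x"
    by metis
  define r0 where "r0 = Min (insert 1 (d ` Z)) / 2"
  have r0: "r0 > 0" using d(1) finZ by (auto simp: r0_def)
  have sep: "2 * r0 \<le> dist D x" if "D \<in> Z" "x \<in> Z" "x \<noteq> D" for D x
  proof -
    have "Min (insert 1 (d ` Z)) \<le> d D" using finZ that by (intro Min_le) auto
    then show ?thesis using d(2)[OF that] by (simp add: r0_def)
  qed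
  have uniq: "D = D'" if "D \<in> Z" "D' \<in> Z" "dist D x < r0" "dist D' x < r0" for D D' x
    using sep[of D D'] dist_triangle_less_add[of D x r0 D' r0] that by (force simp: dist_commute)
  obtain T where T: "T \<ge> 0" "\<And>t. t \<ge> T \<Longrightarrow> \<exists>D\<in>Z. dist D (q t) < r0"
    using eventually_conj[OF eventually_ge_at_top[of 0] close[OF r0]] unfolding eventually_at_top_linorder
    by (meson order_refl)
  obtain D where D: "D \<in> Z" "dist D (q T) < r0" using T by blast
  have stay: "dist D (q t) < r0" if t: "t \<ge> T" for t
  proof (rule ccontr)
    assume nD: "\<not> dist D (q t) < r0"
    have con: "connected (q ` {T..})"
      using T(1) by (intro connected_continuous_image continuous_on_subset[OF q(1)]) auto
    have "connected (q ` {T..}) \<Longrightarrow> False"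
    proof -
      let ?V = "\<Union>D'\<in>Z - {D}. ball D' r0"
      have "q ` {T..} \<subseteq> ball D r0 \<union> ?V" using T(2) by fastforce
      moreover have "ball D r0 \<inter> ?V \<inter> q ` {T..} = {}" using uniq D(1) by fastforce
      moreover have "ball D r0 \<inter> q ` {T..} \<noteq> {}" using D(2) by fastforce
      moreover have "?V \<inter> q ` {T..} \<noteq> {}"
      proof -
        obtain D' where "D' \<in> Z" "dist D' (q t) < r0" using T(2)[OF t] by blast
        then show ?thesis using nD t by fastforce
      qed
      ultimately show False
        using connectedD[OF con, of "ball D r0" ?V] by auto
    qed
    then show False using con by simp
  qed
  have "(q \<longlongrightarrow> D) at_top"
  proof (rule tendstoI)
    fix r :: real assume "r > 0"
    then have "eventually (\<lambda>t. \<exists>D\<in>Z. dist D (q t) < min r r0) at_top" using r0 by (intro close) auto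
    then show "eventually (\<lambda>t. dist (q t) D < r) at_top"
      using eventually_ge_at_top[of T]
    proof eventually_elim
      case (elim t)
      then obtain D' where D': "D' \<in> Z" "dist D' (q t) < r" "dist D' (q t) < r0" by auto
      then show ?case using uniq[OF D(1) D'(1) stay[OF elim(2)]] by (simp add: dist_commute)
    qed
  qed
  then show ?thesis using that[of D] D(1) by (auto simp: Z_def)
qed

context orientation_cascade
begin

lemma dissipative_form_decay:
  assumes "dissipative_form i D \<epsilon> c \<eta> A" "solution Q u" "solution Q' u'" "t \<ge> 0"
    "near \<eta> (\<lambda>j. if j = i then D else mat 1) {..i} (Q t) (u t)"
    "near \<eta> (\<lambda>j. if j = i then D else mat 1) {..i} (Q' t) (u' t)"
  shows "\<exists>P. ((\<lambda>t. agent_form \<epsilon> i D (Q t) (u t) (Q' t) (u' t)) has_real_derivative P) (at t within {0..}) \<and>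
        P \<le> - c * gap (Q t) (u t) (Q' t) (u' t) i + A * (\<Sum>j\<in>{..<i}. gap (Q t) (u t) (Q' t) (u' t) j)"
  using assms by (simp add: dissipative_form_def)

lemma dissipative_form_abs:
  "dissipative_form i D \<epsilon> c \<eta> A \<Longrightarrow> \<bar>agent_form \<epsilon> i D Q u Q' u'\<bar> \<le> A * gap Q u Q' u' i"
  by (simp add: dissipative_form_def agent_form_def gap_def)

lemma dissipative_form_pos:
  "dissipative_form i (mat 1) \<epsilon> c \<eta> A \<Longrightarrow> c * gap Q u Q' u' i \<le> agent_form \<epsilon> i (mat 1) Q u Q' u'"
  by (simp add: dissipative_form_def agent_form_def gap_def)

lemma crit_finite: "finite (crit i)"
proof -
  interpret gain_eigenbasis "C i" "k i" "b i" "e i" "l i" by (rule eigenbasis)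
  show ?thesis by (rule finite_critical)
qed

lemma uniform_agent_ok:
  obtains \<epsilon> c \<eta> A where "c > 0" "\<eta> > 0" "\<eta> \<le> 1/8" "A > 0"
    "\<And>i D. D \<in> crit i \<Longrightarrow> \<epsilon> i D > 0 \<and> dissipative_form i D (\<epsilon> i D) c \<eta> A"
proof -
  have "\<forall>p\<in>Sigma UNIV crit. \<exists>\<epsilon> c \<eta> A. \<epsilon> > 0 \<and> c > 0 \<and> \<eta> > 0 \<and> A > 0 \<and> dissipative_form (fst p) (snd p) \<epsilon> c \<eta> A"
    using dissipative_form_exists by auto
  then obtain ef where "\<forall>p\<in>Sigma UNIV crit. \<exists>c \<eta> A. ef p > 0 \<and> c > 0 \<and> \<eta> > 0 \<and> A > 0 \<and> dissipative_form (fst p) (snd p) (ef p) c \<eta> A"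
    by (rule exE[OF bchoice]) (rule that)
  then obtain cf where "\<forall>p\<in>Sigma UNIV crit. \<exists>\<eta> A. ef p > 0 \<and> cf p > 0 \<and> \<eta> > 0 \<and> A > 0 \<and> dissipative_form (fst p) (snd p) (ef p) (cf p) \<eta> A"
    by (rule exE[OF bchoice]) (rule that)
  then obtain hf where "\<forall>p\<in>Sigma UNIV crit. \<exists>A. ef p > 0 \<and> cf p > 0 \<and> hf p > 0 \<and> A > 0 \<and> dissipative_form (fst p) (snd p) (ef p) (cf p) (hf p) A"
    by (rule exE[OF bchoice]) (rule that)
  then obtain Af where f: "\<forall>p\<in>Sigma UNIV crit. ef p > 0 \<and> cf p > 0 \<and> hf p > 0 \<and> Af p > 0 \<and> dissipative_form (fst p) (snd p) (ef p) (cf p) (hf p) (Af p)"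
    by (rule exE[OF bchoice]) (rule that)
  note f = bspec[OF f]
  have fin: "finite (Sigma UNIV crit)" by (intro finite_SigmaI crit_finite) auto
  define c where "c = Min (insert 1 (cf ` Sigma UNIV crit))"
  define \<eta> where "\<eta> = Min (insert (1/8) (hf ` Sigma UNIV crit))"
  define A where "A = Max (insert 1 (Af ` Sigma UNIV crit))"
  show ?thesis
  proof (rule that[of c \<eta> A "\<lambda>i D. ef (i, D)"])
    show "c > 0" "\<eta> > 0" using fin f by (auto simp: c_def \<eta>_def)
    show "\<eta> \<le> 1/8" unfolding \<eta>_def by (rule Min_le) (use fin in auto)
    have "1 \<le> A" unfolding A_def by (rule Max_ge) (use fin in auto)
    then show "A > 0" by simp
    fix i D assume "D \<in> crit i"
    then have p: "(i, D) \<in> Sigma UNIV crit" by auto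
    have "dissipative_form i D (ef (i, D)) c \<eta> A"
    proof (rule dissipative_form_mono)
      show "dissipative_form i D (ef (i, D)) (cf (i, D)) (hf (i, D)) (Af (i, D))" using f[OF p] by simp
      show "c \<le> cf (i, D)" "\<eta> \<le> hf (i, D)" unfolding c_def \<eta>_def by (rule Min_le; use fin p in force)+
      show "Af (i, D) \<le> A" unfolding A_def by (rule Max_ge; use fin p in force)
    qed
    then show "ef (i, D) > 0 \<and> dissipative_form i D (ef (i, D)) c \<eta> A" using f[OF p] by simp
  qed
qed

definition cascade_form where
  "cascade_form a \<epsilon> J D Q u Q' u' = (\<Sum>j\<in>J. a j * agent_form (\<epsilon> j (D j)) j (D j) Q u Q' u')"

lemma cascade_form_bound:
  assumes "\<And>j. j \<in> J \<Longrightarrow> dissipative_form j (D j) (\<epsilon> j (D j)) c \<eta> A" "\<And>j. 0 < a j \<and> a j \<le> (1::real)" "A > 0"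
  shows "\<bar>cascade_form a \<epsilon> J D Q u Q' u'\<bar> \<le> A * (\<Sum>j\<in>J. gap Q u Q' u' j)"
proof -
  have "\<bar>cascade_form a \<epsilon> J D Q u Q' u'\<bar> \<le> (\<Sum>j\<in>J. \<bar>a j * agent_form (\<epsilon> j (D j)) j (D j) Q u Q' u'\<bar>)"
    unfolding cascade_form_def by (rule sum_abs)
  also have "\<dots> \<le> (\<Sum>j\<in>J. A * gap Q u Q' u' j)"
  proof (rule sum_mono)
    fix j assume "j \<in> J"
    then have "\<bar>agent_form (\<epsilon> j (D j)) j (D j) Q u Q' u'\<bar> \<le> A * gap Q u Q' u' j"
      by (rule dissipative_form_abs[OF assms(1)])
    moreover have "\<bar>a j * agent_form (\<epsilon> j (D j)) j (D j) Q u Q' u'\<bar> \<le> 1 * \<bar>agent_form (\<epsilon> j (D j)) j (D j) Q u Q' u'\<bar>"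
      using assms(2)[of j] unfolding abs_mult by (intro mult_right_mono) auto
    ultimately show "\<bar>a j * agent_form (\<epsilon> j (D j)) j (D j) Q u Q' u'\<bar> \<le> A * gap Q u Q' u' j" by simp
  qed
  finally show ?thesis by (simp add: sum_distrib_left)
qed

text \<open>Each agent is disturbed by its predecessors only. If its weight is smaller than theirs by a large
  enough factor, the disturbance is absorbed by the decay of their forms.\<close>

lemma cascade_form_decay:
  assumes ok: "\<And>j. j \<in> J \<Longrightarrow> dissipative_form j (D j) (\<epsilon> j (D j)) c \<eta> A" and c: "c > 0" and A: "A > 0"
    and J: "\<And>i j. i \<in> J \<Longrightarrow> j < i \<Longrightarrow> j \<in> J \<and> D j = mat 1"
  obtains a \<mu> where "\<And>j. 0 < a j \<and> a j \<le> (1::real)" "\<mu> > 0"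
    "\<And>Q u Q' u' t. solution Q u \<Longrightarrow> solution Q' u' \<Longrightarrow> t \<ge> 0 \<Longrightarrow> near \<eta> D J (Q t) (u t) \<Longrightarrow> near \<eta> D J (Q' t) (u' t) \<Longrightarrow>
      \<exists>P. ((\<lambda>t. cascade_form a \<epsilon> J D (Q t) (u t) (Q' t) (u' t)) has_real_derivative P) (at t within {0..}) \<and>
        P \<le> - \<mu> * (\<Sum>j\<in>J. gap (Q t) (u t) (Q' t) (u' t) j)"
proof -
  define N where "N = real CARD('f)"
  have N: "N \<ge> 1" by (simp add: N_def Suc_leI)
  define \<delta> where "\<delta> = min 1 (c / (2 * (A * N)))"
  have \<delta>: "0 < \<delta>" "\<delta> \<le> 1" using c A N by (auto simp: \<delta>_def)
  have \<delta>A: "A * N * \<delta> \<le> c / 2"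
  proof -
    have p: "2 * (A * N) > 0" using A N by simp
    have "\<delta> \<le> c / (2 * (A * N))" by (simp add: \<delta>_def)
    then have "\<delta> * (2 * (A * N)) \<le> c" using p by (simp only: pos_le_divide_eq)
    then show ?thesis by (simp add: mult_ac)
  qed
  \<comment> \<open>The weight depends on the rank of the agent, so each one is \<open>\<delta>\<close> times smaller than all before.\<close>
  define a where "a j = \<delta> ^ card {i::'f. i < j}" for j
  have a: "0 < a j \<and> a j \<le> 1" for j using \<delta> by (simp add: a_def power_le_one)
  have a_lt: "a i \<le> \<delta> * a j" if "j < i" for i j
  proof -
    have "card {l. l < j} < card {l. l < i}" using that by (intro psubset_card_mono) auto
    then have "\<delta> ^ card {l. l < i} \<le> \<delta> ^ Suc (card {l. l < j})" using \<delta> by (intro power_decreasing) auto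
    then show ?thesis by (simp add: a_def)
  qed
  define m where "m = \<delta> ^ CARD('f)"
  have m: "m > 0" "m \<le> a j" for j using \<delta> unfolding m_def a_def by (auto intro!: power_decreasing card_mono)
  show ?thesis
  proof (rule that[of a "c / 2 * m"])
    show "0 < a j \<and> a j \<le> 1" for j by (rule a)
    show "c / 2 * m > 0" using c m by simp
    fix Q u Q' u' t assume *: "solution Q u" "solution Q' u'" "t \<ge> (0::real)" "near \<eta> D J (Q t) (u t)" "near \<eta> D J (Q' t) (u' t)"
    let ?n = "gap (Q t) (u t) (Q' t) (u' t)"
    have "\<forall>i\<in>J. \<exists>P. ((\<lambda>t. agent_form (\<epsilon> i (D i)) i (D i) (Q t) (u t) (Q' t) (u' t)) has_real_derivative P) (at t within {0..}) \<and>
        P \<le> - c * ?n i + A * (\<Sum>j\<in>{..<i}. ?n j)"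
    proof
      fix i assume i: "i \<in> J"
      have nr: "near \<eta> (\<lambda>j. if j = i then D i else mat 1) {..i} Q u" if "near \<eta> D J Q u" for Q u
        unfolding near_def
      proof
        fix j assume "j \<in> {..i}"
        then have *: "j \<in> J" "D j = (if j = i then D i else mat 1)" using J[OF i, of j] i by (auto simp: order_le_less)
        then show "norm (Q $ j - (if j = i then D i else mat 1)) \<le> \<eta> \<and> norm (u $ j) \<le> \<eta>"
          using nearD[OF that *(1)] unfolding *(2)[symmetric] by blast
      qed
      show "\<exists>P. ((\<lambda>t. agent_form (\<epsilon> i (D i)) i (D i) (Q t) (u t) (Q' t) (u' t)) has_real_derivative P) (at t within {0..}) \<and>
        P \<le> - c * ?n i + A * (\<Sum>j\<in>{..<i}. ?n j)"
        by (rule dissipative_form_decay[OF ok[OF i] *(1-3) nr[OF *(4)] nr[OF *(5)]])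
    qed
    then obtain P where P': "\<forall>i\<in>J. ((\<lambda>t. agent_form (\<epsilon> i (D i)) i (D i) (Q t) (u t) (Q' t) (u' t)) has_real_derivative P i) (at t within {0..}) \<and>
        P i \<le> - c * ?n i + A * (\<Sum>j\<in>{..<i}. ?n j)"
      by (rule exE[OF bchoice]) (rule that)
    note P = conjunct1[OF bspec[OF P']] conjunct2[OF bspec[OF P']]
    have "((\<lambda>t. cascade_form a \<epsilon> J D (Q t) (u t) (Q' t) (u' t)) has_real_derivative (\<Sum>i\<in>J. a i * P i)) (at t within {0..})"
      unfolding cascade_form_def by (intro DERIV_sum DERIV_cmult P(1))
    moreover have "(\<Sum>i\<in>J. a i * P i) \<le> - (c / 2 * m) * (\<Sum>j\<in>J. ?n j)"
    proof -
      have "(\<Sum>i\<in>J. a i * P i) \<le> (\<Sum>i\<in>J. - c * (a i * ?n i) + A * \<delta> * (\<Sum>j\<in>J. a j * ?n j))"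
      proof (rule sum_mono)
        fix i assume i: "i \<in> J"
        have "a i * P i \<le> a i * (- c * ?n i + A * (\<Sum>j\<in>{..<i}. ?n j))"
          using P(2)[OF i] a[of i] by (intro mult_left_mono) auto
        also have "\<dots> = - c * (a i * ?n i) + A * (\<Sum>j\<in>{..<i}. a i * ?n j)"
          by (simp add: algebra_simps sum_distrib_left)
        also have "(\<Sum>j\<in>{..<i}. a i * ?n j) \<le> (\<Sum>j\<in>{..<i}. \<delta> * (a j * ?n j))"
          using mult_right_mono[OF a_lt gap_nonneg] by (intro sum_mono) (auto simp: mult.assoc)
        also have "\<dots> \<le> (\<Sum>j\<in>J. \<delta> * (a j * ?n j))"
          using \<delta> a gap_nonneg J[OF i] by (intro sum_mono2) (auto intro!: mult_nonneg_nonneg simp: less_imp_le)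
        also have "A * \<dots> = A * \<delta> * (\<Sum>j\<in>J. a j * ?n j)" by (simp add: sum_distrib_left mult_ac)
        finally show "a i * P i \<le> - c * (a i * ?n i) + A * \<delta> * (\<Sum>j\<in>J. a j * ?n j)" using A by simp
      qed
      also have "\<dots> = - c * (\<Sum>i\<in>J. a i * ?n i) + real (card J) * (A * \<delta> * (\<Sum>j\<in>J. a j * ?n j))"
        by (simp only: sum.distrib sum_constant sum_distrib_left[of "- c", symmetric])
      also have "real (card J) * (A * \<delta> * (\<Sum>j\<in>J. a j * ?n j)) \<le> N * (A * \<delta> * (\<Sum>j\<in>J. a j * ?n j))"
        using A \<delta> a gap_nonneg
        by (intro mult_right_mono) (auto simp: N_def less_imp_le intro!: card_mono mult_nonneg_nonneg sum_nonneg)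
      also have "N * (A * \<delta> * (\<Sum>j\<in>J. a j * ?n j)) = (A * N * \<delta>) * (\<Sum>j\<in>J. a j * ?n j)" by (simp add: mult_ac)
      also have "\<dots> \<le> c / 2 * (\<Sum>j\<in>J. a j * ?n j)"
        using a gap_nonneg by (intro mult_right_mono \<delta>A sum_nonneg mult_nonneg_nonneg) (auto simp: less_imp_le)
      finally have "(\<Sum>i\<in>J. a i * P i) \<le> - (c / 2) * (\<Sum>j\<in>J. a j * ?n j)" by simp
      moreover have "c / 2 * (m * (\<Sum>j\<in>J. ?n j)) \<le> c / 2 * (\<Sum>j\<in>J. a j * ?n j)"
        unfolding sum_distrib_left[of m] using c m(2) by (intro mult_left_mono sum_mono mult_right_mono gap_nonneg) auto
      ultimately show ?thesis by simp
    qed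
    ultimately show "\<exists>P. ((\<lambda>t. cascade_form a \<epsilon> J D (Q t) (u t) (Q' t) (u' t)) has_real_derivative P) (at t within {0..}) \<and>
        P \<le> - (c / 2 * m) * (\<Sum>j\<in>J. gap (Q t) (u t) (Q' t) (u' t) j)" by blast
  qed
qed

lemma tendsto_near:
  assumes J: "\<And>j. j \<in> J \<Longrightarrow> ((\<lambda>t. Q t $ j) \<longlongrightarrow> D j) at_top" "\<And>j. j \<in> J \<Longrightarrow> ((\<lambda>t. u t $ j) \<longlongrightarrow> 0) at_top" and "\<eta> > 0"
  shows "eventually (\<lambda>t. near \<eta> D J (Q t) (u t)) at_top"
proof -
  have "\<forall>j\<in>J. eventually (\<lambda>t. norm (Q t $ j - D j) \<le> \<eta> \<and> norm (u t $ j) \<le> \<eta>) at_top"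
  proof
    fix j assume j: "j \<in> J"
    show "eventually (\<lambda>t. norm (Q t $ j - D j) \<le> \<eta> \<and> norm (u t $ j) \<le> \<eta>) at_top"
      using tendstoD[OF J(1)[OF j] assms(3)] tendstoD[OF J(2)[OF j] assms(3)]
      by eventually_elim (auto simp: dist_norm less_imp_le)
  qed
  then show ?thesis unfolding near_def by (subst eventually_ball_finite_distrib) auto
qed

text \<open>The second solution in the comparison is the zero solution. The set \<open>J\<close> contains all predecessors of
  its members, so that the inequality closes.\<close>

lemma exponential_convergence:
  assumes sol: "solution Q u" and J: "\<And>i j. i \<in> J \<Longrightarrow> j < i \<Longrightarrow> j \<in> J"
    and lim: "\<And>j. j \<in> J \<Longrightarrow> ((\<lambda>t. Q t $ j) \<longlongrightarrow> mat 1) at_top" "\<And>j. j \<in> J \<Longrightarrow> ((\<lambda>t. u t $ j) \<longlongrightarrow> 0) at_top"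
  obtains K \<mu> T where "\<mu> > 0" "T \<ge> 0" "K \<ge> 0" "\<And>t j. t \<ge> T \<Longrightarrow> j \<in> J \<Longrightarrow> norm (Q t $ j - mat 1) \<le> K * exp (- \<mu> * (t - T))"
proof -
  obtain \<epsilon> c \<eta> A where ok: "c > 0" "\<eta> > 0" "\<eta> \<le> 1/8" "A > 0"
    "\<And>i D. D \<in> crit i \<Longrightarrow> \<epsilon> i D > 0 \<and> dissipative_form i D (\<epsilon> i D) c \<eta> A" by (rule uniform_agent_ok) blast
  let ?D = "\<lambda>_::'f. mat 1 :: real^3^3"
  have okI: "dissipative_form j (?D j) (\<epsilon> j (?D j)) c \<eta> A" for j using ok(5)[OF id_critical] by blast
  obtain a \<mu> where a: "\<And>j. 0 < a j \<and> a j \<le> (1::real)" and \<mu>: "\<mu> > 0" and decay: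
    "\<And>Q u Q' u' t. solution Q u \<Longrightarrow> solution Q' u' \<Longrightarrow> t \<ge> 0 \<Longrightarrow> near \<eta> ?D J (Q t) (u t) \<Longrightarrow> near \<eta> ?D J (Q' t) (u' t) \<Longrightarrow>
      \<exists>P. ((\<lambda>t. cascade_form a \<epsilon> J ?D (Q t) (u t) (Q' t) (u' t)) has_real_derivative P) (at t within {0..}) \<and>
        P \<le> - \<mu> * (\<Sum>j\<in>J. gap (Q t) (u t) (Q' t) (u' t) j)"
    by (rule cascade_form_decay[where J=J and D="?D" and \<epsilon>=\<epsilon>, OF okI ok(1,4)]) (use J in auto)
  obtain T where T: "T \<ge> 0" "\<And>t. t \<ge> T \<Longrightarrow> near \<eta> ?D J (Q t) (u t)"
    using eventually_conj[OF eventually_ge_at_top[of 0] tendsto_near[of J Q ?D u, OF lim ok(2)]]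
    unfolding eventually_at_top_linorder by (meson order_refl)
  let ?Q' = "(\<chi> j. mat 1) :: 'f orientations" and ?u' = "0 :: 'f velocities"
  define V where "V t = cascade_form a \<epsilon> J ?D (Q t) (u t) ?Q' ?u'" for t
  define n where "n t = (\<Sum>j\<in>J. gap (Q t) (u t) ?Q' ?u' j)" for t
  have Vle: "\<bar>V t\<bar> \<le> A * n t" for t
    unfolding V_def n_def by (rule cascade_form_bound[where c=c and \<eta>=\<eta>]) (use okI a ok in auto)
  have expV: "V t \<le> exp (- (\<mu> / A) * (t - T)) * V T" if t: "t \<ge> T" for t
  proof (rule exponential_comparison[OF T(1) t])
    fix s assume s: "T \<le> s"
    have "near \<eta> ?D J ?Q' ?u'" using ok by (simp add: near_def)
    then obtain P where P: "(V has_real_derivative P) (at s within {0..})" "P \<le> - \<mu> * n s"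
      using decay[OF sol trivial_solution, of s] T s unfolding V_def n_def by auto
    have "V s / A \<le> n s" using Vle[of s] ok(4) by (simp add: pos_divide_le_eq mult.commute)
    then have "\<mu> * (V s / A) \<le> \<mu> * n s" using \<mu> by (intro mult_left_mono) auto
    then show "\<exists>D. (V has_real_derivative D) (at s within {0..}) \<and> D \<le> - (\<mu> / A) * V s"
      using P by (intro exI[of _ P]) auto
  qed
  have Vge: "norm (Q t $ j - mat 1) \<le> sqrt (9 / (c * a j) * V t)" if t: "t \<ge> T" and j: "j \<in> J" for t j
  proof -
    have rot: "rotation_matrix (Q t $ j)" using solutionD(1)[OF sol] t T(1) by auto
    have pos: "c * gap (Q t) (u t) ?Q' ?u' i \<le> agent_form (\<epsilon> i (?D i)) i (?D i) (Q t) (u t) ?Q' ?u'" for i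
      by (rule dissipative_form_pos[OF okI])
    have "norm (Q t $ j - mat 1) \<le> 3 * norm (vee (rel (Q t) ?Q' j))"
      using norm_rel_le[of "Q t" j ?Q'] rot nearD(1)[OF T(2)[OF t] j] ok(3) by (simp add: rotation_matrix_id)
    then have "(norm (Q t $ j - mat 1))\<^sup>2 \<le> (3 * norm (vee (rel (Q t) ?Q' j)))\<^sup>2" by (rule power_mono) simp
    also have "\<dots> \<le> 9 * gap (Q t) (u t) ?Q' ?u' j" by (simp add: gap_def power_mult_distrib)
    also have "\<dots> = 9 / (c * a j) * (a j * (c * gap (Q t) (u t) ?Q' ?u' j))" using ok(1) a[of j] by simp
    also have "\<dots> \<le> 9 / (c * a j) * (a j * agent_form (\<epsilon> j (?D j)) j (?D j) (Q t) (u t) ?Q' ?u')"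
      using pos[of j] ok(1) a[of j] by (intro mult_left_mono) auto
    also have "\<dots> \<le> 9 / (c * a j) * V t"
    proof (rule mult_left_mono)
      show "a j * agent_form (\<epsilon> j (?D j)) j (?D j) (Q t) (u t) ?Q' ?u' \<le> V t"
        unfolding V_def cascade_form_def
      proof (rule member_le_sum)
        fix i show "0 \<le> a i * agent_form (\<epsilon> i (?D i)) i (?D i) (Q t) (u t) ?Q' ?u'"
          using pos[of i] a[of i] mult_nonneg_nonneg[OF less_imp_le[OF ok(1)] gap_nonneg[of "Q t" "u t" ?Q' ?u' i]]
          by (intro mult_nonneg_nonneg) auto
      qed (use j in auto)
      show "0 \<le> 9 / (c * a j)" using ok(1) a[of j] by simp
    qed
    finally show ?thesis using ok(1) a[of j] by (intro real_le_rsqrt) auto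
  qed
  have VT: "0 \<le> V T" if "j \<in> J" for j
  proof -
    have "0 \<le> 9 / (c * a j) * V T"
      using Vge[OF order_refl that] norm_ge_zero[of "Q T $ j - mat 1"] order_trans real_sqrt_ge_0_iff by blast
    moreover have "9 / (c * a j) > 0" using ok(1) a[of j] by simp
    ultimately show ?thesis by (simp only: zero_le_mult_iff) linarith
  qed
  define K where "K = (\<Sum>j\<in>J. sqrt (9 / (c * a j) * \<bar>V T\<bar>))"
  have sq: "0 \<le> sqrt (9 / (c * a j) * \<bar>V T\<bar>)" for j using ok(1) a[of j] by simp
  show ?thesis
  proof (rule that[of "\<mu> / A / 2" T K])
    show "\<mu> / A / 2 > 0" "T \<ge> 0" using \<mu> ok T by auto
    show "K \<ge> 0" unfolding K_def by (intro sum_nonneg sq)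
    fix t j assume t: "t \<ge> T" and j: "j \<in> J"
    have "sqrt (9 / (c * a j) * V t) \<le> sqrt (9 / (c * a j) * (exp (- (\<mu> / A) * (t - T)) * V T))"
      using expV[OF t] ok(1) a[of j] by (intro real_sqrt_le_mono mult_left_mono) auto
    also have "\<dots> = sqrt (9 / (c * a j) * \<bar>V T\<bar>) * sqrt (exp (- (\<mu> / A) * (t - T)))"
      unfolding real_sqrt_mult[symmetric] abs_of_nonneg[OF VT[OF j]] by (simp only: mult_ac)
    also have "sqrt (exp (- (\<mu> / A) * (t - T))) = exp (- (\<mu> / A / 2) * (t - T))"
      by (rule real_sqrt_unique) (simp_all add: power2_eq_square flip: exp_add)
    also have "sqrt (9 / (c * a j) * \<bar>V T\<bar>) \<le> K"
      unfolding K_def using j sq by (intro member_le_sum) auto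
    finally show "norm (Q t $ j - mat 1) \<le> K * exp (- (\<mu> / A / 2) * (t - T))"
      using Vge[OF t j] by simp
  qed
qed

end

section \<open>Convergence of every agent to a critical orientation\<close>

lemma finite_linorder_induct [case_names less]:
  assumes "\<And>x::'a::{finite,linorder}. (\<And>y. y < x \<Longrightarrow> P y) \<Longrightarrow> P x"
  shows "P a"
proof (induction a rule: measure_induct_rule[where f="\<lambda>x. card {..<x}"])
  case (less x)
  show ?case
  proof (rule assms)
    fix y assume "y < x"
    then have "{..<y} \<subset> {..<x}" by auto
    then show "P y" by (intro less psubset_card_mono) auto
  qed
qed

lemma inner_mult_vec: "x \<bullet> (A *v y) = (transpose (A::real^'n^'n) *v x) \<bullet> y"
  by (simp add: dot_lmul_matrix transpose_matrix_vector)

lemma torque_le: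
  assumes "rotation_matrix Q" and "\<And>c. c \<in> C \<Longrightarrow> k c > 0"
  shows "norm (torque C k b g Q) \<le> (\<Sum>c\<in>C. k c * norm (b c) * norm (g c))"
  unfolding torque_def
proof (rule sum_norm_le)
  fix c assume c: "c \<in> C"
  have "norm ((transpose Q *v g c) \<times> b c) \<le> norm (g c) * norm (b c)"
    using norm_cross_le[of "transpose Q *v g c" "b c"]
    by (simp add: norm_rotation_mult_vec rotation_matrix_transpose assms)
  then show "norm (k c *\<^sub>R ((transpose Q *v g c) \<times> b c)) \<le> k c * norm (b c) * norm (g c)"
    using assms(2)[OF c] by (simp add: mult_left_mono mult_ac)
qed

lemma torque_lipschitz:
  assumes "rotation_matrix Q2" and k: "\<And>c. c \<in> C \<Longrightarrow> k c > 0"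
  shows "norm (torque C k b g1 Q1 - torque C k b g2 Q2)
     \<le> (\<Sum>c\<in>C. k c * norm (b c) * (norm (Q1 - Q2) * norm (g1 c) + norm (g1 c - g2 c)))"
proof -
  have "torque C k b g1 Q1 - torque C k b g2 Q2
     = (\<Sum>c\<in>C. k c *\<^sub>R ((transpose (Q1 - Q2) *v g1 c + transpose Q2 *v (g1 c - g2 c)) \<times> b c))"
    unfolding torque_def sum_subtractf[symmetric]
    by (intro sum.cong refl)
      (simp add: scaleR_right_diff_distrib[symmetric] transpose_diff mult_vec_diff_left mult_vec_diff_right
        Cross3.left_diff_distrib[symmetric])
  also have "norm \<dots> \<le> (\<Sum>c\<in>C. k c * norm (b c) * (norm (Q1 - Q2) * norm (g1 c) + norm (g1 c - g2 c)))"
  proof (rule sum_norm_le)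
    fix c assume c: "c \<in> C"
    have "norm (transpose (Q1 - Q2) *v g1 c + transpose Q2 *v (g1 c - g2 c)) \<le> norm (Q1 - Q2) * norm (g1 c) + norm (g1 c - g2 c)"
      using norm_mult_vec_le[of "transpose (Q1 - Q2)" "g1 c"] assms(1)
      by (intro norm_triangle_le add_mono) (simp_all add: norm_transpose norm_rotation_mult_vec rotation_matrix_transpose)
    then have "norm ((transpose (Q1 - Q2) *v g1 c + transpose Q2 *v (g1 c - g2 c)) \<times> b c)
        \<le> (norm (Q1 - Q2) * norm (g1 c) + norm (g1 c - g2 c)) * norm (b c)"
      by (intro order_trans[OF norm_cross_le] mult_right_mono) auto
    then show "norm (k c *\<^sub>R ((transpose (Q1 - Q2) *v g1 c + transpose Q2 *v (g1 c - g2 c)) \<times> b c))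
      \<le> k c * norm (b c) * (norm (Q1 - Q2) * norm (g1 c) + norm (g1 c - g2 c))"
      using k[OF c] by (simp add: mult_left_mono mult_ac)
  qed
  finally show ?thesis .
qed

definition attitude_potential :: "'c set \<Rightarrow> ('c \<Rightarrow> real) \<Rightarrow> ('c \<Rightarrow> real^3) \<Rightarrow> real^3^3 \<Rightarrow> real" where
  "attitude_potential C k b Q = - (\<Sum>c\<in>C. k c * (b c \<bullet> (Q *v b c)))"

text \<open>The torque is the gradient of the potential on the rotation group, up to sign.\<close>

lemma attitude_potential_derivative:
  assumes "(q has_vector_derivative - (q t ** hat v)) (at t within S)"
  shows "((\<lambda>s. attitude_potential C k b (q s)) has_real_derivative - (v \<bullet> torque C k b b (q t))) (at t within S)"
proof -
  have "((\<lambda>s. attitude_potential C k b (q s)) has_real_derivative - (\<Sum>c\<in>C. k c * (b c \<bullet> (- (q t ** hat v) *v b c)))) (at t within S)"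
    unfolding attitude_potential_def has_real_derivative_iff_has_vector_derivative
    by (intro has_vector_derivative_minus has_vector_derivative_sum has_vector_derivative_mult_right
        bounded_linear.has_vector_derivative[OF bounded_linear_inner_right]
        bounded_linear.has_vector_derivative[OF bounded_bilinear.bounded_linear_left[OF bounded_bilinear_mult_vec]] assms)
  also have "- (\<Sum>c\<in>C. k c * (b c \<bullet> (- (q t ** hat v) *v b c))) = - (v \<bullet> torque C k b b (q t))"
    unfolding torque_def inner_sum_right
  proof (intro arg_cong[of _ _ uminus] sum.cong refl)
    fix c
    have "b c \<bullet> (- (q t ** hat v) *v b c) = - ((transpose (q t) *v b c) \<bullet> (v \<times> b c))"
      by (simp add: bounded_bilinear.minus_left[OF bounded_bilinear_mult_vec] inner_mult_vec[symmetric]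
          matrix_vector_mul_assoc[symmetric] hat_mult)
    also have "\<dots> = v \<bullet> ((transpose (q t) *v b c) \<times> b c)"
      by (simp add: cross3_simps)
    finally show "k c * (b c \<bullet> (- (q t ** hat v) *v b c)) = v \<bullet> k c *\<^sub>R ((transpose (q t) *v b c) \<times> b c)" by simp
  qed
  finally show ?thesis .
qed

lemma torque_derivative:
  assumes "(q has_vector_derivative - (q t ** hat v)) (at t within S)" "rotation_matrix (q t)"
    and k: "\<And>c. c \<in> C \<Longrightarrow> k c > 0"
  obtains d where "((\<lambda>s. torque C k b b (q s)) has_vector_derivative d) (at t within S)"
    "norm d \<le> (\<Sum>c\<in>C. k c * norm (b c) * norm (b c)) * norm v"
proof
  let ?d = "\<Sum>c\<in>C. k c *\<^sub>R (((transpose (- (q t ** hat v))) *v b c) \<times> b c)"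
  show "((\<lambda>s. torque C k b b (q s)) has_vector_derivative ?d) (at t within S)"
    unfolding torque_def
    by (intro has_vector_derivative_sum bounded_linear.has_vector_derivative[OF bounded_linear_scaleR_right]
        bounded_linear.has_vector_derivative[OF bounded_bilinear.bounded_linear_left[OF bounded_bilinear_cross]]
        bounded_linear.has_vector_derivative[OF bounded_bilinear.bounded_linear_left[OF bounded_bilinear_mult_vec]]
        has_vector_derivative_transpose assms(1))
  show "norm ?d \<le> (\<Sum>c\<in>C. k c * norm (b c) * norm (b c)) * norm v"
    unfolding sum_distrib_right
  proof (rule sum_norm_le)
    fix c assume c: "c \<in> C"
    have "transpose (- (q t ** hat v)) *v b c = v \<times> (transpose (q t) *v b c)"
      by (simp add: bounded_linear.linear[OF bounded_linear_transpose, THEN linear_neg] matrix_transpose_mul transpose_hat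
          bounded_bilinear.minus_left[OF bounded_bilinear_matrix_mult] matrix_vector_mul_assoc[symmetric] hat_mult)
    then have "norm (transpose (- (q t ** hat v)) *v b c) \<le> norm v * norm (b c)"
      using norm_cross_le[of v "transpose (q t) *v b c"]
      by (simp add: norm_rotation_mult_vec rotation_matrix_transpose assms(2))
    then have "norm (((transpose (- (q t ** hat v))) *v b c) \<times> b c) \<le> (norm v * norm (b c)) * norm (b c)"
      by (intro order_trans[OF norm_cross_le] mult_right_mono) auto
    then show "norm (k c *\<^sub>R (((transpose (- (q t ** hat v))) *v b c) \<times> b c)) \<le> k c * norm (b c) * norm (b c) * norm v"
      using k[OF c] by (simp add: mult_left_mono mult_ac)
  qed
qed

context orientation_cascade
begin

lemma g_bound:
  assumes "c \<in> C i" "\<And>j. rotation_matrix (Q $ j)"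
  shows "norm (g i c Q) \<le> norm (b i c) + L * (4 * real CARD('f))"
proof -
  have "norm (g i c Q - b i c) \<le> L * (\<Sum>j\<in>{..<i}. norm (Q $ j - mat 1))"
    using g_lipschitz[OF assms(1), of Q "\<chi> j. mat 1"] assms rotation_matrix_id by (simp add: g_id[OF assms(1)])
  also have "\<dots> \<le> L * (\<Sum>j\<in>{..<i}. 4)"
  proof (intro mult_left_mono sum_mono L_nonneg)
    fix j show "norm (Q $ j - mat 1) \<le> 4"
      using norm_triangle_ineq4[of "Q $ j" "mat 1"] norm_rotation[OF assms(2)[of j]] norm_mat_1 by linarith
  qed
  also have "\<dots> \<le> L * (4 * real CARD('f))"
    using L_nonneg by (intro mult_left_mono) (auto intro!: card_mono)
  finally show ?thesis using norm_triangle_sub[of "g i c Q" "b i c"] by linarith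
qed

lemma drive_bound:
  obtains M where "M \<ge> 0" "\<And>Q. (\<And>j. rotation_matrix (Q $ j)) \<Longrightarrow> norm (drive i Q) \<le> M"
proof
  let ?M = "\<Sum>c\<in>C i. k i c * norm (b i c) * (norm (b i c) + L * (4 * real CARD('f)))"
  show "?M \<ge> 0" using k_pos L_nonneg by (intro sum_nonneg mult_nonneg_nonneg add_nonneg_nonneg) (auto simp: less_imp_le)
  fix Q :: "'f orientations" assume rot: "\<And>j. rotation_matrix (Q $ j)"
  have "norm (drive i Q) \<le> (\<Sum>c\<in>C i. k i c * norm (b i c) * norm (g i c Q))"
    by (rule torque_le[OF rot k_pos])
  also have "\<dots> \<le> ?M"
    using g_bound[OF _ rot] k_pos by (intro sum_mono mult_left_mono mult_nonneg_nonneg) (auto simp: less_imp_le)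
  finally show "norm (drive i Q) \<le> ?M" .
qed

lemma velocity_bounded:
  assumes sol: "solution Q u"
  obtains M where "M \<ge> 0" "\<And>t. t \<ge> 0 \<Longrightarrow> norm (u t $ i) \<le> M"
proof -
  obtain M where M: "M \<ge> 0" "\<And>Q. (\<And>j. rotation_matrix (Q $ j)) \<Longrightarrow> norm (drive i Q) \<le> M" by (rule drive_bound) blast
  define B where "B = (norm (u 0 $ i))\<^sup>2 + M\<^sup>2 / \<kappa>\<^sup>2"
  have "norm (u t $ i) \<le> sqrt B" if t: "t \<ge> 0" for t
  proof -
    have "(norm (u t $ i))\<^sup>2 \<le> exp (- \<kappa> * (t - 0)) * (norm (u 0 $ i))\<^sup>2 + M\<^sup>2 / \<kappa>\<^sup>2"
    proof (rule stable_forced_norm_bound[OF order_refl t \<kappa>_pos M(1)])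
      fix s :: real assume s: "0 \<le> s"
      let ?e = "om i s \<times> u s $ i - \<kappa> *\<^sub>R (u s $ i) + drive i (Q s)"
      have "u s $ i \<bullet> drive i (Q s) \<le> norm (u s $ i) * M"
        by (rule order_trans[OF norm_cauchy_schwarz mult_left_mono[OF M(2)]]) (use solutionD(1)[OF sol s] in auto)
      then have "u s $ i \<bullet> ?e \<le> - \<kappa> * (norm (u s $ i))\<^sup>2 + M * norm (u s $ i)"
        by (simp add: inner_add_right inner_diff_right dot_cross_self power2_norm_eq_inner mult.commute)
      then show "\<exists>e'. ((\<lambda>s. u s $ i) has_vector_derivative e') (at s within {0..}) \<and>
          u s $ i \<bullet> e' \<le> - \<kappa> * (norm (u s $ i))\<^sup>2 + M * norm (u s $ i)"
        using solutionD(3)[OF sol s, of i] by blast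
    qed
    also have "exp (- \<kappa> * (t - 0)) * (norm (u 0 $ i))\<^sup>2 \<le> 1 * (norm (u 0 $ i))\<^sup>2"
      using \<kappa>_pos t by (intro mult_right_mono) auto
    finally show ?thesis by (intro real_le_rsqrt) (simp add: B_def)
  qed
  moreover have "sqrt B \<ge> 0" by (simp add: B_def)
  ultimately show ?thesis using that by blast
qed

text \<open>The energy alone dissipates \<open>\<bar>u\<bar>\<^sup>2\<close>. Subtracting \<open>\<epsilon> u \<bullet> \<tau>\<close>, where \<open>\<tau>\<close> is the torque for exact directions,
  produces \<open>- \<epsilon> \<bar>\<tau>\<bar>\<^sup>2\<close> as well. The effect of the inexact directions decays exponentially and
  is compensated by an exponential term in the Lyapunov function. The dissipated quantity has
  bounded derivative, so Barbalat's argument applies.\<close>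

lemma agent_dissipation:
  assumes sol: "solution Q u" and T: "T \<ge> 0" "\<mu> > 0" "K \<ge> 0"
    and pre: "\<And>t j. t \<ge> T \<Longrightarrow> j < i \<Longrightarrow> norm (Q t $ j - mat 1) \<le> K * exp (- \<mu> * (t - T))"
  shows "((\<lambda>t. (norm (u t $ i))\<^sup>2 + (norm (torque (C i) (k i) (b i) (b i) (Q t $ i)))\<^sup>2) \<longlongrightarrow> 0) at_top"
proof -
  let ?\<tau> = "\<lambda>t. torque (C i) (k i) (b i) (b i) (Q t $ i)"
  let ?v = "\<lambda>t. u t $ i"
  obtain w where w: "w \<ge> 0" "\<And>t. t \<ge> 0 \<Longrightarrow> norm (om i t) \<le> w" by (rule om_bound) blast
  obtain M where M: "M \<ge> 0" "\<And>t. t \<ge> 0 \<Longrightarrow> norm (?v t) \<le> M" by (rule velocity_bounded[OF sol]) blast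
  obtain Md where Md: "Md \<ge> 0" "\<And>Q. (\<And>j. rotation_matrix (Q $ j)) \<Longrightarrow> norm (drive i Q) \<le> Md" by (rule drive_bound) blast
  define K1 where "K1 = (\<Sum>c\<in>C i. k i c * norm (b i c))"
  define K3 where "K3 = (\<Sum>c\<in>C i. k i c * norm (b i c) * norm (b i c))"
  have K: "K1 \<ge> 0" "K3 \<ge> 0" using k_pos[of _ i] by (auto simp: K1_def K3_def less_imp_le intro!: sum_nonneg mult_nonneg_nonneg)
  have rot: "rotation_matrix (Q t $ j)" if "t \<ge> 0" for t j using solutionD(1)[OF sol that] .
  have \<tau>K: "norm (?\<tau> t) \<le> K3" if "t \<ge> 0" for t
    unfolding K3_def by (rule torque_le[OF rot[OF that] k_pos])
  define R where "R = K1 * (L * (real CARD('f) * K))"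
  have r: "norm (drive i (Q t) - ?\<tau> t) \<le> R * exp (- \<mu> * (t - T))" if t: "t \<ge> T" for t
  proof -
    have t0: "t \<ge> 0" using t T by simp
    have "norm (drive i (Q t) - ?\<tau> t) \<le> (\<Sum>c\<in>C i. k i c * norm (b i c) * (norm (Q t $ i - Q t $ i) * norm (g i c (Q t)) + norm (g i c (Q t) - b i c)))"
      by (rule torque_lipschitz[OF rot[OF t0] k_pos])
    also have "\<dots> \<le> (\<Sum>c\<in>C i. k i c * norm (b i c) * (L * (real CARD('f) * K) * exp (- \<mu> * (t - T))))"
    proof (intro sum_mono mult_left_mono)
      fix c assume c: "c \<in> C i"
      have "norm (g i c (Q t) - b i c) \<le> L * (\<Sum>j\<in>{..<i}. norm (Q t $ j - mat 1))"
        using g_lipschitz[OF c, of "Q t" "\<chi> j. mat 1"] rot[OF t0] rotation_matrix_id by (simp add: g_id[OF c])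
      also have "\<dots> \<le> L * (\<Sum>j\<in>{..<i}. K * exp (- \<mu> * (t - T)))"
        using pre[OF t] L_nonneg by (intro mult_left_mono sum_mono) auto
      also have "\<dots> \<le> L * (real CARD('f) * (K * exp (- \<mu> * (t - T))))"
        using L_nonneg T(3) unfolding sum_constant by (intro mult_left_mono mult_right_mono) (auto intro!: card_mono)
      finally show "norm (Q t $ i - Q t $ i) * norm (g i c (Q t)) + norm (g i c (Q t) - b i c) \<le> L * (real CARD('f) * K) * exp (- \<mu> * (t - T))"
        by (simp add: mult.assoc)
    qed (use k_pos in \<open>auto intro!: mult_nonneg_nonneg simp: less_imp_le\<close>)
    also have "\<dots> = R * exp (- \<mu> * (t - T))" by (simp add: R_def K1_def sum_distrib_right mult.assoc)
    finally show ?thesis .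
  qed
  have R0: "R \<ge> 0" using K L_nonneg T by (simp add: R_def)
  \<comment> \<open>Each bound costs at most a quarter of the damping.\<close>
  define \<epsilon> where "\<epsilon> = min (\<kappa> / (4 * (K3 + 1))) (\<kappa> / (2 * (w + \<kappa>)\<^sup>2))"
  have \<epsilon>: "\<epsilon> > 0" "\<epsilon> * K3 \<le> \<kappa> / 4" "\<epsilon> * (w + \<kappa>)\<^sup>2 / 2 \<le> \<kappa> / 4"
  proof -
    have p: "4 * (K3 + 1) > 0" "2 * (w + \<kappa>)\<^sup>2 > 0" using K \<kappa>_pos w by auto
    show e: "\<epsilon> > 0" using p \<kappa>_pos unfolding \<epsilon>_def by (simp only: min_less_iff_conj) simp
    have "\<epsilon> * (4 * (K3 + 1)) \<le> \<kappa>" "\<epsilon> * (2 * (w + \<kappa>)\<^sup>2) \<le> \<kappa>"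
      using p by (simp_all only: pos_le_divide_eq[symmetric]) (auto simp: \<epsilon>_def)
    then show "\<epsilon> * K3 \<le> \<kappa> / 4" "\<epsilon> * (w + \<kappa>)\<^sup>2 / 2 \<le> \<kappa> / 4" using e by (auto simp: algebra_simps)
  qed
  define R' where "R' = R * (M + \<epsilon> * K3)"
  have R': "R' \<ge> 0" using R0 M \<epsilon> K by (simp add: R'_def)
  define gg where "gg t = (norm (?v t))\<^sup>2 + (norm (?\<tau> t))\<^sup>2" for t
  define Y where "Y t = (norm (?v t))\<^sup>2 / 2 + attitude_potential (C i) (k i) (b i) (Q t $ i) - \<epsilon> * (?v t \<bullet> ?\<tau> t)
      + R' / \<mu> * exp (- \<mu> * (t - T))" for t
  define c where "c = min (\<kappa> / 2) (\<epsilon> / 2)"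
  have c: "c > 0" using \<kappa>_pos \<epsilon> by (simp add: c_def)
  define Lg where "Lg = 2 * (M * ((w + \<kappa>) * M + Md)) + 2 * (K3 * (K3 * M)) + 1"
  have Lg: "Lg > 0" unfolding Lg_def using M K w \<kappa>_pos Md
    by (intro add_nonneg_pos add_nonneg_nonneg mult_nonneg_nonneg) auto
  have deriv: "\<exists>d. (?\<tau> has_vector_derivative d) (at t within {0..}) \<and> norm d \<le> K3 * norm (?v t)" if t: "t \<ge> 0" for t
    by (rule torque_derivative[where C="C i" and k="k i" and b="b i", OF solutionD(2)[OF sol t, of i] rot[OF t] k_pos])
      (auto simp: K3_def)
  let ?v' = "\<lambda>t. om i t \<times> ?v t - \<kappa> *\<^sub>R (?v t) + drive i (Q t)"
  have vd: "(?v has_vector_derivative ?v' t) (at t within {0..})" if t: "t \<ge> 0" for t by (rule solutionD(3)[OF sol t])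
  have v'n: "norm (?v' t) \<le> (w + \<kappa>) * M + Md" if t: "t \<ge> 0" for t
  proof -
    have "norm (om i t \<times> ?v t) \<le> w * M"
      by (rule order_trans[OF norm_cross_le mult_mono]) (use w M t in auto)
    moreover have "norm (\<kappa> *\<^sub>R ?v t) \<le> \<kappa> * M" using M(2)[OF t] \<kappa>_pos by simp
    moreover have "norm (drive i (Q t)) \<le> Md" using Md(2) rot[OF t] by blast
    ultimately show ?thesis
      using norm_triangle_ineq[of "om i t \<times> ?v t - \<kappa> *\<^sub>R (?v t)" "drive i (Q t)"]
        norm_triangle_ineq4[of "om i t \<times> ?v t" "\<kappa> *\<^sub>R (?v t)"] by (simp add: distrib_right)
  qed
  have "(gg \<longlongrightarrow> 0) at_top"
  proof (rule barbalat_dissipation[OF T(1) c Lg])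
    fix t assume "t \<ge> T" show "gg t \<ge> 0" by (simp add: gg_def)
  next
    fix s t assume st: "T \<le> s" "s \<le> t"
    have "- gg t - Lg * t \<le> - gg s - Lg * s"
    proof (rule nonincreasing_on[where f="\<lambda>r. - gg r - Lg * r"])
      fix x assume x: "s \<le> x" "x \<le> t"
      then have x0: "x \<ge> 0" using st T by simp
      obtain d where d: "(?\<tau> has_vector_derivative d) (at x within {0..})" "norm d \<le> K3 * norm (?v x)"
        using deriv[OF x0] by blast
      let ?D = "2 * (?v x \<bullet> ?v' x) + 2 * (?\<tau> x \<bullet> d)"
      have "(gg has_real_derivative ?D) (at x within {0..})"
        unfolding gg_def[abs_def]
        by (intro DERIV_add has_real_derivative_norm_power2 vd[OF x0] d(1))
      then have "((\<lambda>r. - gg r - Lg * r) has_real_derivative (- ?D - Lg)) (at x within {0..})"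
        by (auto intro!: derivative_eq_intros)
      moreover have "- (?v x \<bullet> ?v' x) \<le> M * ((w + \<kappa>) * M + Md)"
        using norm_cauchy_schwarz[of "- ?v x" "?v' x"] mult_mono[OF M(2)[OF x0] v'n[OF x0] M(1) norm_ge_zero]
        unfolding inner_minus_left norm_minus_cancel by linarith
      moreover have "- (?\<tau> x \<bullet> d) \<le> K3 * (K3 * M)"
      proof -
        have "norm d \<le> K3 * M" using d(2) mult_left_mono[OF M(2)[OF x0] K(2)] by linarith
        then show ?thesis
          using norm_cauchy_schwarz[of "- ?\<tau> x" d] mult_mono[OF \<tau>K[OF x0] _ K(2) norm_ge_zero, of d "K3 * M"]
          unfolding inner_minus_left norm_minus_cancel by linarith
      qed
      ultimately show "\<exists>D. ((\<lambda>r. - gg r - Lg * r) has_real_derivative D) (at x within {0..}) \<and> D \<le> 0"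
        by (intro exI[of _ "- ?D - Lg"] conjI) (assumption, unfold Lg_def, linarith)
    qed (use st T in auto)
    then show "gg s - Lg * (t - s) \<le> gg t" by (simp add: right_diff_distrib)
  next
    fix t assume t: "t \<ge> T"
    then have t0: "t \<ge> 0" using T by simp
    have "\<bar>b i c \<bullet> (Q t $ i *v b i c)\<bar> \<le> norm (b i c) * norm (b i c)" for c
      using Cauchy_Schwarz_ineq2[of "b i c" "Q t $ i *v b i c"] by (simp add: norm_rotation_mult_vec rot[OF t0])
    then have "(\<Sum>c\<in>C i. k i c * (b i c \<bullet> (Q t $ i *v b i c))) \<le> K3"
      unfolding K3_def mult.assoc by (intro sum_mono mult_left_mono) (use k_pos in \<open>auto simp: less_imp_le abs_le_iff\<close>)
    then have "attitude_potential (C i) (k i) (b i) (Q t $ i) \<ge> - K3" by (simp add: attitude_potential_def)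
    moreover have "?v t \<bullet> ?\<tau> t \<le> M * K3"
      using norm_cauchy_schwarz[of "?v t" "?\<tau> t"] mult_mono[OF M(2)[OF t0] \<tau>K[OF t0] M(1) norm_ge_zero] by linarith
    then have "\<epsilon> * (?v t \<bullet> ?\<tau> t) \<le> \<epsilon> * (M * K3)" using \<epsilon> by (intro mult_left_mono) auto
    moreover have "R' / \<mu> * exp (- \<mu> * (t - T)) \<ge> 0" using R' T by simp
    ultimately show "Y t \<ge> - K3 - \<epsilon> * (M * K3)" unfolding Y_def using zero_le_power2[of "norm (?v t)"] by linarith
    obtain d where d: "(?\<tau> has_vector_derivative d) (at t within {0..})" "norm d \<le> K3 * norm (?v t)"
      using deriv[OF t0] by blast
    let ?E = "exp (- \<mu> * (t - T))"
    let ?D = "?v t \<bullet> ?v' t - ?v t \<bullet> ?\<tau> t - \<epsilon> * (?v t \<bullet> d + ?v' t \<bullet> ?\<tau> t) - R' * ?E"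
    have "(Y has_real_derivative ?D) (at t within {0..})"
    proof -
      have 1: "((\<lambda>t. (norm (?v t))\<^sup>2 / 2) has_real_derivative ?v t \<bullet> ?v' t) (at t within {0..})"
        using DERIV_cdivide[OF has_real_derivative_norm_power2[OF vd[OF t0]], of 2] by simp
      have 2: "((\<lambda>t. attitude_potential (C i) (k i) (b i) (Q t $ i)) has_real_derivative - (?v t \<bullet> ?\<tau> t)) (at t within {0..})"
        by (rule attitude_potential_derivative[OF solutionD(2)[OF sol t0]])
      have 3: "((\<lambda>t. \<epsilon> * (?v t \<bullet> ?\<tau> t)) has_real_derivative \<epsilon> * (?v t \<bullet> d + ?v' t \<bullet> ?\<tau> t)) (at t within {0..})"
        using has_vector_derivative_inner[OF vd[OF t0] d(1)] by (intro DERIV_cmult) (simp add: has_real_derivative_iff_has_vector_derivative)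
      have 4: "((\<lambda>t. R' / \<mu> * exp (- \<mu> * (t - T))) has_real_derivative - R' * ?E) (at t within {0..})"
        using T by (auto intro!: derivative_eq_intros)
      show ?thesis unfolding Y_def[abs_def]
        using DERIV_add[OF DERIV_diff[OF DERIV_add[OF 1 2] 3] 4] by simp
    qed
    moreover have "?D \<le> - c * gg t"
    proof -
      define x y \<rho> where "x = norm (?v t)" and "y = norm (?\<tau> t)" and "\<rho> = R * ?E"
      define r where "r = drive i (Q t) - ?\<tau> t"
      have xy: "0 \<le> x" "0 \<le> y" "x \<le> M" "y \<le> K3" "0 \<le> \<rho>" using M(2)[OF t0] \<tau>K[OF t0] R0 by (auto simp: x_def y_def \<rho>_def)
      have rn: "norm r \<le> \<rho>" using assms r[OF t] by (simp add: r_def \<rho>_def)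
      have bnd: "- (a \<bullet> b) \<le> p * q" if "norm a \<le> p" "norm b \<le> q" for a b :: "real^3" and p q
        using norm_cauchy_schwarz[of "- a" b] mult_mono[OF that order_trans[OF norm_ge_zero that(1)] norm_ge_zero]
        unfolding inner_minus_left norm_minus_cancel by linarith
      have dr: "drive i (Q t) = r + ?\<tau> t" by (simp add: r_def)
      have e1: "?v t \<bullet> ?v' t - ?v t \<bullet> ?\<tau> t = - \<kappa> * x\<^sup>2 + ?v t \<bullet> r"
        unfolding dr x_def by (simp add: inner_add_right inner_diff_right dot_cross_self power2_norm_eq_inner)
      have e2: "?v' t \<bullet> ?\<tau> t = (om i t \<times> ?v t) \<bullet> ?\<tau> t - \<kappa> * (?v t \<bullet> ?\<tau> t) + r \<bullet> ?\<tau> t + y\<^sup>2"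
        unfolding dr y_def by (simp add: inner_add_left inner_diff_left power2_norm_eq_inner)
      have b1: "?v t \<bullet> r \<le> x * \<rho>" using bnd[of "- ?v t" x r \<rho>] rn by (simp add: x_def)
      have "norm (om i t \<times> ?v t) \<le> w * x"
        using norm_cross_le[of "om i t" "?v t"] mult_right_mono[OF w(2)[OF t0], of x] xy by (simp add: x_def)
      then have b2: "- ((om i t \<times> ?v t) \<bullet> ?\<tau> t) \<le> (w * x) * y" by (rule bnd) (simp add: y_def)
      have b3: "?v t \<bullet> ?\<tau> t \<le> x * y" using norm_cauchy_schwarz by (simp add: x_def y_def)
      have b4: "- (r \<bullet> ?\<tau> t) \<le> \<rho> * y" by (rule bnd[OF rn]) (simp add: y_def)
      have b5: "- (?v t \<bullet> d) \<le> x * (K3 * x)" by (rule bnd) (use d(2) in \<open>auto simp: x_def\<close>)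
      have b3': "\<kappa> * (?v t \<bullet> ?\<tau> t) \<le> \<kappa> * (x * y)" using b3 \<kappa>_pos by (intro mult_left_mono) auto
      have "- (?v t \<bullet> d + ?v' t \<bullet> ?\<tau> t) \<le> x * (K3 * x) + (w * x) * y + \<kappa> * (x * y) + \<rho> * y - y\<^sup>2"
        unfolding e2 using b2 b3' b4 b5 by linarith
      then have "\<epsilon> * - (?v t \<bullet> d + ?v' t \<bullet> ?\<tau> t) \<le> \<epsilon> * (x * (K3 * x) + (w * x) * y + \<kappa> * (x * y) + \<rho> * y - y\<^sup>2)"
        using \<epsilon> by (intro mult_left_mono) auto
      also have "\<dots> = \<epsilon> * K3 * x\<^sup>2 + \<epsilon> * ((w + \<kappa>) * x * y) + \<epsilon> * (\<rho> * y) - \<epsilon> * y\<^sup>2"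
        by (simp add: algebra_simps power2_eq_square)
      also have "(w + \<kappa>) * x * y \<le> (w + \<kappa>)\<^sup>2 / 2 * x\<^sup>2 + y\<^sup>2 / 2"
      proof -
        have "0 \<le> ((w + \<kappa>) * x - y)\<^sup>2" by simp
        then show ?thesis by (simp add: power2_diff power_mult_distrib)
      qed
      then have "\<epsilon> * ((w + \<kappa>) * x * y) \<le> \<epsilon> * ((w + \<kappa>)\<^sup>2 / 2 * x\<^sup>2 + y\<^sup>2 / 2)" using \<epsilon> by (intro mult_left_mono) auto
      then have "\<epsilon> * K3 * x\<^sup>2 + \<epsilon> * ((w + \<kappa>) * x * y) + \<epsilon> * (\<rho> * y) - \<epsilon> * y\<^sup>2
         \<le> \<epsilon> * K3 * x\<^sup>2 + (\<epsilon> * (w + \<kappa>)\<^sup>2 / 2) * x\<^sup>2 + \<epsilon> * (\<rho> * y) - (\<epsilon> / 2) * y\<^sup>2"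
        by (simp add: distrib_left)
      also have "\<dots> \<le> \<kappa> / 4 * x\<^sup>2 + \<kappa> / 4 * x\<^sup>2 + \<epsilon> * (\<rho> * y) - (\<epsilon> / 2) * y\<^sup>2"
        using mult_right_mono[OF \<epsilon>(2), of "x\<^sup>2"] mult_right_mono[OF \<epsilon>(3), of "x\<^sup>2"] by (intro diff_right_mono add_right_mono add_mono) auto
      finally have b6: "\<epsilon> * - (?v t \<bullet> d + ?v' t \<bullet> ?\<tau> t) \<le> \<kappa> / 2 * x\<^sup>2 + \<epsilon> * (\<rho> * y) - (\<epsilon> / 2) * y\<^sup>2" by simp
      have "x * \<rho> + \<epsilon> * (\<rho> * y) \<le> M * \<rho> + \<epsilon> * (\<rho> * K3)"
        using xy \<epsilon> by (intro add_mono mult_right_mono mult_left_mono) auto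
      also have "\<dots> = R' * ?E" by (simp add: R'_def \<rho>_def algebra_simps)
      finally have b7: "x * \<rho> + \<epsilon> * (\<rho> * y) \<le> R' * ?E" .
      have "?D \<le> - \<kappa> * x\<^sup>2 + \<kappa> / 2 * x\<^sup>2 - (\<epsilon> / 2) * y\<^sup>2"
        using e1 b1 b6 b7 by (simp only: mult_minus_right)
      also have "\<dots> = - (\<kappa> / 2 * x\<^sup>2) - (\<epsilon> / 2) * y\<^sup>2" by simp
      also have "\<dots> \<le> - (c * x\<^sup>2) - c * y\<^sup>2"
      proof -
        have cc: "c \<le> \<kappa> / 2" "c \<le> \<epsilon> / 2" by (simp_all add: c_def)
        have "c * x\<^sup>2 \<le> \<kappa> / 2 * x\<^sup>2" "c * y\<^sup>2 \<le> \<epsilon> / 2 * y\<^sup>2"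
          by (rule mult_right_mono[OF cc(1) zero_le_power2], rule mult_right_mono[OF cc(2) zero_le_power2])
        then show ?thesis by linarith
      qed
      finally show ?thesis by (simp add: gg_def x_def y_def algebra_simps)
    qed
    ultimately show "\<exists>D. (Y has_real_derivative D) (at t within {0..}) \<and> D \<le> - c * gg t" by blast
  qed
  then show ?thesis by (simp add: gg_def[abs_def])
qed

lemma agent_asymptotics:
  assumes sol: "solution Q u"
  shows "(\<And>j. j < i \<Longrightarrow> ((\<lambda>t. Q t $ j) \<longlongrightarrow> mat 1) at_top) \<Longrightarrow>
     ((\<lambda>t. u t $ i) \<longlongrightarrow> 0) at_top \<and> (\<exists>D\<in>crit i. ((\<lambda>t. Q t $ i) \<longlongrightarrow> D) at_top)"
proof (induction i rule: finite_linorder_induct)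
  case (less i)
  have pre: "((\<lambda>t. u t $ j) \<longlongrightarrow> 0) at_top" if "j < i" for j
    using less.IH[OF that] less.prems that by auto
  obtain K \<mu> T where E: "\<mu> > 0" "T \<ge> 0" "K \<ge> 0" "\<And>t j. t \<ge> T \<Longrightarrow> j \<in> {..<i} \<Longrightarrow> norm (Q t $ j - mat 1) \<le> K * exp (- \<mu> * (t - T))"
    by (rule exponential_convergence[OF sol, of "{..<i}"]) (use pre less.prems in auto)
  let ?\<tau> = "\<lambda>t. torque (C i) (k i) (b i) (b i) (Q t $ i)"
  have lim: "((\<lambda>t. (norm (u t $ i))\<^sup>2 + (norm (?\<tau> t))\<^sup>2) \<longlongrightarrow> 0) at_top"
    by (rule agent_dissipation[OF sol E(2,1,3)]) (use E(4) in auto)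
  from tendsto_real_sqrt[OF lim] have lim': "((\<lambda>t. sqrt ((norm (u t $ i))\<^sup>2 + (norm (?\<tau> t))\<^sup>2)) \<longlongrightarrow> 0) at_top" by simp
  have u0: "((\<lambda>t. u t $ i) \<longlongrightarrow> 0) at_top"
    by (rule Lim_null_comparison[OF _ lim']) (auto intro!: always_eventually real_le_rsqrt)
  have \<tau>0: "(?\<tau> \<longlongrightarrow> 0) at_top"
    by (rule Lim_null_comparison[OF _ lim']) (auto intro!: always_eventually real_le_rsqrt)
  have "continuous_on {0..} (\<lambda>t. Q t $ i)"
    unfolding continuous_on_eq_continuous_within
    by (intro ballI has_vector_derivative_continuous[OF solutionD(2)[OF sol]]) auto
  moreover have "continuous_on {R. rotation_matrix R} (torque (C i) (k i) (b i) (b i))"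
    unfolding torque_def
    by (intro continuous_intros bounded_linear.continuous_on[OF bounded_bilinear.bounded_linear_left[OF bounded_bilinear_cross]]
        bounded_linear.continuous_on[OF bounded_bilinear.bounded_linear_left[OF bounded_bilinear_mult_vec]]
        bounded_linear.continuous_on[OF bounded_linear_transpose])
  moreover have "finite {R \<in> {R. rotation_matrix R}. torque (C i) (k i) (b i) (b i) R = 0}"
    using crit_finite[of i] by (simp add: critical_def)
  ultimately obtain D where "rotation_matrix D" "torque (C i) (k i) (b i) (b i) D = 0" "((\<lambda>t. Q t $ i) \<longlongrightarrow> D) at_top"
    using tendsto_some_zero[OF compact_rotation_matrices _ _ _ _ \<tau>0] solutionD(1)[OF sol] by auto
  then show ?case using u0 by (auto simp: critical_def)
qed

end

section \<open>Initial states attracted by an undesired orientation\<close>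

lemma norm_vec_power2: "(norm (x :: 'a::real_normed_vector^'n))\<^sup>2 = (\<Sum>i\<in>UNIV. (norm (x $ i))\<^sup>2)"
  by (simp add: norm_vec_def L2_set_def sum_nonneg)

lemma norm_vec_le_sum: "norm (x :: 'a::real_normed_vector^'n) \<le> (\<Sum>i\<in>UNIV. norm (x $ i))"
  by (simp add: norm_vec_def L2_set_le_sum)

text \<open>The points depend Lipschitz continuously on their coordinates \<open>y\<close> in a hyperplane. Stating this with \<open>y\<close> as a function on
  \<open>S\<close> makes it independent of the regularity of \<open>S\<close>. The type argument
  fixes the space that contains the hyperplane.\<close>

definition lipschitz_hypersurface :: "'a::metric_space set \<Rightarrow> 'b::euclidean_space itself \<Rightarrow> bool" where
  "lipschitz_hypersurface S _ \<longleftrightarrow> (\<exists>(E::'b) y B. E \<noteq> 0 \<and> (\<forall>s\<in>S. y s \<bullet> E = 0) \<and>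
      (\<forall>s\<in>S. \<forall>s'\<in>S. dist s s' \<le> B * dist (y s) (y s')))"

definition perp_part :: "'a::real_inner \<Rightarrow> 'a \<Rightarrow> 'a" where
  "perp_part E z = z - (z \<bullet> E) *\<^sub>R E"

lemma perp_part_diff: "perp_part E (x - y) = perp_part E x - perp_part E y"
  by (simp add: perp_part_def inner_diff_left algebra_simps)

lemma perp_part_orthogonal: "norm E = 1 \<Longrightarrow> perp_part E z \<bullet> E = 0"
  by (simp add: perp_part_def inner_diff_left norm_eq_1)

lemma norm_perp_part: "norm E = 1 \<Longrightarrow> (norm (perp_part E z))\<^sup>2 = (norm z)\<^sup>2 - (z \<bullet> E)\<^sup>2"
  unfolding power2_norm_eq_inner perp_part_def
  by (simp add: inner_diff_left inner_diff_right norm_eq_1 inner_commute power2_eq_square)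

lemma norm_perp_part_le: "norm E = 1 \<Longrightarrow> norm (perp_part E z) \<le> norm z"
  by (rule power2_le_imp_le) (simp_all add: norm_perp_part)

text \<open>Split \<open>x\<close> along the unstable direction \<open>v\<close>: where the form is nonnegative, the component along \<open>v\<close> is bounded by the
  other components.\<close>

lemma energy_form_cone:
  assumes "linear H" and sym: "\<And>x y. y \<bullet> H x = x \<bullet> H y" and v: "norm v = 1" "H v = - m *\<^sub>R v" and m: "m > 0"
    and le: "\<And>x d. \<bar>energy_form \<epsilon> H x d\<bar> \<le> A * ((norm x)\<^sup>2 + (norm d)\<^sup>2)"
  shows "energy_form \<epsilon> H x d \<le> - (m / 4) * (x \<bullet> v)\<^sup>2 + (A + \<epsilon>\<^sup>2 * m) * ((norm x)\<^sup>2 - (x \<bullet> v)\<^sup>2 + (norm d)\<^sup>2)"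
proof -
  define s where "s = x \<bullet> v"
  define p where "p = perp_part v x"
  have x: "x = s *\<^sub>R v + p" by (simp add: p_def perp_part_def s_def)
  have pv: "p \<bullet> v = 0" "v \<bullet> p = 0" using v perp_part_orthogonal[of v x] by (simp_all add: p_def inner_commute)
  have vv: "v \<bullet> v = 1" using v by (simp add: norm_eq_1)
  have pn: "(norm p)\<^sup>2 = (norm x)\<^sup>2 - s\<^sup>2" by (simp add: p_def norm_perp_part v s_def)
  have vHp: "v \<bullet> H p = 0" using sym[of v p] by (simp add: v pv)
  have Hx: "H x = - (s * m) *\<^sub>R v + H p"
    by (subst x) (simp add: linear_add[OF assms(1)] linear_cmul[OF assms(1)] v)
  have xHx: "x \<bullet> H x = - m * s\<^sup>2 + p \<bullet> H p"
    unfolding Hx by (subst x) (simp add: inner_add_left inner_add_right inner_diff_right vv pv vHp power2_eq_square algebra_simps)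
  have dHx: "d \<bullet> H x = - (s * m) * (d \<bullet> v) + d \<bullet> H p" by (simp add: Hx inner_add_right inner_diff_right)
  have eq: "energy_form \<epsilon> H x d = energy_form \<epsilon> H p d - m * s\<^sup>2 / 2 - m * (\<epsilon> * s * (d \<bullet> v))"
    unfolding energy_form_def xHx dHx by (simp add: algebra_simps add_divide_distrib diff_divide_distrib)
  have "0 \<le> (s / 2 + \<epsilon> * (d \<bullet> v))\<^sup>2" by simp
  then have "- (\<epsilon> * s * (d \<bullet> v)) \<le> s\<^sup>2 / 4 + \<epsilon>\<^sup>2 * (d \<bullet> v)\<^sup>2"
    by (simp add: power2_sum power_divide power_mult_distrib mult_ac)
  also have "(d \<bullet> v)\<^sup>2 \<le> (norm d)\<^sup>2"
    using Cauchy_Schwarz_ineq2[of d v] v by (simp add: abs_le_square_iff[symmetric])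
  then have "s\<^sup>2 / 4 + \<epsilon>\<^sup>2 * (d \<bullet> v)\<^sup>2 \<le> s\<^sup>2 / 4 + \<epsilon>\<^sup>2 * (norm d)\<^sup>2" by (intro add_left_mono mult_left_mono) auto
  finally have "m * - (\<epsilon> * s * (d \<bullet> v)) \<le> m * (s\<^sup>2 / 4 + \<epsilon>\<^sup>2 * (norm d)\<^sup>2)" using m by (intro mult_left_mono) auto
  then have 1: "- (m * (\<epsilon> * s * (d \<bullet> v))) \<le> m * s\<^sup>2 / 4 + \<epsilon>\<^sup>2 * m * (norm d)\<^sup>2" by (simp add: algebra_simps)
  have 2: "energy_form \<epsilon> H p d \<le> A * ((norm p)\<^sup>2 + (norm d)\<^sup>2)" using le[of p d] by simp
  have 3: "0 \<le> \<epsilon>\<^sup>2 * m * (norm p)\<^sup>2" using m by simp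
  have "energy_form \<epsilon> H x d \<le> - (m * s\<^sup>2) / 4 + A * ((norm p)\<^sup>2 + (norm d)\<^sup>2) + \<epsilon>\<^sup>2 * m * (norm p)\<^sup>2 + \<epsilon>\<^sup>2 * m * (norm d)\<^sup>2"
    unfolding eq using 1 2 3 by linarith
  also have "\<dots> = - (m / 4) * s\<^sup>2 + (A + \<epsilon>\<^sup>2 * m) * ((norm p)\<^sup>2 + (norm d)\<^sup>2)" by (simp add: algebra_simps)
  finally show ?thesis by (simp add: pn s_def)
qed

context orientation_cascade
begin

text \<open>The form satisfies \<open>V' \<le> - \<mu> n\<close> and \<open>\<bar>V\<bar> \<le> A n\<close>, hence \<open>V' \<le> (\<mu> / A) V\<close>. A negative value would be
  amplified exponentially, whereas \<open>V\<close> is bounded as long as both solutions stay near their targets.\<close>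

lemma near_forever_nonneg:
  assumes ok: "\<And>j. j \<in> J \<Longrightarrow> dissipative_form j (D j) (\<epsilon> j (D j)) c \<eta> A" and A: "A > 0" and \<eta>: "\<eta> \<le> 1/8"
    and a: "\<And>j. 0 < a j \<and> a j \<le> (1::real)" and \<mu>: "\<mu> > 0"
    and decay: "\<And>t. t \<ge> T \<Longrightarrow> \<exists>P. ((\<lambda>t. cascade_form a \<epsilon> J D (Q t) (u t) (Q' t) (u' t)) has_real_derivative P) (at t within {0..}) \<and>
        P \<le> - \<mu> * (\<Sum>j\<in>J. gap (Q t) (u t) (Q' t) (u' t) j)"
    and rot: "\<And>t j. t \<ge> T \<Longrightarrow> rotation_matrix (Q t $ j)"
    and near: "\<And>t. t \<ge> T \<Longrightarrow> near \<eta> D J (Q t) (u t)" "\<And>t. t \<ge> T \<Longrightarrow> near \<eta> D J (Q' t) (u' t)" and T: "T \<ge> 0"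
  shows "0 \<le> cascade_form a \<epsilon> J D (Q T) (u T) (Q' T) (u' T)"
proof (rule ccontr)
  define V where "V t = cascade_form a \<epsilon> J D (Q t) (u t) (Q' t) (u' t)" for t
  define n where "n t = (\<Sum>j\<in>J. gap (Q t) (u t) (Q' t) (u' t) j)" for t
  assume "\<not> 0 \<le> cascade_form a \<epsilon> J D (Q T) (u T) (Q' T) (u' T)"
  then have VT: "V T < 0" by (simp add: V_def)
  have Vle: "\<bar>V t\<bar> \<le> A * n t" for t
    unfolding V_def n_def by (rule cascade_form_bound[where J=J and D=D and \<epsilon>=\<epsilon>, OF ok a A])
  define B where "B = A * (\<Sum>j\<in>J. 2)"
  have B: "B \<ge> 0" using A by (simp add: B_def)
  have VB: "- B \<le> V t" if t: "t \<ge> T" for t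
  proof -
    have "gap (Q t) (u t) (Q' t) (u' t) j \<le> 2" if j: "j \<in> J" for j
    proof -
      note nr = nearD[OF near(1)[OF t] j] nearD[OF near(2)[OF t] j]
      have "norm (vee (rel (Q t) (Q' t) j)) \<le> norm (Q t $ j - Q' t $ j)"
        using norm_vee[of "rel (Q t) (Q' t) j"] norm_rel[where Q="Q t" and i=j and Q'="Q' t", OF rot[OF t]] by simp
      also have "\<dots> \<le> 1" using norm_triangle_ineq4[of "Q t $ j - D j" "Q' t $ j - D j"] nr \<eta> by simp
      finally have 1: "(norm (vee (rel (Q t) (Q' t) j)))\<^sup>2 \<le> 1" by (simp add: power_le_one)
      have "norm (u t $ j - u' t $ j) \<le> 1" using norm_triangle_ineq4[of "u t $ j" "u' t $ j"] nr \<eta> by linarith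
      then have "(norm (u t $ j - u' t $ j))\<^sup>2 \<le> 1" by (simp add: power_le_one)
      with 1 show ?thesis by (simp add: gap_def)
    qed
    then have "A * n t \<le> B" unfolding n_def B_def using A by (intro mult_left_mono sum_mono) auto
    then show ?thesis using Vle[of t] by linarith
  qed
  \<comment> \<open>Chosen such that \<open>(1 + x) V T = V T - B\<close>, which is below the lower bound \<open>- B\<close>.\<close>
  define x where "x = B / (- V T)"
  have x: "x \<ge> 0" using B VT by (simp add: x_def divide_nonneg_neg)
  define t where "t = T + x * A / \<mu>"
  have t: "T \<le> t" using x A \<mu> by (simp add: t_def)
  have "V t \<le> exp (\<mu> / A * (t - T)) * V T"
  proof (rule exponential_comparison[OF T t])
    fix s assume s: "T \<le> s" "s \<le> t"
    obtain P where P: "(V has_real_derivative P) (at s within {0..})" "P \<le> - \<mu> * n s"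
      using decay[OF s(1)] unfolding V_def[abs_def] n_def by blast
    have "- V s / A \<le> n s"
      unfolding pos_divide_le_eq[OF A] using Vle[of s] mult.commute[of "n s" A] by linarith
    then have "\<mu> * (- V s / A) \<le> \<mu> * n s" using \<mu> by (intro mult_left_mono) auto
    moreover have "\<mu> * (- V s / A) = - (\<mu> / A * V s)" by simp
    ultimately have "P \<le> \<mu> / A * V s" using P(2) by linarith
    then show "\<exists>D. (V has_real_derivative D) (at s within {0..}) \<and> D \<le> \<mu> / A * V s"
      using P(1) by blast
  qed
  also have "\<mu> / A * (t - T) = x" using A \<mu> by (simp add: t_def)
  also have "exp x * V T \<le> (1 + x) * V T"
    using exp_ge_add_one_self[of x] VT by (simp only: mult_le_cancel_right_neg)
  also have "(1 + x) * V T = V T - B" using VT by (simp add: x_def distrib_right left_diff_distrib)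
  finally show False using VB[OF t] VT by linarith
qed

definition chart :: "'f orientations \<Rightarrow> 'f orientations \<Rightarrow> 'f velocities \<Rightarrow> 'f velocities \<times> 'f velocities" where
  "chart Qr Q u = ((\<chi> j. vee (transpose (Qr $ j) ** Q $ j)), u)"

definition target :: "'f \<Rightarrow> real^3^3 \<Rightarrow> 'f \<Rightarrow> real^3^3" where
  "target i D j = (if j = i then D else mat 1)"

text \<open>By the cone condition a nonnegative form bounds the state difference by its part orthogonal to
  the unstable direction. The directions are compared in the chart \<open>Q \<mapsto> vee (Qr\<^sup>T Q)\<close>
  around an arbitrary nearby rotation \<open>Qr\<close>, which distorts differences by a factor \<open>1 + O(\<eta>)\<close>. Agents after
  \<open>i\<close> need not be near anything: their coordinates belong to the orthogonal part.\<close>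

lemma unstable_separation:
  assumes D: "D \<in> crit i" "D \<noteq> mat 1"
  obtains \<eta> B and E :: "'f velocities \<times> 'f velocities" where "\<eta> > 0" "B \<ge> 0" "norm E = 1"
    "\<And>Q u Q' u' T Qr. solution Q u \<Longrightarrow> solution Q' u' \<Longrightarrow> T \<ge> 0 \<Longrightarrow>
       (\<And>t. t \<ge> T \<Longrightarrow> near \<eta> (target i D) {..i} (Q t) (u t)) \<Longrightarrow> (\<And>t. t \<ge> T \<Longrightarrow> near \<eta> (target i D) {..i} (Q' t) (u' t)) \<Longrightarrow>
       (\<And>j. rotation_matrix (Qr $ j)) \<Longrightarrow>
       (\<And>j. norm (Q T $ j - Qr $ j) \<le> \<eta>) \<Longrightarrow> (\<And>j. norm (Q' T $ j - Qr $ j) \<le> \<eta>) \<Longrightarrow>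
       norm ((Q T, u T) - (Q' T, u' T)) \<le> B * norm (perp_part E (chart Qr (Q T) (u T)) - perp_part E (chart Qr (Q' T) (u' T)))"
proof -
  interpret gain_eigenbasis "C i" "k i" "b i" "e i" "l i" by (rule eigenbasis)
  obtain v m where v: "norm v = 1" "m > 0" "hess i D v = - m *\<^sub>R v"
    by (rule hessian_bounds[OF D(1)]) (use D(2) in auto)
  note sym = hessian_symmetric[OF torque_critical[OF D(1)]]
  obtain \<epsilon> c \<eta>0 A where ok: "c > 0" "\<eta>0 > 0" "\<eta>0 \<le> 1/8" "A > 0"
    "\<And>i D. D \<in> crit i \<Longrightarrow> \<epsilon> i D > 0 \<and> dissipative_form i D (\<epsilon> i D) c \<eta>0 A" by (rule uniform_agent_ok) blast
  let ?J = "{..i}" and ?D = "target i D"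
  have okJ: "dissipative_form j (?D j) (\<epsilon> j (?D j)) c \<eta>0 A" for j
    using ok(5)[OF D(1)] ok(5)[OF id_critical[of j]] by (simp add: target_def)
  obtain a \<mu> where a: "\<And>j. 0 < a j \<and> a j \<le> (1::real)" and \<mu>: "\<mu> > 0" and decay:
    "\<And>Q u Q' u' t. solution Q u \<Longrightarrow> solution Q' u' \<Longrightarrow> t \<ge> 0 \<Longrightarrow> near \<eta>0 ?D ?J (Q t) (u t) \<Longrightarrow> near \<eta>0 ?D ?J (Q' t) (u' t) \<Longrightarrow>
      \<exists>P. ((\<lambda>t. cascade_form a \<epsilon> ?J ?D (Q t) (u t) (Q' t) (u' t)) has_real_derivative P) (at t within {0..}) \<and>
        P \<le> - \<mu> * (\<Sum>j\<in>?J. gap (Q t) (u t) (Q' t) (u' t) j)"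
    by (rule cascade_form_decay[where J="?J" and D="?D" and \<epsilon>=\<epsilon>, OF okJ ok(1,4)]) (auto simp: target_def)
  define C' where "C' = A + (\<epsilon> i D)\<^sup>2 * m"
  have C': "C' \<ge> A" "C' > 0" using v ok(4) by (auto simp: C'_def add_pos_nonneg)
  define L2 where "L2 = C' / (a i * (m / 4))"
  have L2: "L2 \<ge> 0" using C' a[of i] v by (simp add: L2_def)
  define Lc where "Lc = sqrt (1 + L2)"
  have Lc: "Lc \<ge> 1" using L2 by (simp add: Lc_def)
  \<comment> \<open>The chart error \<open>3 \<eta> \<bar>\<delta>\<bar>\<close>, amplified by \<open>Lc\<close>, is at most half of \<open>\<bar>\<delta>\<bar>\<close> and can be absorbed.\<close>
  define \<eta> where "\<eta> = min \<eta>0 (1 / (6 * Lc))"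
  have \<eta>: "\<eta> > 0" "\<eta> \<le> \<eta>0" "3 * \<eta> * Lc \<le> 1 / 2"
  proof -
    show "\<eta> > 0" "\<eta> \<le> \<eta>0" using ok Lc by (auto simp: \<eta>_def)
    have "\<eta> \<le> 1 / (6 * Lc)" by (simp add: \<eta>_def)
    moreover have "6 * Lc > 0" using Lc by simp
    ultimately have "\<eta> * (6 * Lc) \<le> 1" by (simp only: pos_le_divide_eq)
    then show "3 * \<eta> * Lc \<le> 1 / 2" by simp
  qed
  define E :: "'f velocities \<times> 'f velocities" where "E = (axis i v, 0)"
  have E: "norm E = 1"
    using v(1) by (simp add: E_def norm_eq_1 inner_axis_axis)
  show ?thesis
  proof (rule that[of \<eta> "6 * Lc" E])
    show "\<eta> > 0" "0 \<le> 6 * Lc" "norm E = 1" using \<eta> Lc E by auto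
    fix Q u Q' u' T Qr
    assume sol: "solution Q u" "solution Q' u'" and T: "T \<ge> (0::real)"
      and nr: "\<And>t. t \<ge> T \<Longrightarrow> near \<eta> ?D ?J (Q t) (u t)" "\<And>t. t \<ge> T \<Longrightarrow> near \<eta> ?D ?J (Q' t) (u' t)"
      and Qr: "\<And>j. rotation_matrix (Qr $ j)" "\<And>j. norm (Q T $ j - Qr $ j) \<le> \<eta>" "\<And>j. norm (Q' T $ j - Qr $ j) \<le> \<eta>"
    note nr0 = near_mono[OF nr(1) \<eta>(2)] near_mono[OF nr(2) \<eta>(2)]
    have rot: "rotation_matrix (Q t $ j)" "rotation_matrix (Q' t $ j)" if "t \<ge> 0" for t j
      using solutionD(1)[OF sol(1) that] solutionD(1)[OF sol(2) that] by auto
    let ?n = "gap (Q T) (u T) (Q' T) (u' T)"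
    let ?x = "\<lambda>j. vee (rel (Q T) (Q' T) j)" and ?d = "\<lambda>j. u T $ j - u' T $ j"
    let ?f = "\<lambda>j. agent_form (\<epsilon> j (?D j)) j (?D j) (Q T) (u T) (Q' T) (u' T)"
    have V0: "0 \<le> cascade_form a \<epsilon> ?J ?D (Q T) (u T) (Q' T) (u' T)"
    proof (rule near_forever_nonneg[where J="?J" and D="?D" and \<epsilon>=\<epsilon>, OF okJ ok(4,3) a \<mu>])
      fix t assume t: "T \<le> t"
      show "\<exists>P. ((\<lambda>t. cascade_form a \<epsilon> ?J ?D (Q t) (u t) (Q' t) (u' t)) has_real_derivative P) (at t within {0..}) \<and>
        P \<le> - \<mu> * (\<Sum>j\<in>?J. gap (Q t) (u t) (Q' t) (u' t) j)"
        using t T by (intro decay sol nr0) auto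
    qed (use T rot nr0 in auto)
    define s where "s = ?x i \<bullet> v"
    define q where "q = (a i * (m / 4)) * s\<^sup>2"
    define \<rho>2 where "\<rho>2 = (\<Sum>j\<in>UNIV. ?n j) - s\<^sup>2"
    have \<epsilon>i: "?D i = D" by (simp add: target_def)
    have "cascade_form a \<epsilon> ?J ?D (Q T) (u T) (Q' T) (u' T) = a i * ?f i + (\<Sum>j\<in>{..<i}. a j * ?f j)"
    proof -
      have "?J = insert i {..<i}" by auto
      then show ?thesis by (simp add: cascade_form_def)
    qed
    moreover have "?f i \<le> - (m / 4) * s\<^sup>2 + C' * (?n i - s\<^sup>2)"
    proof -
      have "\<bar>energy_form (\<epsilon> i D) (hess i D) x d\<bar> \<le> A * ((norm x)\<^sup>2 + (norm d)\<^sup>2)" for x d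
        using ok(5)[OF D(1)] by (simp add: dissipative_form_def)
      from energy_form_cone[OF linear_hessian sym v(1,3,2) this, of "?x i" "?d i"]
      show ?thesis unfolding \<epsilon>i agent_form_def gap_def s_def C'_def by (simp add: algebra_simps)
    qed
    then have "a i * ?f i \<le> a i * (- (m / 4) * s\<^sup>2 + C' * (?n i - s\<^sup>2))" using a[of i] by (intro mult_left_mono) auto
    moreover have "\<dots> = a i * (C' * (?n i - s\<^sup>2)) - q" by (simp add: q_def algebra_simps)
    moreover have si: "s\<^sup>2 \<le> ?n i"
    proof -
      have "\<bar>s\<bar> \<le> norm (?x i)" using Cauchy_Schwarz_ineq2[of "?x i" v] v by (simp add: s_def)
      then have "s\<^sup>2 \<le> (norm (?x i))\<^sup>2" by (simp add: abs_le_square_iff[symmetric])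
      then show ?thesis using zero_le_power2[of "norm (?d i)"] by (simp only: gap_def)
    qed
    have "a i * (C' * (?n i - s\<^sup>2)) \<le> C' * (?n i - s\<^sup>2)"
      using a[of i] C' si by (intro mult_left_le_one_le mult_nonneg_nonneg) auto
    moreover have "(\<Sum>j\<in>{..<i}. a j * ?f j) \<le> (\<Sum>j\<in>{..<i}. C' * ?n j)"
    proof (rule sum_mono)
      fix j
      have "\<bar>?f j\<bar> \<le> A * ?n j" by (rule dissipative_form_abs[OF okJ])
      moreover have "A * ?n j \<le> C' * ?n j" using C' by (intro mult_right_mono gap_nonneg) auto
      moreover have "a j * ?f j \<le> a j * \<bar>?f j\<bar>" by (rule mult_left_mono) (use a[of j] in auto)
      moreover have "a j * \<bar>?f j\<bar> \<le> 1 * \<bar>?f j\<bar>" by (rule mult_right_mono) (use a[of j] in auto)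
      ultimately show "a j * ?f j \<le> C' * ?n j" by linarith
    qed
    moreover have "C' * (?n i - s\<^sup>2) + (\<Sum>j\<in>{..<i}. C' * ?n j) \<le> C' * \<rho>2"
    proof -
      have "(\<Sum>j\<in>insert i {..<i}. ?n j) \<le> (\<Sum>j\<in>UNIV. ?n j)" by (intro sum_mono2 gap_nonneg) auto
      then have "(?n i - s\<^sup>2) + (\<Sum>j\<in>{..<i}. ?n j) \<le> \<rho>2" by (simp add: \<rho>2_def)
      then have "C' * ((?n i - s\<^sup>2) + (\<Sum>j\<in>{..<i}. ?n j)) \<le> C' * \<rho>2" using C' by (intro mult_left_mono) auto
      then show ?thesis by (simp add: distrib_left sum_distrib_left)
    qed
    ultimately have "q \<le> C' * \<rho>2" using V0 by linarith
    then have "s\<^sup>2 \<le> L2 * \<rho>2"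
      using a[of i] v by (simp add: L2_def q_def field_simps)
    then have tot: "(\<Sum>j\<in>UNIV. ?n j) \<le> (1 + L2) * \<rho>2" by (simp add: \<rho>2_def algebra_simps)
    define \<delta> :: "'f velocities \<times> 'f velocities" where "\<delta> = ((\<chi> j. ?x j), u' T - u T)"
    have \<delta>n: "(norm \<delta>)\<^sup>2 = (\<Sum>j\<in>UNIV. ?n j)"
      by (simp add: \<delta>_def norm_Pair norm_vec_power2 gap_def sum.distrib norm_minus_commute sum_nonneg)
    have "\<delta> \<bullet> E = s" by (simp add: \<delta>_def E_def s_def inner_axis)
    then have "\<rho>2 = (norm (perp_part E \<delta>))\<^sup>2" by (simp add: norm_perp_part[OF E] \<delta>n \<rho>2_def)
    then have "(norm \<delta>)\<^sup>2 \<le> (Lc * norm (perp_part E \<delta>))\<^sup>2"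
      using tot L2 by (simp add: \<delta>n Lc_def power_mult_distrib)
    then have \<delta>c: "norm \<delta> \<le> Lc * norm (perp_part E \<delta>)" by (rule power2_le_imp_le) (use Lc in auto)
    have rel_le: "norm (Q T $ j - Q' T $ j) \<le> 3 * norm (?x j)" for j
    proof (rule norm_rel_le[OF rot[OF T]])
      show "norm (Q T $ j - Q' T $ j) \<le> 1 / 2"
        using norm_triangle_ineq4[of "Q T $ j - Qr $ j" "Q' T $ j - Qr $ j"] Qr(2,3)[of j] \<eta>(2) ok(3) by simp
    qed
    let ?Y = "chart Qr (Q T) (u T)" and ?Y' = "chart Qr (Q' T) (u' T)"
    define r where "r = (?Y' - ?Y) - \<delta>"
    have r_comp: "r = ((\<chi> j. vee ((transpose (Qr $ j) ** Q T $ j - mat 1) ** rel (Q T) (Q' T) j)), 0)"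
    proof -
      have eqj: "transpose (Qr $ j) ** Q' T $ j - transpose (Qr $ j) ** Q T $ j - rel (Q T) (Q' T) j
        = (transpose (Qr $ j) ** Q T $ j - mat 1) ** rel (Q T) (Q' T) j" for j
      proof -
        have "transpose (Qr $ j) ** Q T $ j ** rel (Q T) (Q' T) j = transpose (Qr $ j) ** (Q T $ j ** transpose (Q T $ j)) ** Q' T $ j - transpose (Qr $ j) ** Q T $ j"
          unfolding rel_def matrix_diff_right by (simp add: matrix_mul_assoc)
        also have "\<dots> = transpose (Qr $ j) ** Q' T $ j - transpose (Qr $ j) ** Q T $ j"
          by (simp add: rotation_matrixD rot[OF T])
        finally show ?thesis by (simp add: matrix_diff_left)
      qed
      show ?thesis
        unfolding r_def \<delta>_def chart_def eqj[symmetric] by (simp add: vec_eq_iff vee_diff)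
    qed
    have "(norm r)\<^sup>2 \<le> (3 * \<eta> * norm \<delta>)\<^sup>2"
    proof -
      have "(norm r)\<^sup>2 = (\<Sum>j\<in>UNIV. (norm (vee ((transpose (Qr $ j) ** Q T $ j - mat 1) ** rel (Q T) (Q' T) j)))\<^sup>2)"
        by (simp add: r_comp norm_Pair norm_vec_power2 sum_nonneg)
      also have "\<dots> \<le> (\<Sum>j\<in>UNIV. (3 * \<eta>)\<^sup>2 * ?n j)"
      proof (rule sum_mono)
        fix j
        have "transpose (Qr $ j) ** Q T $ j - mat 1 = transpose (Qr $ j) ** (Q T $ j - Qr $ j)"
          by (simp add: matrix_diff_right rotation_matrixD Qr(1))
        then have "norm (transpose (Qr $ j) ** Q T $ j - mat 1) \<le> \<eta>"
          using Qr(2)[of j] by (simp add: norm_rotation_mult rotation_matrix_transpose Qr(1))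
        moreover have "norm (rel (Q T) (Q' T) j) \<le> 3 * norm (?x j)" using rel_le[of j] norm_rel[where Q="Q T" and i=j and Q'="Q' T", OF rot(1)[OF T]] by simp
        ultimately have "norm (transpose (Qr $ j) ** Q T $ j - mat 1) * norm (rel (Q T) (Q' T) j) \<le> \<eta> * (3 * norm (?x j))"
          using \<eta>(1) by (intro mult_mono) auto
        also have "\<dots> = 3 * \<eta> * norm (?x j)" by simp
        finally have "norm (vee ((transpose (Qr $ j) ** Q T $ j - mat 1) ** rel (Q T) (Q' T) j)) \<le> 3 * \<eta> * norm (?x j)"
          using norm_vee[of "(transpose (Qr $ j) ** Q T $ j - mat 1) ** rel (Q T) (Q' T) j"]
            norm_matrix_mult_le[of "transpose (Qr $ j) ** Q T $ j - mat 1" "rel (Q T) (Q' T) j"] by linarith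
        then have "(norm (vee ((transpose (Qr $ j) ** Q T $ j - mat 1) ** rel (Q T) (Q' T) j)))\<^sup>2 \<le> (3 * \<eta> * norm (?x j))\<^sup>2"
          by (rule power_mono) simp
        also have "\<dots> = (3 * \<eta>)\<^sup>2 * (norm (?x j))\<^sup>2" by (simp add: power_mult_distrib)
        also have "\<dots> \<le> (3 * \<eta>)\<^sup>2 * ?n j" by (intro mult_left_mono) (auto simp: gap_def)
        finally show "(norm (vee ((transpose (Qr $ j) ** Q T $ j - mat 1) ** rel (Q T) (Q' T) j)))\<^sup>2 \<le> (3 * \<eta>)\<^sup>2 * ?n j" .
      qed
      also have "\<dots> = (3 * \<eta>)\<^sup>2 * (\<Sum>j\<in>UNIV. ?n j)" by (rule sum_distrib_left[symmetric])
      finally show ?thesis unfolding power_mult_distrib[of _ "norm \<delta>"] \<delta>n .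
    qed
    then have rn: "norm r \<le> 3 * \<eta> * norm \<delta>" by (rule power2_le_imp_le) (use \<eta> in auto)
    have "perp_part E \<delta> = perp_part E (?Y' - ?Y) - perp_part E r" by (simp add: r_def flip: perp_part_diff)
    then have "norm (perp_part E \<delta>) \<le> norm (perp_part E (?Y' - ?Y)) + norm (perp_part E r)" by (simp only: norm_triangle_ineq4)
    also have "norm (perp_part E r) \<le> 3 * \<eta> * norm \<delta>" using norm_perp_part_le[OF E, of r] rn by linarith
    finally have "Lc * norm (perp_part E \<delta>) \<le> Lc * (norm (perp_part E (?Y' - ?Y)) + 3 * \<eta> * norm \<delta>)" using Lc by (intro mult_left_mono) auto
    also have "\<dots> = Lc * norm (perp_part E (?Y' - ?Y)) + (3 * \<eta> * Lc) * norm \<delta>" by (simp add: algebra_simps)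
    also have "\<dots> \<le> Lc * norm (perp_part E (?Y' - ?Y)) + (1 / 2) * norm \<delta>" using \<eta>(3) by (intro add_left_mono mult_right_mono) auto
    finally have \<delta>Y: "norm \<delta> \<le> 2 * Lc * norm (perp_part E (?Y' - ?Y))" using \<delta>c by linarith
    have "(norm ((Q T, u T) - (Q' T, u' T)))\<^sup>2 \<le> (3 * norm \<delta>)\<^sup>2"
    proof -
      have "(norm ((Q T, u T) - (Q' T, u' T)))\<^sup>2 = (\<Sum>j\<in>UNIV. (norm (Q T $ j - Q' T $ j))\<^sup>2 + (norm (?d j))\<^sup>2)"
        by (simp add: norm_Pair norm_vec_power2 sum.distrib sum_nonneg)
      also have "\<dots> \<le> (\<Sum>j\<in>UNIV. 9 * ?n j)"
      proof (rule sum_mono)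
        fix j
        have "(norm (Q T $ j - Q' T $ j))\<^sup>2 \<le> (3 * norm (?x j))\<^sup>2" by (rule power_mono[OF rel_le]) simp
        also have "\<dots> = 9 * (norm (?x j))\<^sup>2" by (simp add: power_mult_distrib)
        finally show "(norm (Q T $ j - Q' T $ j))\<^sup>2 + (norm (?d j))\<^sup>2 \<le> 9 * ?n j"
          using zero_le_power2[of "norm (?d j)"] unfolding gap_def distrib_left by linarith
      qed
      also have "\<dots> = (3 * norm \<delta>)\<^sup>2" by (simp add: power_mult_distrib \<delta>n sum_distrib_left)
      finally show ?thesis .
    qed
    then have "norm ((Q T, u T) - (Q' T, u' T)) \<le> 3 * norm \<delta>" by (rule power2_le_imp_le) simp
    also have "\<dots> \<le> 6 * Lc * norm (perp_part E (?Y' - ?Y))" using \<delta>Y by simp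
    also have "norm (perp_part E (?Y' - ?Y)) = norm (perp_part E ?Y - perp_part E ?Y')"
      by (simp only: perp_part_diff norm_minus_commute)
    finally show "norm ((Q T, u T) - (Q' T, u' T)) \<le> 6 * Lc * norm (perp_part E ?Y - perp_part E ?Y')" .
  qed
qed

end

lemma norm_vec_le_sum_bound:
  fixes x :: "'a::real_normed_vector^'n"
  assumes "\<And>i. norm (x $ i) \<le> B i"
  shows "norm x \<le> (\<Sum>i\<in>UNIV. B i)"
proof -
  have "(\<Sum>i\<in>UNIV. norm (x $ i)) \<le> (\<Sum>i\<in>UNIV. B i)" by (rule sum_mono) (rule assms)
  then show ?thesis using norm_vec_le_sum[of x] by linarith
qed

lemma finite_linorder_least:
  fixes P :: "'a::{finite,linorder} \<Rightarrow> bool"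
  assumes "\<not> P a"
  obtains x where "\<not> P x" "\<And>y. y < x \<Longrightarrow> P y"
  using finite_linorder_induct[of P a] assms by blast

context orientation_cascade
begin

text \<open>Gronwall's inequality in reversed time. The vector field is Lipschitz as long as the velocities are bounded by \<open>m\<close>.\<close>

lemma backward_lipschitz:
  assumes T: "T \<ge> 0" and m: "m \<ge> 0"
  obtains K where "K \<ge> 0"
    "\<And>Q u Q' u'. solution Q u \<Longrightarrow> solution Q' u' \<Longrightarrow> (\<And>t j. 0 \<le> t \<Longrightarrow> t \<le> T \<Longrightarrow> norm (u t $ j) \<le> m) \<Longrightarrow>
       norm ((Q 0, u 0) - (Q' 0, u' 0)) \<le> K * norm ((Q T, u T) - (Q' T, u' T))"
proof -
  obtain w where w: "w \<ge> 0" "\<And>i t. t \<ge> 0 \<Longrightarrow> norm (om i t) \<le> w" by (rule om_bound) blast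
  define N where "N = real CARD('f)"
  define Kd where "Kd i = (\<Sum>c\<in>C i. k i c * norm (b i c) * ((norm (b i c) + L * (4 * N)) + L * N))" for i
  define K1 where "K1 = (\<Sum>i\<in>(UNIV::'f set). 2 * m + 4) + (\<Sum>i\<in>UNIV. w + \<kappa> + Kd i)"
  show ?thesis
  proof (rule that[of "exp (K1 * T)"])
    fix Q u Q' u' assume sol: "solution Q u" "solution Q' u'" and um: "\<And>t j. 0 \<le> t \<Longrightarrow> t \<le> T \<Longrightarrow> norm (u t $ j) \<le> m"
    define E where "E t = (Q t, u t) - (Q' t, u' t)" for t
    have step: "\<exists>D. ((\<lambda>t. (norm (E t))\<^sup>2) has_real_derivative D) (at t within {0..}) \<and> - (2 * K1) * (norm (E t))\<^sup>2 \<le> D"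
      if t: "0 \<le> t" "t \<le> T" for t
    proof -
      have rot: "rotation_matrix (Q t $ j)" "rotation_matrix (Q' t $ j)" for j
        using solutionD(1)[OF sol(1) t(1)] solutionD(1)[OF sol(2) t(1)] by auto
      let ?n = "norm (E t)"
      have comp: "norm (Q t $ j - Q' t $ j) \<le> ?n" "norm (u t $ j - u' t $ j) \<le> ?n" for j
      proof -
        have "norm (Q t $ j - Q' t $ j) \<le> norm (Q t - Q' t)" "norm (u t $ j - u' t $ j) \<le> norm (u t - u' t)"
          using Finite_Cartesian_Product.norm_nth_le[of "Q t - Q' t" j] Finite_Cartesian_Product.norm_nth_le[of "u t - u' t" j] by simp_all
        moreover have "norm (Q t - Q' t) \<le> ?n" "norm (u t - u' t) \<le> ?n"
          by (simp_all add: E_def norm_Pair)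
        ultimately show "norm (Q t $ j - Q' t $ j) \<le> ?n" "norm (u t $ j - u' t $ j) \<le> ?n" by linarith+
      qed
      let ?f = "\<lambda>i. - (Q t $ i ** hat (u t $ i)) - (- (Q' t $ i ** hat (u' t $ i)))"
      let ?g = "\<lambda>i. (om i t \<times> u t $ i - \<kappa> *\<^sub>R (u t $ i) + drive i (Q t)) - (om i t \<times> u' t $ i - \<kappa> *\<^sub>R (u' t $ i) + drive i (Q' t))"
      have dQ: "((\<lambda>t. Q t - Q' t) has_vector_derivative (\<chi> i. ?f i)) (at t within {0..})"
        by (rule has_vector_derivative_vec_lambda)
           (simp only: vector_minus_component vec_lambda_beta, intro has_vector_derivative_diff solutionD(2) sol t(1))
      have du: "((\<lambda>t. u t - u' t) has_vector_derivative (\<chi> i. ?g i)) (at t within {0..})"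
        by (rule has_vector_derivative_vec_lambda)
           (simp only: vector_minus_component vec_lambda_beta, intro has_vector_derivative_diff solutionD(3) sol t(1))
      have dE: "(E has_vector_derivative ((\<chi> i. ?f i), (\<chi> i. ?g i))) (at t within {0..})"
        using has_vector_derivative_Pair[OF dQ du] by (simp add: E_def[abs_def])
      have fn: "norm (?f i) \<le> (2 * m + 4) * ?n" for i
      proof -
        have "?f i = - ((Q t $ i - Q' t $ i) ** hat (u t $ i) + Q' t $ i ** hat (u t $ i - u' t $ i))"
          by (simp add: matrix_diff_left matrix_diff_right hat_diff)
        then have "norm (?f i) \<le> norm ((Q t $ i - Q' t $ i) ** hat (u t $ i)) + norm (Q' t $ i ** hat (u t $ i - u' t $ i))"
          by (simp only: norm_minus_cancel norm_triangle_ineq)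
        also have "norm ((Q t $ i - Q' t $ i) ** hat (u t $ i)) \<le> ?n * (2 * m)"
          using norm_hat[of "u t $ i"] um[OF t, of i]
          by (intro order_trans[OF norm_matrix_mult_le] mult_mono comp) auto
        also have "norm (Q' t $ i ** hat (u t $ i - u' t $ i)) \<le> 2 * (2 * ?n)"
          using norm_hat[of "u t $ i - u' t $ i"] comp(2)[of i] norm_rotation[OF rot(2)[of i]]
          by (intro order_trans[OF norm_matrix_mult_le] mult_mono) auto
        finally show ?thesis by (simp add: algebra_simps)
      qed
      have gn: "norm (?g i) \<le> (w + \<kappa> + Kd i) * ?n" for i
      proof -
        have "?g i = om i t \<times> (u t $ i - u' t $ i) - \<kappa> *\<^sub>R (u t $ i - u' t $ i) + (drive i (Q t) - drive i (Q' t))"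
          by (simp add: Cross3.right_diff_distrib algebra_simps)
        then have "norm (?g i) \<le> norm (om i t \<times> (u t $ i - u' t $ i)) + norm (\<kappa> *\<^sub>R (u t $ i - u' t $ i)) + norm (drive i (Q t) - drive i (Q' t))"
          by (simp only: norm_triangle_le[OF add_mono[OF norm_triangle_ineq4 order_refl]])
        also have "norm (om i t \<times> (u t $ i - u' t $ i)) \<le> w * ?n"
          using w t by (intro order_trans[OF norm_cross_le] mult_mono comp) auto
        also have "norm (\<kappa> *\<^sub>R (u t $ i - u' t $ i)) \<le> \<kappa> * ?n" using comp(2)[of i] \<kappa>_pos by simp
        also have "norm (drive i (Q t) - drive i (Q' t)) \<le> (\<Sum>c\<in>C i. k i c * norm (b i c) * (norm (Q t $ i - Q' t $ i) * norm (g i c (Q t)) + norm (g i c (Q t) - g i c (Q' t))))"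
          by (rule torque_lipschitz[OF rot(2) k_pos])
        also have "\<dots> \<le> (\<Sum>c\<in>C i. k i c * norm (b i c) * (?n * (norm (b i c) + L * (4 * N)) + L * (N * ?n)))"
        proof (intro sum_mono mult_left_mono add_mono mult_mono comp)
          fix c assume c: "c \<in> C i"
          show "norm (g i c (Q t)) \<le> norm (b i c) + L * (4 * N)" unfolding N_def by (rule g_bound[OF c rot(1)])
          have "norm (g i c (Q t) - g i c (Q' t)) \<le> L * (\<Sum>j\<in>{..<i}. norm (Q t $ j - Q' t $ j))"
            by (rule g_lipschitz[OF c rot])
          also have "\<dots> \<le> L * (\<Sum>j\<in>{..<i}. ?n)" using L_nonneg by (intro mult_left_mono sum_mono comp) auto
          also have "\<dots> \<le> L * (N * ?n)"
            using L_nonneg unfolding sum_constant N_def by (intro mult_left_mono mult_right_mono) (auto intro!: card_mono)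
          finally show "norm (g i c (Q t) - g i c (Q' t)) \<le> L * (N * ?n)" .
        qed (use k_pos in \<open>auto intro!: mult_nonneg_nonneg simp: less_imp_le\<close>)
        also have "\<dots> = Kd i * ?n" unfolding Kd_def sum_distrib_right by (intro sum.cong refl) (simp add: algebra_simps)
        finally show ?thesis by (simp add: distrib_right)
      qed
      have "norm ((\<chi> i. ?f i), (\<chi> i. ?g i)) \<le> norm (\<chi> i. ?f i) + norm (\<chi> i. ?g i)" by (rule norm_Pair_le)
      also have "norm (\<chi> i. ?f i) \<le> (\<Sum>i\<in>(UNIV::'f set). (2 * m + 4) * ?n)"
        by (rule norm_vec_le_sum_bound) (simp only: vec_lambda_beta, rule fn)
      also have "norm (\<chi> i. ?g i) \<le> (\<Sum>i\<in>UNIV. (w + \<kappa> + Kd i) * ?n)"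
        by (rule norm_vec_le_sum_bound) (simp only: vec_lambda_beta, rule gn)
      finally have "norm ((\<chi> i. ?f i), (\<chi> i. ?g i)) \<le> K1 * ?n"
        by (simp only: K1_def sum_distrib_right[symmetric] distrib_right[symmetric])
      then have "?n * norm ((\<chi> i. ?f i), (\<chi> i. ?g i)) \<le> ?n * (K1 * ?n)" by (intro mult_left_mono) auto
      moreover have "\<bar>E t \<bullet> ((\<chi> i. ?f i), (\<chi> i. ?g i))\<bar> \<le> ?n * norm ((\<chi> i. ?f i), (\<chi> i. ?g i))" by (rule Cauchy_Schwarz_ineq2)
      moreover have "?n * (K1 * ?n) = K1 * ?n\<^sup>2" by (simp add: power2_eq_square)
      ultimately have "- (2 * (K1 * ?n\<^sup>2)) \<le> 2 * (E t \<bullet> ((\<chi> i. ?f i), (\<chi> i. ?g i)))" by linarith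
      then show ?thesis
        using has_real_derivative_norm_power2[OF dE] by (intro exI conjI) (assumption, simp)
    qed
    have "(norm (E 0))\<^sup>2 \<le> exp (2 * K1 * (T - 0)) * (norm (E T))\<^sup>2"
      by (rule backward_comparison[OF order_refl T step])
    also have "\<dots> = (exp (K1 * T) * norm (E T))\<^sup>2" by (simp add: power_mult_distrib mult_ac flip: exp_double)
    finally have "norm (E 0) \<le> exp (K1 * T) * norm (E T)" by (rule power2_le_imp_le) simp
    then show "norm ((Q 0, u 0) - (Q' 0, u' 0)) \<le> exp (K1 * T) * norm ((Q T, u T) - (Q' T, u' T))" by (simp add: E_def)
  qed simp
qed

text \<open>Initial states of solutions that are near the target of \<open>i\<close> and \<open>D\<close> from time \<open>T\<close> on. The rotations \<open>Qr\<close> locate the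
  attitudes at time \<open>T\<close> and \<open>m\<close> bounds the velocities before.\<close>

definition trapped_states :: "real \<Rightarrow> 'f \<Rightarrow> real^3^3 \<Rightarrow> 'f orientations \<Rightarrow> real \<Rightarrow> real \<Rightarrow> ('f orientations \<times> 'f velocities) set" where
  "trapped_states \<eta> i D Qr T m = {(Q 0, u 0) | Q u. solution Q u \<and>
     (\<forall>t\<ge>T. near \<eta> (target i D) {..i} (Q t) (u t)) \<and> (\<forall>j. norm (Q T $ j - Qr $ j) \<le> \<eta>) \<and>
     (\<forall>t j. 0 \<le> t \<and> t \<le> T \<longrightarrow> norm (u t $ j) \<le> m)}"

text \<open>Distinct trapped states are told apart by the reduced coordinates of their solutions at time
  \<open>T\<close>, and Lipschitz continuously so. Selecting one solution for each
  state makes these coordinates a function of the state.\<close>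

lemma trapped_states_hypersurface:
  assumes D: "D \<in> crit i" "D \<noteq> mat 1"
  obtains \<eta> where "\<eta> > 0" "\<And>Qr T m. (\<And>j. rotation_matrix (Qr $ j)) \<Longrightarrow> T \<ge> 0 \<Longrightarrow> m \<ge> 0 \<Longrightarrow>
     lipschitz_hypersurface (trapped_states \<eta> i D Qr T m) TYPE('f velocities \<times> 'f velocities)"
proof -
  obtain \<eta> B and E :: "'f velocities \<times> 'f velocities" where \<eta>: "\<eta> > 0" "B \<ge> 0" "norm E = 1" and sep:
    "\<And>Q u Q' u' T Qr. solution Q u \<Longrightarrow> solution Q' u' \<Longrightarrow> T \<ge> 0 \<Longrightarrow>
       (\<And>t. t \<ge> T \<Longrightarrow> near \<eta> (target i D) {..i} (Q t) (u t)) \<Longrightarrow> (\<And>t. t \<ge> T \<Longrightarrow> near \<eta> (target i D) {..i} (Q' t) (u' t)) \<Longrightarrow>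
       (\<And>j. rotation_matrix (Qr $ j)) \<Longrightarrow>
       (\<And>j. norm (Q T $ j - Qr $ j) \<le> \<eta>) \<Longrightarrow> (\<And>j. norm (Q' T $ j - Qr $ j) \<le> \<eta>) \<Longrightarrow>
       norm ((Q T, u T) - (Q' T, u' T)) \<le> B * norm (perp_part E (chart Qr (Q T) (u T)) - perp_part E (chart Qr (Q' T) (u' T)))"
    by (rule unstable_separation[OF D]) blast
  show ?thesis
  proof (rule that[OF \<eta>(1)])
    fix Qr :: "'f orientations" and T m :: real
    assume Qr: "\<And>j. rotation_matrix (Qr $ j)" and T: "T \<ge> 0" and m: "m \<ge> 0"
    obtain K where K: "K \<ge> 0" "\<And>Q u Q' u'. solution Q u \<Longrightarrow> solution Q' u' \<Longrightarrow> (\<And>t j. 0 \<le> t \<Longrightarrow> t \<le> T \<Longrightarrow> norm (u t $ j) \<le> m) \<Longrightarrow>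
       norm ((Q 0, u 0) - (Q' 0, u' 0)) \<le> K * norm ((Q T, u T) - (Q' T, u' T))"
      by (rule backward_lipschitz[OF T m]) blast
    define good where "good s X \<longleftrightarrow> s = (fst X 0, snd X 0) \<and> solution (fst X) (snd X) \<and>
       (\<forall>t\<ge>T. near \<eta> (target i D) {..i} (fst X t) (snd X t)) \<and> (\<forall>j. norm (fst X T $ j - Qr $ j) \<le> \<eta>) \<and>
       (\<forall>t j. 0 \<le> t \<and> t \<le> T \<longrightarrow> norm (snd X t $ j) \<le> m)" for s and X :: "(real \<Rightarrow> 'f orientations) \<times> (real \<Rightarrow> 'f velocities)"
    define X where "X s = (SOME X. good s X)" for s
    have X: "good s (X s)" if s: "s \<in> trapped_states \<eta> i D Qr T m" for s
    proof -
      obtain Q u where "good s (Q, u)" using s unfolding trapped_states_def good_def by auto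
      then show ?thesis unfolding X_def by (rule someI)
    qed
    define y where "y s = perp_part E (chart Qr (fst (X s) T) (snd (X s) T))" for s
    have "y s \<bullet> E = 0" for s unfolding y_def by (rule perp_part_orthogonal[OF \<eta>(3)])
    moreover have "dist s s' \<le> K * B * dist (y s) (y s')"
      if "s \<in> trapped_states \<eta> i D Qr T m" "s' \<in> trapped_states \<eta> i D Qr T m" for s s'
    proof -
      note g = X[OF that(1), unfolded good_def] X[OF that(2), unfolded good_def]
      have "dist s s' = norm ((fst (X s) 0, snd (X s) 0) - (fst (X s') 0, snd (X s') 0))"
        using conjunct1[OF g(1)] conjunct1[OF g(2)] unfolding dist_norm by presburger
      also have "\<dots> \<le> K * norm ((fst (X s) T, snd (X s) T) - (fst (X s') T, snd (X s') T))"
        by (rule K(2)) (use g in auto)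
      also have "\<dots> \<le> K * (B * norm (y s - y s'))"
        unfolding y_def by (intro mult_left_mono K(1) sep Qr T) (use g in auto)
      finally show ?thesis by (simp add: dist_norm mult.assoc)
    qed
    moreover have "E \<noteq> 0" using \<eta>(3) by auto
    ultimately show "lipschitz_hypersurface (trapped_states \<eta> i D Qr T m) TYPE('f velocities \<times> 'f velocities)"
      unfolding lipschitz_hypersurface_def by blast
  qed
qed

text \<open>Take the first agent \<open>i\<close> that does not converge to the identity. It converges to another critical orientation \<open>D\<close>,
  and its predecessors to the identity. The solution is thus eventually near the corresponding target, from some
  natural number \<open>T\<close> on. With a bound \<open>m\<close> for the velocities and a member \<open>Qr\<close> of a countable dense set close to the
  attitudes at time \<open>T\<close>, its initial state is in one of countably many sets of trapped states.\<close>

theorem almost_global_convergence: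
  "\<exists>F. countable F \<and> (\<forall>S\<in>F. lipschitz_hypersurface S TYPE('f velocities \<times> 'f velocities)) \<and>
     (\<forall>Q u. solution Q u \<longrightarrow> (Q 0, u 0) \<notin> \<Union>F \<longrightarrow> (\<forall>i. ((\<lambda>t. Q t $ i) \<longlongrightarrow> mat 1) at_top))"
proof -
  define I where "I = Sigma UNIV (\<lambda>i. crit i - {mat 1})"
  have "finite I" unfolding I_def by (intro finite_SigmaI finite_Diff crit_finite) auto
  have "\<forall>p\<in>I. \<exists>\<eta>>0. \<forall>Qr T m. (\<forall>j. rotation_matrix (Qr $ j)) \<longrightarrow> T \<ge> 0 \<longrightarrow> m \<ge> 0 \<longrightarrow>
     lipschitz_hypersurface (trapped_states \<eta> (fst p) (snd p) Qr T m) TYPE('f velocities \<times> 'f velocities)"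
  proof
    fix p assume "p \<in> I"
    then have "snd p \<in> crit (fst p)" "snd p \<noteq> mat 1" by (auto simp: I_def)
    then show "\<exists>\<eta>>0. \<forall>Qr T m. (\<forall>j. rotation_matrix (Qr $ j)) \<longrightarrow> T \<ge> 0 \<longrightarrow> m \<ge> 0 \<longrightarrow>
     lipschitz_hypersurface (trapped_states \<eta> (fst p) (snd p) Qr T m) TYPE('f velocities \<times> 'f velocities)"
      by (rule trapped_states_hypersurface) blast
  qed
  from bchoice[OF this] obtain \<eta> where \<eta>: "\<forall>p\<in>I. \<eta> p > 0 \<and> (\<forall>Qr T m. (\<forall>j. rotation_matrix (Qr $ j)) \<longrightarrow> T \<ge> 0 \<longrightarrow> m \<ge> 0 \<longrightarrow>
     lipschitz_hypersurface (trapped_states (\<eta> p) (fst p) (snd p) Qr T m) TYPE('f velocities \<times> 'f velocities))"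
    by (elim exE) (rule that)
  define Rots where "Rots = {Q :: 'f orientations. \<forall>j. rotation_matrix (Q $ j)}"
  obtain \<Theta> where \<Theta>: "countable \<Theta>" "\<Theta> \<subseteq> Rots" "Rots \<subseteq> closure \<Theta>" using separable[of Rots] by blast
  define F where "F = (\<lambda>(p, Qr, T, m). trapped_states (\<eta> p) (fst p) (snd p) Qr (real T) (real m)) ` Sigma I (\<lambda>_. Sigma \<Theta> (\<lambda>_. UNIV))"
  have c1: "countable F" unfolding F_def
    by (intro countable_image countable_SIGMA countable_finite[OF \<open>finite I\<close>] \<Theta>(1)) auto
  have c2: "\<forall>S\<in>F. lipschitz_hypersurface S TYPE('f velocities \<times> 'f velocities)"
    using \<eta> \<Theta>(2) unfolding F_def Rots_def by fastforce
  have c3: "((\<lambda>t. Q t $ i) \<longlongrightarrow> mat 1) at_top" if sol: "solution Q u" and out: "(Q 0, u 0) \<notin> \<Union>F" for Q u i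
  proof (rule ccontr)
    assume "\<not> ((\<lambda>t. Q t $ i) \<longlongrightarrow> mat 1) at_top"
    then obtain i where i: "\<not> ((\<lambda>t. Q t $ i) \<longlongrightarrow> mat 1) at_top" "\<And>j. j < i \<Longrightarrow> ((\<lambda>t. Q t $ j) \<longlongrightarrow> mat 1) at_top"
      by (rule finite_linorder_least[where P="\<lambda>i. ((\<lambda>t. Q t $ i) \<longlongrightarrow> mat 1) at_top"]) blast
    obtain D where D: "D \<in> crit i" "((\<lambda>t. Q t $ i) \<longlongrightarrow> D) at_top" using agent_asymptotics[OF sol i(2)] by blast
    have "D \<noteq> mat 1" using i(1) D(2) by auto
    then have p: "(i, D) \<in> I" using D(1) by (auto simp: I_def)
    have \<eta>p: "\<eta> (i, D) > 0" using \<eta> p by blast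
    have "eventually (\<lambda>t. near (\<eta> (i, D)) (target i D) {..i} (Q t) (u t)) at_top"
    proof (rule tendsto_near[OF _ _ \<eta>p])
      fix j assume j: "j \<in> {..i}"
      show "((\<lambda>t. Q t $ j) \<longlongrightarrow> target i D j) at_top"
        using j i(2)[of j] D(2) by (cases "j = i") (auto simp: target_def)
      have "\<And>l. l < j \<Longrightarrow> ((\<lambda>t. Q t $ l) \<longlongrightarrow> mat 1) at_top" using j i(2) by auto
      then show "((\<lambda>t. u t $ j) \<longlongrightarrow> 0) at_top" using agent_asymptotics[OF sol, of j] by blast
    qed
    then obtain T0 where T0: "\<And>t. t \<ge> T0 \<Longrightarrow> near (\<eta> (i, D)) (target i D) {..i} (Q t) (u t)"
      unfolding eventually_at_top_linorder by blast
    define T where "T = nat \<lceil>T0\<rceil>"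
    have TT: "T0 \<le> real T" unfolding T_def by (rule real_nat_ceiling_ge)
    have "\<forall>j. \<exists>M\<ge>0. \<forall>t\<ge>0. norm (u t $ j) \<le> M" using velocity_bounded[OF sol] by metis
    then obtain Mj where Mj: "\<And>j. Mj j \<ge> 0" "\<And>j t. t \<ge> 0 \<Longrightarrow> norm (u t $ j) \<le> Mj j" by metis
    define m where "m = nat \<lceil>\<Sum>j\<in>UNIV. Mj j\<rceil>"
    have mj: "norm (u t $ j) \<le> real m" if "t \<ge> 0" for t j
    proof -
      have "Mj j \<le> (\<Sum>j\<in>UNIV. Mj j)" by (intro member_le_sum Mj) auto
      also have "\<dots> \<le> real m" unfolding m_def by (rule real_nat_ceiling_ge)
      finally show ?thesis using Mj(2)[OF that, of j] by linarith
    qed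
    have "Q (real T) \<in> closure \<Theta>" using \<Theta>(3) solutionD(1)[OF sol, of "real T"] by (auto simp: Rots_def)
    then obtain Qr where Qr: "Qr \<in> \<Theta>" "dist Qr (Q (real T)) < \<eta> (i, D)" using \<eta>p unfolding closure_approachable by blast
    have close: "norm (Q (real T) $ j - Qr $ j) \<le> \<eta> (i, D)" for j
    proof -
      have "norm (Q (real T) $ j - Qr $ j) \<le> norm (Q (real T) - Qr)"
        using Finite_Cartesian_Product.norm_nth_le[of "Q (real T) - Qr" j] by simp
      then show ?thesis using Qr(2) by (simp add: dist_norm norm_minus_commute)
    qed
    have nearT: "near (\<eta> (i, D)) (target i D) {..i} (Q t) (u t)" if "real T \<le> t" for t
      using T0 TT that by simp
    have "(Q 0, u 0) \<in> trapped_states (\<eta> (i, D)) i D Qr (real T) (real m)"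
      unfolding trapped_states_def
      by (intro CollectI exI[of _ Q] exI[of _ u] conjI allI impI refl sol nearT close mj) auto
    moreover have "trapped_states (\<eta> (i, D)) i D Qr (real T) (real m) \<in> F"
      unfolding F_def by (rule image_eqI[of _ _ "((i, D), Qr, T, m)"]) (use p Qr(1) in auto)
    ultimately show False using out by blast
  qed
  show ?thesis
    by (rule exI[of _ F], intro conjI c1 c2 allI impI, rule c3)
qed

end

section \<open>Null sets in charts\<close>

unbundle no cross3_syntax

lemma lipschitz_hypersurface_Times:
  assumes "lipschitz_hypersurface S TYPE('b::euclidean_space)"
  shows "lipschitz_hypersurface (S \<times> (UNIV :: 'c::euclidean_space set)) TYPE('b \<times> 'c)"
proof -
  obtain E :: 'b and y B where E: "E \<noteq> 0" "\<And>s. s \<in> S \<Longrightarrow> y s \<bullet> E = 0"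
    "\<And>s s'. s \<in> S \<Longrightarrow> s' \<in> S \<Longrightarrow> dist s s' \<le> B * dist (y s) (y s')"
    using assms unfolding lipschitz_hypersurface_def by blast
  show ?thesis
    unfolding lipschitz_hypersurface_def
  proof (intro exI conjI ballI)
    show "(E, 0::'c) \<noteq> 0" using E(1) by (simp add: zero_prod_def)
    fix s assume "s \<in> S \<times> (UNIV :: 'c set)"
    then show "(\<lambda>(s, x). (y s, x)) s \<bullet> (E, 0::'c) = 0" using E(2) by auto
    fix s' assume "s' \<in> S \<times> (UNIV :: 'c set)"
    with \<open>s \<in> S \<times> UNIV\<close> obtain a x a' x' where s: "s = (a, x)" "s' = (a', x')" "a \<in> S" "a' \<in> S" by auto
    let ?d = "dist (y a, x) (y a', x')"
    have "dist s s' \<le> dist a a' + dist x x'" by (simp add: s dist_Pair_Pair sqrt_sum_squares_le_sum)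
    also have "\<dots> \<le> B * dist (y a) (y a') + ?d" using E(3)[OF s(3,4)] by (intro add_mono) (auto simp: dist_Pair_Pair)
    also have "B * dist (y a) (y a') \<le> \<bar>B\<bar> * ?d" by (intro mult_mono) (auto simp: dist_Pair_Pair)
    finally show "dist s s' \<le> (\<bar>B\<bar> + 1) * dist ((\<lambda>(s, x). (y s, x)) s) ((\<lambda>(s, x). (y s, x)) s')" by (simp add: s distrib_right)
  qed
qed

text \<open>On bounded sets the parametrization is expansive, so points of the preimage depend Lipschitz continuously on their
  reduced coordinates, which lie in a hyperplane. Lipschitz images of null sets are null.\<close>

lemma negligible_preimage_hypersurface:
  fixes \<phi> :: "'v::euclidean_space \<Rightarrow> 'a::metric_space"
  assumes S: "lipschitz_hypersurface S TYPE('b::euclidean_space)" and dim: "DIM('b) \<le> DIM('v)"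
    and inv: "\<And>m::nat. \<exists>B\<ge>0. \<forall>x x'. norm x \<le> m \<longrightarrow> norm x' \<le> m \<longrightarrow> dist x x' \<le> B * dist (\<phi> x) (\<phi> x')"
  shows "negligible {x. \<phi> x \<in> S}"
proof -
  obtain E :: 'b and y B where E: "E \<noteq> 0" "\<And>s. s \<in> S \<Longrightarrow> y s \<bullet> E = 0"
    "\<And>s s'. s \<in> S \<Longrightarrow> s' \<in> S \<Longrightarrow> dist s s' \<le> B * dist (y s) (y s')"
    using S unfolding lipschitz_hypersurface_def by blast
  define X where "X m = {x. norm x \<le> real m \<and> \<phi> x \<in> S}" for m :: nat
  have "negligible (X m)" for m
  proof -
    obtain B' where B': "B' \<ge> 0" "\<And>x x'. norm x \<le> m \<Longrightarrow> norm x' \<le> m \<Longrightarrow> dist x x' \<le> B' * dist (\<phi> x) (\<phi> x')"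
      using inv[of m] by blast
    define h where "h x = y (\<phi> x)" for x
    have lip: "dist x x' \<le> B' * B * dist (h x) (h x')" if "x \<in> X m" "x' \<in> X m" for x x'
    proof -
      have "dist x x' \<le> B' * dist (\<phi> x) (\<phi> x')" using that by (intro B') (auto simp: X_def)
      also have "\<dots> \<le> B' * (B * dist (h x) (h x'))" unfolding h_def using that by (intro mult_left_mono E(3) B') (auto simp: X_def)
      finally show ?thesis by (simp add: mult.assoc)
    qed
    have inj: "inj_on h (X m)"
    proof (rule inj_onI)
      fix x x' assume "x \<in> X m" "x' \<in> X m" "h x = h x'"
      then show "x = x'" using lip[of x x'] by simp
    qed
    have neg: "negligible (h ` X m)"
    proof (rule negligible_subset[OF negligible_hyperplane[of E 0]])
      show "h ` X m \<subseteq> {x. E \<bullet> x = 0}" using E(2) by (auto simp: h_def X_def inner_commute)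
    qed (use E in auto)
    have "negligible (inv_into (X m) h ` (h ` X m))"
    proof (rule negligible_locally_Lipschitz_image[OF dim neg])
      fix z assume z: "z \<in> h ` X m"
      show "\<exists>T B. open T \<and> z \<in> T \<and> (\<forall>z'\<in>h ` X m \<inter> T. norm (inv_into (X m) h z' - inv_into (X m) h z) \<le> B * norm (z' - z))"
        using z lip inj by (intro exI[of _ UNIV] exI[of _ "B' * B"]) (auto simp: dist_norm)
    qed
    moreover have "inv_into (X m) h ` (h ` X m) = X m" by (simp add: inj inv_into_image_cancel)
    ultimately show ?thesis by simp
  qed
  then have "negligible (\<Union>m. X m)" by (intro negligible_countable_Union) auto
  moreover have "{x. \<phi> x \<in> S} \<subseteq> (\<Union>m. X m)" by (auto simp: X_def intro: real_arch_simple)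
  ultimately show ?thesis by (rule negligible_subset)
qed

unbundle cross3_syntax

text \<open>With \<open>A v = 1 - hat v\<close> one has \<open>A v (cayley v + 1) = 2\<close>, so differences of Cayley transforms
  are \<open>2 (A v)\<^sup>-\<^sup>1 hat (v - v') (A v')\<^sup>-\<^sup>1\<close>.\<close>

lemma cayley_expansive:
  assumes "norm v \<le> m" "norm v' \<le> m"
  shows "norm (v - v') \<le> (2 + 2 * m)\<^sup>2 * norm (cayley v - cayley v')"
proof -
  have m: "m \<ge> 0" using assms(1) norm_ge_zero[of v] by linarith
  define A where "A v = mat 1 - hat v" for v
  have inv: "invertible (A v)" for v
  proof -
    have "x = 0" if "A v *v x = 0" for x
    proof -
      have "x = v \<times> x" using that by (simp add: A_def mult_vec_diff_left hat_mult)
      then have "x \<bullet> x = (v \<times> x) \<bullet> x" by simp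
      then show ?thesis by (simp add: dot_cross_self)
    qed
    then show ?thesis unfolding invertible_left_inverse matrix_left_invertible_ker by blast
  qed
  have AC: "A v ** (cayley v + mat 1) = 2 *\<^sub>R mat 1" for v
  proof -
    have "A v ** matrix_inv (A v) = mat 1"
      unfolding matrix_inv_def using someI_ex[OF inv[of v, unfolded invertible_def]] by blast
    then have "A v ** cayley v = mat 1 + hat v"
      by (simp add: cayley_def A_def[symmetric] matrix_mul_assoc)
    then have "A v ** (cayley v + mat 1) = (mat 1 + hat v) + A v"
      by (simp add: bounded_bilinear.add_right[OF bounded_bilinear_matrix_mult])
    then show ?thesis by (simp add: A_def scaleR_2)
  qed
  have CA: "(cayley v + mat 1) ** A v = 2 *\<^sub>R mat 1" for v
  proof -
    have "A v ** ((1/2) *\<^sub>R (cayley v + mat 1)) = mat 1"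
      by (simp add: bounded_bilinear.scaleR_right[OF bounded_bilinear_matrix_mult] AC)
    then have "((1/2) *\<^sub>R (cayley v + mat 1)) ** A v = mat 1" by (simp add: matrix_left_right_inverse)
    then have "2 *\<^sub>R (((1/2) *\<^sub>R (cayley v + mat 1)) ** A v) = 2 *\<^sub>R mat 1" by simp
    then show ?thesis by (simp add: bounded_bilinear.scaleR_left[OF bounded_bilinear_matrix_mult])
  qed
  have "A v ** (cayley v - cayley v') ** A v' = (A v ** (cayley v + mat 1)) ** A v' - A v ** ((cayley v' + mat 1) ** A v')"
    by (simp only: matrix_mul_assoc matrix_diff_left[symmetric] matrix_diff_right[symmetric]) simp
  also have "\<dots> = 2 *\<^sub>R (A v' - A v)"
    unfolding AC CA by (simp add: bounded_bilinear.scaleR_left[OF bounded_bilinear_matrix_mult]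
        bounded_bilinear.scaleR_right[OF bounded_bilinear_matrix_mult] scaleR_right_diff_distrib)
  also have "A v' - A v = hat (v - v')" by (simp add: A_def hat_diff)
  finally have eq: "2 *\<^sub>R hat (v - v') = A v ** (cayley v - cayley v') ** A v'" by simp
  have A: "norm (A x) \<le> 2 + 2 * m" if "norm x \<le> m" for x
    using norm_triangle_ineq4[of "mat 1 :: real^3^3" "hat x"] norm_mat_1 norm_hat[of x] that by (simp add: A_def)
  have "norm (v - v') \<le> norm (hat (v - v'))" using norm_vee[of "hat (v - v')"] by (simp add: vee_hat)
  also have "\<dots> \<le> norm (2 *\<^sub>R hat (v - v'))" by simp
  also have "\<dots> \<le> norm (A v ** (cayley v - cayley v')) * norm (A v')" unfolding eq by (rule norm_matrix_mult_le)
  also have "\<dots> \<le> (norm (A v) * norm (cayley v - cayley v')) * norm (A v')" by (intro mult_right_mono norm_matrix_mult_le) auto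
  also have "\<dots> \<le> ((2 + 2 * m) * norm (cayley v - cayley v')) * (2 + 2 * m)"
    using A[OF assms(1)] A[OF assms(2)] m by (intro mult_mono mult_right_mono mult_nonneg_nonneg) auto
  finally show ?thesis by (simp add: power2_eq_square mult_ac)
qed

section \<open>From the estimators to the cascade\<close>

lemma mult_vec_outer: "outer b *v x = (b \<bullet> x) *\<^sub>R b"
  by (simp add: outer_def columnvector_def rowvector_def matrix_matrix_mult_def matrix_vector_mult_def
      vec_eq_iff inner_vec_def sum_distrib_left sum_distrib_right mult_ac)

lemma perp_proj_mult_vec: "perp_proj b *v x = perp_part b x"
  by (simp add: perp_proj_def mult_vec_diff_left mult_vec_outer perp_part_def inner_commute)

lemma linear_perp_part: "linear (perp_part b)"
  by (rule linearI) (simp_all add: perp_part_def inner_add_left algebra_simps)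

lemma perp_part_rotation:
  assumes "rotation_matrix (S :: real^3^3)"
  shows "S *v perp_part b (transpose S *v x) = perp_part (S *v b) x"
proof -
  have "(transpose S *v x) \<bullet> b = x \<bullet> (S *v b)"
    by (simp add: inner_mult_vec)
  then show ?thesis
    by (simp add: perp_part_def mult_vec_diff_right matrix_vector_mult_scaleR rotation_matrixD assms)
qed

lemma direction_sgn: "direction p i j = sgn (p j - p i)"
  by (simp add: direction_def sgn_div_norm)

lemma norm_direction_le: "norm (direction p i j) \<le> 1"
  by (simp add: direction_sgn norm_sgn)

text \<open>\<open>S S\<^sup>T\<close> is constant because \<open>hat \<psi>\<close> is skew, and the determinant cannot jump from \<open>1\<close> to \<open>-1\<close>.\<close>

lemma rotation_preserved:
  fixes S :: "real \<Rightarrow> real^3^3"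
  assumes d: "\<And>t. t \<ge> 0 \<Longrightarrow> (S has_vector_derivative S t ** hat (\<psi> t)) (at t within {0..})"
    and S0: "rotation_matrix (S 0)" and t: "t \<ge> 0"
  shows "rotation_matrix (S t)"
proof -
  have "((\<lambda>t. S t ** transpose (S t)) has_vector_derivative 0) (at t within {0..})" if "t \<ge> 0" for t
  proof -
    have "S t ** transpose (S t ** hat (\<psi> t)) + S t ** hat (\<psi> t) ** transpose (S t) = 0"
      by (simp add: matrix_transpose_mul transpose_hat matrix_mul_assoc bounded_bilinear.minus_left[OF bounded_bilinear_matrix_mult]
          bounded_bilinear.minus_right[OF bounded_bilinear_matrix_mult])
    then show ?thesis
      using has_vector_derivative_matrix_mult[OF d[OF that] has_vector_derivative_transpose[OF d[OF that]]] by simp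
  qed
  then have d0: "((\<lambda>t. S t ** transpose (S t)) has_vector_derivative 0) (at t within {0..})" if "t \<in> {0..}" for t
    using that by simp
  obtain c where c': "\<And>t. t \<in> {0..} \<Longrightarrow> S t ** transpose (S t) = c"
    by (rule has_vector_derivative_zero_constant[OF convex_real_interval(1) d0]) (assumption, rule that)
  have c: "S t ** transpose (S t) = c" if "t \<ge> 0" for t using c'[of t] that by simp
  have "S t ** transpose (S t) = mat 1" if "t \<ge> 0" for t
    using c[OF that] c[of 0] S0 by (simp add: rotation_matrixD)
  then have orth: "orthogonal_matrix (S t)" if "t \<ge> 0" for t
    using that by (simp add: orthogonal_matrix_def matrix_left_right_inverse)
  have "continuous_on {0..} S"
    unfolding continuous_on_eq_continuous_within by (intro ballI has_vector_derivative_continuous[OF d]) auto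
  then have "continuous_on {0..t} (\<lambda>t. det (S t))"
    unfolding det_3 by (intro continuous_intros) (auto intro: continuous_on_subset)
  have "det (S t) = 1"
  proof (rule ccontr)
    assume "det (S t) \<noteq> 1"
    then have "det (S t) = -1" using det_orthogonal_matrix[OF orth[OF t]] by auto
    moreover have "det (S 0) = 1" using S0 by (simp add: rotation_matrix_def)
    ultimately obtain s where s: "0 \<le> s" "s \<le> t" "det (S s) = 0"
      using IVT2'[of "\<lambda>t. det (S t)" t 0 0] t \<open>continuous_on {0..t} (\<lambda>t. det (S t))\<close> by auto
    then show False using det_orthogonal_matrix[OF orth[OF s(1)]] by auto
  qed
  then show ?thesis using orth[OF t] by (simp add: rotation_matrix_def)
qed

lemma norm_vec_scale_le:
  fixes x :: "'a::real_normed_vector^'n" and y :: "'b::real_normed_vector^'n"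
  assumes "\<And>i. norm (x $ i) \<le> c * norm (y $ i)" "c \<ge> 0"
  shows "norm x \<le> c * norm y"
proof -
  have "norm x \<le> L2_set (\<lambda>i. c * norm (y $ i)) UNIV"
    unfolding norm_vec_def by (rule L2_set_mono) (use assms(1) in auto)
  also have "\<dots> = c * norm y" using assms(2) by (simp add: norm_vec_def L2_set_right_distrib)
  finally show ?thesis .
qed

lemma negligible_Union_image:
  assumes "countable F" "\<And>S. S \<in> F \<Longrightarrow> negligible (f S)"
  shows "negligible (\<Union>S\<in>F. f S)"
proof (cases "F = {}")
  case False
  then have "(\<Union>S\<in>F. f S) = (\<Union>n::nat. f (from_nat_into F n))"
    using range_from_nat_into[OF False assms(1)] by (metis image_image)
  moreover have "negligible (\<Union>n::nat. f (from_nat_into F n))"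
    by (rule negligible_countable_Union) (use assms(2) from_nat_into[OF False] in auto)
  ultimately show ?thesis by simp
qed simp

lemma nbr_pair_in:
  assumes "card S = 2"
  shows "fst (nbr_pair S) \<in> S" "snd (nbr_pair S) \<in> S"
proof -
  obtain x y where "S = {x, y}" "x \<noteq> y" using assms by (auto simp: card_2_iff)
  then have "case (x, y) of (j, l) \<Rightarrow> j \<noteq> l \<and> S = {j, l}" by simp
  then have "case nbr_pair S of (j, l) \<Rightarrow> j \<noteq> l \<and> S = {j, l}" unfolding nbr_pair_def by (rule someI)
  then show "fst (nbr_pair S) \<in> S" "snd (nbr_pair S) \<in> S" by auto
qed

text \<open>Eigenvectors of a symmetric matrix for distinct eigenvalues are orthogonal, so three distinct
  eigenvalues provide an orthonormal basis. A zero eigenvalue would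
  confine all directions to the plane orthogonal to its eigenvector.\<close>

lemma gain_eigenbasis_exists:
  assumes fin: "finite C" and k: "\<And>c. c \<in> C \<Longrightarrow> k c > 0"
    and nc: "\<not> coplanar (insert 0 (b ` C))"
    and eig: "card {x::real. \<exists>v. v \<noteq> 0 \<and> (\<Sum>c\<in>C. k c *\<^sub>R outer (b c)) *v v = x *\<^sub>R v} = 3"
  shows "\<exists>e l. gain_eigenbasis C k b e l"
proof -
  define K where "K x = (\<Sum>c\<in>C. k c *\<^sub>R ((b c \<bullet> x) *\<^sub>R b c))" for x
  have K: "(\<Sum>c\<in>C. k c *\<^sub>R outer (b c)) *v x = K x" for x
    by (simp add: K_def bounded_bilinear.sum_left[OF bounded_bilinear_mult_vec] bounded_bilinear.scaleR_left[OF bounded_bilinear_mult_vec] mult_vec_outer)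
  let ?S = "{x::real. \<exists>v. v \<noteq> 0 \<and> K v = x *\<^sub>R v}"
  have S3: "card ?S = 3" using eig by (simp add: K)
  then have "finite ?S" by (intro card_ge_0_finite) simp
  then obtain l :: "3 \<Rightarrow> real" where l: "bij_betw l UNIV ?S"
    using finite_same_card_bij[of "UNIV :: 3 set" ?S] S3 by auto
  have "\<exists>v. v \<noteq> 0 \<and> K v = l i *\<^sub>R v" for i using bij_betwE[OF l] by auto
  then obtain v where v: "\<And>i. v i \<noteq> 0" "\<And>i. K (v i) = l i *\<^sub>R v i" by metis
  define e where "e i = v i /\<^sub>R norm (v i)" for i
  have Ksc: "K (a *\<^sub>R x) = a *\<^sub>R K x" for a x by (simp add: K_def scaleR_sum_right mult_ac)
  have Ke: "K (e i) = l i *\<^sub>R e i" for i by (simp add: e_def Ksc v mult.commute)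
  have en: "norm (e i) = 1" for i using v(1)[of i] by (simp add: e_def)
  have Ksym: "x \<bullet> K y = (\<Sum>c\<in>C. k c * ((b c \<bullet> x) * (b c \<bullet> y)))" for x y
    by (simp add: K_def inner_sum_right inner_commute mult_ac)
  have linj: "inj l" using l by (simp add: bij_betw_def)
  have orth: "e i \<bullet> e j = (if i = j then 1 else 0)" for i j
  proof (cases "i = j")
    case False
    have "e i \<bullet> K (e j) = e j \<bullet> K (e i)" unfolding Ksym by (simp add: mult_ac)
    then have "(l j - l i) * (e i \<bullet> e j) = 0" by (simp add: Ke inner_commute algebra_simps)
    moreover have "l j \<noteq> l i" using False linj by (auto dest: injD)
    ultimately show ?thesis using False by simp
  qed (simp add: en norm_eq_1[symmetric])
  have lpos: "l i > 0" for i
  proof -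
    have li: "l i = (\<Sum>c\<in>C. k c * (b c \<bullet> e i)\<^sup>2)"
    proof -
      have "l i = e i \<bullet> K (e i)" by (simp add: Ke orth)
      then show ?thesis by (simp add: Ksym power2_eq_square)
    qed
    have nn: "0 \<le> k c * (b c \<bullet> e i)\<^sup>2" if "c \<in> C" for c using k[OF that] by simp
    have "l i \<noteq> 0"
    proof
      assume "l i = 0"
      then have z: "b c \<bullet> e i = 0" if "c \<in> C" for c
      proof -
        have "(\<Sum>c\<in>C. k c * (b c \<bullet> e i)\<^sup>2) = 0" using li \<open>l i = 0\<close> by (simp only:)
        from sum_nonneg_0[OF fin nn this that] show ?thesis using k[OF that] by simp
      qed
      obtain j m :: 3 where jm: "UNIV = {i, j, m}" "j \<noteq> i" "m \<noteq> i" "j \<noteq> m"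
      proof -
        have "card (UNIV - {i}) = 2" by (subst card_Diff_singleton) simp_all
        then obtain j m where "UNIV - {i} = {j, m}" "j \<noteq> m" unfolding card_2_iff by blast
        moreover from this have "UNIV = {i, j, m}" "j \<noteq> i" "m \<noteq> i" by blast+
        ultimately show ?thesis using that by blast
      qed
      have "insert 0 (b ` C) \<subseteq> affine hull {0, e j, e m}"
      proof -
        have sp: "affine hull {0, e j, e m} = span {0, e j, e m}" by (intro affine_hull_span_0 hull_inc) simp
        have "b c \<in> span {0, e j, e m}" if "c \<in> C" for c
        proof -
          have "b c = (\<Sum>n\<in>{i, j, m}. (b c \<bullet> e n) *\<^sub>R e n)" using orthonormal_expansion[OF orth, of "b c"] jm(1) by simp
          also have "\<dots> = (b c \<bullet> e j) *\<^sub>R e j + (b c \<bullet> e m) *\<^sub>R e m" using jm(2-4) z[OF that] by simp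
          also have "\<dots> \<in> span {0, e j, e m}" by (intro span_add span_mul span_base) auto
          finally show ?thesis .
        qed
        then show ?thesis unfolding sp by (auto intro: span_zero)
      qed
      then show False using nc unfolding coplanar_def by blast
    qed
    moreover have "l i \<ge> 0" unfolding li by (rule sum_nonneg[OF nn])
    ultimately show ?thesis by simp
  qed
  have "gain_eigenbasis C k b e l"
    by unfold_locales (use orth Ke[unfolded K_def] lpos linj in auto)
  then show ?thesis by blast
qed

text \<open>The constant is the minimum of the quadratic form on the unit sphere.\<close>

lemma positive_definite_bound:
  fixes A :: "'a::euclidean_space \<Rightarrow> 'a"
  assumes A: "linear A" and pos: "\<And>x. x \<noteq> 0 \<Longrightarrow> 0 < x \<bullet> A x"
  obtains \<alpha> where "\<alpha> > 0" "\<And>x. \<alpha> * (norm x)\<^sup>2 \<le> x \<bullet> A x"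
proof -
  have bl: "bounded_linear A" using A by (simp add: linear_conv_bounded_linear)
  have "continuous_on (sphere 0 1) (\<lambda>x. x \<bullet> A x)"
    by (intro continuous_intros bounded_linear.continuous_on[OF bl])
  moreover have "sphere (0::'a) 1 \<noteq> {}" by simp
  ultimately obtain x0 where x0: "x0 \<in> sphere 0 1" "\<forall>x\<in>sphere 0 1. x0 \<bullet> A x0 \<le> x \<bullet> A x"
    using continuous_attains_inf[OF compact_sphere, of 0 1 "\<lambda>x. x \<bullet> A x"] by auto
  show ?thesis
  proof (rule that[of "x0 \<bullet> A x0"])
    show "x0 \<bullet> A x0 > 0" using x0(1) by (intro pos) auto
    fix x
    show "(x0 \<bullet> A x0) * (norm x)\<^sup>2 \<le> x \<bullet> A x"
    proof (cases "x = 0")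
      case False
      have "x0 \<bullet> A x0 \<le> (x /\<^sub>R norm x) \<bullet> A (x /\<^sub>R norm x)" using x0(2) False by (intro bspec[OF x0(2)]) simp
      also have "\<dots> = (x \<bullet> A x) / (norm x)\<^sup>2"
        using False by (simp add: linear_cmul[OF A] power2_eq_square field_simps)
      finally show ?thesis using False by (simp add: pos_le_divide_eq)
    qed (simp add: linear_0[OF A])
  qed
qed

locale leader_follower_network =
  fixes p :: "'l::finite + 'f::{finite,linorder} \<Rightarrow> real^3"
    and R :: "'l + 'f \<Rightarrow> real \<Rightarrow> real^3^3"
    and \<omega> :: "'l + 'f \<Rightarrow> real \<Rightarrow> real^3"
    and N :: "'f \<Rightarrow> ('l + 'f) set"
    and k :: "'f \<Rightarrow> ('l + 'f) option \<Rightarrow> real"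
    and k\<omega> :: real
    and kp :: "'f \<Rightarrow> 'l + 'f \<Rightarrow> real"
  assumes rotation: "\<And>a t. t \<ge> 0 \<Longrightarrow> rotation_matrix (R a t)"
    and kinematics: "\<And>a t. t \<ge> 0 \<Longrightarrow>
          (R a has_vector_derivative R a t ** hat (\<omega> a t)) (at t within {0..})"
    and velocity_bounded: "\<And>a. bounded (\<omega> a ` {0..})"
    and two_neighbors: "\<And>i. card (N i) \<ge> 2"
    and neighbors_precede: "\<And>i j. Inr j \<in> N i \<Longrightarrow> j < i"
    and not_collocated: "inj p"
    and not_collinear: "\<And>i. \<exists>j\<in>N i. \<exists>l\<in>N i. \<not> collinear {p (Inr i), p j, p l}"
    and gains_pos: "\<And>i c. c \<in> orient_index (N i) \<Longrightarrow> k i c > 0"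
    and k\<omega>_pos: "k\<omega> > 0"
    and not_coplanar: "\<And>i. \<not> coplanar (insert 0 (orient_dir p (N i) (Inr i) ` orient_index (N i)))"
    and distinct_eigenvalues: "\<And>i. card {c::real. \<exists>v. v \<noteq> 0 \<and>
          gain_matrix p (N i) (k i) (Inr i) *v v = c *\<^sub>R v} = 3"
    and position_gains_pos: "\<And>i j. j \<in> N i \<Longrightarrow> kp i j > 0"
begin

definition index where "index i = orient_index (N i)"
definition dirs where "dirs i c = orient_dir p (N i) (Inr i) c"

text \<open>Leaders know their orientation, so their error is the identity.\<close>

definition agent_error :: "'f orientations \<Rightarrow> 'l + 'f \<Rightarrow> real^3^3" where
  "agent_error Q = with_leaders (\<lambda>_. mat 1) Q"

definition dirs_est :: "'f \<Rightarrow> ('l + 'f) option \<Rightarrow> 'f orientations \<Rightarrow> real^3" where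
  "dirs_est i c Q = (case c of Some j \<Rightarrow> agent_error Q j *v direction p (Inr i) j
     | None \<Rightarrow> let (j, l) = nbr_pair (N i) in
        ((agent_error Q j *v direction p (Inr i) j) \<times> (agent_error Q l *v direction p (Inr i) l))
          /\<^sub>R norm (direction p (Inr i) j \<times> direction p (Inr i) l))"

definition inertial_velocity :: "'f \<Rightarrow> real \<Rightarrow> real^3" where
  "inertial_velocity i t = R (Inr i) t *v \<omega> (Inr i) t"

definition axes :: "'f \<Rightarrow> (3 \<Rightarrow> real^3) \<times> (3 \<Rightarrow> real)" where
  "axes i = (SOME q. gain_eigenbasis (index i) (k i) (dirs i) (fst q) (snd q))"

text \<open>A sum over all followers serves as an upper bound for the single constants. If the two directions are parallel, the
  quotient is zero by convention, as is the estimated direction.\<close>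

definition lipschitz_const :: real where
  "lipschitz_const = (\<Sum>i\<in>UNIV. 1 + 2 / norm (direction p (Inr i) (fst (nbr_pair (N i))) \<times> direction p (Inr i) (snd (nbr_pair (N i)))))"

lemma finite_N: "finite (N i)" using two_neighbors[of i] by (intro card_ge_0_finite) simp

lemma agent_error_id: "agent_error (\<chi> j. mat 1) a = mat 1"
  by (simp add: agent_error_def with_leaders_def split: sum.split)

lemma rotation_agent_error: "(\<And>j. rotation_matrix (Q $ j)) \<Longrightarrow> rotation_matrix (agent_error Q a)"
  by (simp add: agent_error_def with_leaders_def rotation_matrix_id split: sum.split)

lemma agent_error_diff:
  assumes "a \<in> N i"
  shows "norm (agent_error Q a - agent_error Q' a) \<le> (\<Sum>j\<in>{..<i}. norm (Q $ j - Q' $ j))"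
proof (cases a)
  case (Inl l)
  then show ?thesis by (simp add: agent_error_def with_leaders_def sum_nonneg)
next
  case (Inr j)
  then have "j \<in> {..<i}" using neighbors_precede assms by auto
  then have "norm (Q $ j - Q' $ j) \<le> (\<Sum>j\<in>{..<i}. norm (Q $ j - Q' $ j))" by (intro member_le_sum) auto
  then show ?thesis by (simp add: Inr agent_error_def with_leaders_def)
qed

lemma dirs_est_lipschitz:
  assumes c: "c \<in> index i" and rot: "\<And>j. rotation_matrix (Q $ j)" "\<And>j. rotation_matrix (Q' $ j)"
  shows "norm (dirs_est i c Q - dirs_est i c Q') \<le> lipschitz_const * (\<Sum>j\<in>{..<i}. norm (Q $ j - Q' $ j))"
proof -
  define S where "S = (\<Sum>j\<in>{..<i}. norm (Q $ j - Q' $ j))"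
  have S0: "S \<ge> 0" by (simp add: S_def sum_nonneg)
  define g where "g Q j = agent_error Q j *v direction p (Inr i) j" for Q j
  have gS: "norm (g Q j - g Q' j) \<le> S" if "j \<in> N i" for j
  proof -
    have "norm (g Q j - g Q' j) \<le> norm (agent_error Q j - agent_error Q' j) * norm (direction p (Inr i) j)"
      unfolding g_def mult_vec_diff_left[symmetric] by (rule norm_mult_vec_le)
    also have "\<dots> \<le> S * 1"
      using agent_error_diff[OF that] norm_direction_le S0 by (intro mult_mono) (auto simp: S_def)
    finally show ?thesis by simp
  qed
  have g1: "norm (g Q j) \<le> 1" "norm (g Q' j) \<le> 1" for j
    using norm_direction_le by (simp_all add: g_def norm_rotation_mult_vec rotation_agent_error rot)
  let ?c = "\<lambda>i. 1 + 2 / norm (direction p (Inr i) (fst (nbr_pair (N i))) \<times> direction p (Inr i) (snd (nbr_pair (N i))))"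
  have ci: "?c i \<le> lipschitz_const" unfolding lipschitz_const_def by (rule member_le_sum) auto
  have "norm (dirs_est i c Q - dirs_est i c Q') \<le> ?c i * S"
  proof (cases c)
    case (Some j)
    then have "j \<in> N i" using c by (auto simp: index_def orient_index_def split: if_splits)
    then have "norm (dirs_est i c Q - dirs_est i c Q') \<le> S" using gS by (simp add: dirs_est_def Some g_def)
    also have "1 * S \<le> ?c i * S" using S0 by (intro mult_right_mono) auto
    finally show ?thesis by simp
  next
    case None
    then have "card (N i) = 2" using c by (auto simp: index_def orient_index_def split: if_splits)
    note jl = nbr_pair_in[OF this]
    define j l where "j = fst (nbr_pair (N i))" and "l = snd (nbr_pair (N i))"
    define n where "n = norm (direction p (Inr i) j \<times> direction p (Inr i) l)"
    have eq: "dirs_est i c Q = (g Q j \<times> g Q l) /\<^sub>R n" for Q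
      by (simp add: dirs_est_def None g_def j_def l_def n_def Let_def case_prod_beta)
    have "g Q j \<times> g Q l - g Q' j \<times> g Q' l = (g Q j - g Q' j) \<times> g Q l + g Q' j \<times> (g Q l - g Q' l)"
      by (simp add: Cross3.left_diff_distrib Cross3.right_diff_distrib)
    then have "norm (g Q j \<times> g Q l - g Q' j \<times> g Q' l) \<le> norm ((g Q j - g Q' j) \<times> g Q l) + norm (g Q' j \<times> (g Q l - g Q' l))"
      by (simp only: norm_triangle_ineq)
    also have "norm ((g Q j - g Q' j) \<times> g Q l) \<le> S * 1"
      using jl by (intro order_trans[OF norm_cross_le] mult_mono gS g1 S0) (auto simp: j_def)
    also have "norm (g Q' j \<times> (g Q l - g Q' l)) \<le> 1 * S"
      using jl by (intro order_trans[OF norm_cross_le] mult_mono gS g1) (auto simp: l_def)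
    finally have "norm (g Q j \<times> g Q l - g Q' j \<times> g Q' l) \<le> 2 * S" by simp
    then have "inverse n * norm (g Q j \<times> g Q l - g Q' j \<times> g Q' l) \<le> inverse n * (2 * S)"
      by (intro mult_left_mono) (auto simp: n_def)
    then have "norm (dirs_est i c Q - dirs_est i c Q') \<le> inverse n * (2 * S)"
      unfolding eq scaleR_right_diff_distrib[symmetric] by (simp add: n_def)
    also have "\<dots> = 2 / n * S" by (simp add: field_simps)
    also have "\<dots> \<le> ?c i * S" using S0 unfolding j_def[symmetric] l_def[symmetric] n_def[symmetric] by (intro mult_right_mono) auto
    finally show ?thesis .
  qed
  also have "\<dots> \<le> lipschitz_const * S" using ci S0 by (rule mult_right_mono)
  finally show ?thesis by (simp add: S_def)
qed

lemma index_eigenbasis: "gain_eigenbasis (index i) (k i) (dirs i) (fst (axes i)) (snd (axes i))"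
proof -
  have "\<exists>e l. gain_eigenbasis (index i) (k i) (dirs i) e l"
  proof (rule gain_eigenbasis_exists)
    show "finite (index i)" by (simp add: index_def orient_index_def finite_N)
    show "\<not> coplanar (insert 0 (dirs i ` index i))" using not_coplanar[of i] by (simp add: dirs_def[abs_def] index_def)
    show "card {x::real. \<exists>v. v \<noteq> 0 \<and> (\<Sum>c\<in>index i. k i c *\<^sub>R outer (dirs i c)) *v v = x *\<^sub>R v} = 3"
      using distinct_eigenvalues[of i] by (simp add: gain_matrix_def dirs_def index_def)
  qed (use gains_pos in \<open>auto simp: index_def\<close>)
  then have "\<exists>q. gain_eigenbasis (index i) (k i) (dirs i) (fst q) (snd q)" by force
  then show ?thesis unfolding axes_def by (rule someI_ex)
qed

sublocale cascade: orientation_cascade index k dirs dirs_est inertial_velocity k\<omega> lipschitz_const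
    "\<lambda>i. fst (axes i)" "\<lambda>i. snd (axes i)"
proof (rule orientation_cascade.intro)
  show "finite (index i)" for i by (simp add: index_def orient_index_def finite_N)
  show "k i c > 0" if "c \<in> index i" for c i using gains_pos that by (simp add: index_def)
  show "k\<omega> > 0" by (rule k\<omega>_pos)
  show "gain_eigenbasis (index i) (k i) (dirs i) (fst (axes i)) (snd (axes i))" for i by (rule index_eigenbasis)
  show "bounded (inertial_velocity i ` {0..})" for i
  proof -
    obtain B where "\<And>t. t \<ge> 0 \<Longrightarrow> norm (\<omega> (Inr i) t) \<le> B" using velocity_bounded[of "Inr i"] unfolding bounded_iff by auto
    then show ?thesis unfolding bounded_iff
      by (intro exI[of _ B]) (auto simp: inertial_velocity_def norm_rotation_mult_vec rotation)
  qed
  show "dirs_est i c (\<chi> j. mat 1) = dirs i c" for i c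
    by (simp add: dirs_est_def dirs_def orient_dir_def agent_error_id Let_def case_prod_beta split: option.split)
  show "lipschitz_const \<ge> 0" by (simp add: lipschitz_const_def sum_nonneg)
qed (rule dirs_est_lipschitz)

definition attitude_error :: "(real \<Rightarrow> 'f orientations) \<Rightarrow> real \<Rightarrow> 'f orientations" where
  "attitude_error Rh t = (\<chi> i. Rh t $ i ** transpose (R (Inr i) t))"

definition velocity_error :: "(real \<Rightarrow> 'f velocities) \<Rightarrow> real \<Rightarrow> 'f velocities" where
  "velocity_error W t = (\<chi> i. R (Inr i) t *v W t $ i)"

lemma estimator_rotation:
  assumes "orientation_estimator p R \<omega> N k k\<omega> Rh W" "t \<ge> 0"
  shows "rotation_matrix (Rh t $ i)"
  by (rule rotation_preserved[where \<psi>="\<lambda>t. \<omega> (Inr i) t - W t $ i"]) (use assms in \<open>auto simp: orientation_estimator_def\<close>)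

text \<open>Conjugation by \<open>R\<close> turns the known body velocity into the gyroscopic term, and rotations commute with
  cross products.\<close>

lemma estimator_solution:
  assumes est: "orientation_estimator p R \<omega> N k k\<omega> Rh W"
  shows "cascade.solution (attitude_error Rh) (velocity_error W)"
  unfolding cascade.solution_def
proof (intro allI impI conjI)
  fix i and t :: real assume t: "0 \<le> t"
  let ?R = "R (Inr i) t" and ?Rh = "Rh t $ i" and ?w = "\<omega> (Inr i) t" and ?W = "W t $ i"
  have rot: "rotation_matrix ?R" "rotation_matrix ?Rh" using rotation[OF t] estimator_rotation[OF est t] by auto
  show "rotation_matrix (attitude_error Rh t $ i)"
    by (simp add: attitude_error_def rotation_matrix_mult rotation_matrix_transpose rot)
  have dRh: "((\<lambda>s. Rh s $ i) has_vector_derivative ?Rh ** hat (?w - ?W)) (at t within {0..})"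
    using est t by (simp add: orientation_estimator_def)
  note dR = kinematics[OF t, of "Inr i"]
  have "((\<lambda>s. Rh s $ i ** transpose (R (Inr i) s)) has_vector_derivative
      ?Rh ** transpose (?R ** hat ?w) + ?Rh ** hat (?w - ?W) ** transpose ?R) (at t within {0..})"
    by (rule has_vector_derivative_matrix_mult[OF dRh has_vector_derivative_transpose[OF dR]])
  also have "?Rh ** transpose (?R ** hat ?w) + ?Rh ** hat (?w - ?W) ** transpose ?R = - (?Rh ** hat ?W ** transpose ?R)"
    by (simp add: matrix_transpose_mul transpose_hat hat_diff matrix_diff_left matrix_diff_right matrix_mul_assoc
        bounded_bilinear.minus_left[OF bounded_bilinear_matrix_mult] bounded_bilinear.minus_right[OF bounded_bilinear_matrix_mult])
  also have "?Rh ** hat ?W ** transpose ?R = ?Rh ** (transpose ?R ** ?R) ** hat ?W ** transpose ?R"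
    by (simp add: rotation_matrixD rot)
  also have "\<dots> = (?Rh ** transpose ?R) ** hat (?R *v ?W)"
    unfolding rotation_hat_conj[OF rot(1), symmetric] by (simp only: matrix_mul_assoc)
  finally show "((\<lambda>s. attitude_error Rh s $ i) has_vector_derivative
      - (attitude_error Rh t $ i ** hat (velocity_error W t $ i))) (at t within {0..})"
    by (simp add: attitude_error_def velocity_error_def)
  have g: "with_leaders (\<lambda>l. R (Inl l) t) (Rh t) j *v body_direction p R j (Inr i) j t
      = agent_error (attitude_error Rh t) j *v direction p (Inr i) j" for j
    by (cases j) (simp_all add: with_leaders_def agent_error_def body_direction_def attitude_error_def
        rotation_matrixD rotation[OF t] matrix_vector_mul_assoc[symmetric])
  have est_dir: "orient_dir_est p R (N i) (with_leaders (\<lambda>l. R (Inl l) t) (Rh t)) t (Inr i) c = dirs_est i c (attitude_error Rh t)" for c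
    by (simp add: orient_dir_est_def dirs_est_def g Let_def split: option.split)
  let ?\<tau> = "\<Sum>c\<in>index i. k i c *\<^sub>R ((transpose ?Rh *v dirs_est i c (attitude_error Rh t)) \<times> (transpose ?R *v dirs i c))"
  have "((\<lambda>s. W s $ i) has_vector_derivative - k\<omega> *\<^sub>R ?W + (\<Sum>c\<in>orient_index (N i). k i c *\<^sub>R
                ((transpose ?Rh *v orient_dir_est p R (N i) (with_leaders (\<lambda>l. R (Inl l) t) (Rh t)) t (Inr i) c)
                 \<times> (transpose ?R *v orient_dir p (N i) (Inr i) c)))) (at t within {0..})"
    using est t unfolding orientation_estimator_def by blast
  then have dW: "((\<lambda>s. W s $ i) has_vector_derivative - k\<omega> *\<^sub>R ?W + ?\<tau>) (at t within {0..})"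
    unfolding est_dir index_def dirs_def .
  have "((\<lambda>s. R (Inr i) s *v W s $ i) has_vector_derivative ?R *v (- k\<omega> *\<^sub>R ?W + ?\<tau>) + (?R ** hat ?w) *v ?W) (at t within {0..})"
    by (rule has_vector_derivative_mult_vec[OF dR dW])
  also have "(?R ** hat ?w) *v ?W = inertial_velocity i t \<times> (?R *v ?W)"
    by (simp add: matrix_vector_mul_assoc[symmetric] hat_mult cross_rotation_matrix[OF rot(1)] inertial_velocity_def)
  also have "?R *v (- k\<omega> *\<^sub>R ?W + ?\<tau>) = - k\<omega> *\<^sub>R (?R *v ?W) + ?R *v ?\<tau>"
    by (simp only: matrix_vector_right_distrib matrix_vector_mult_scaleR)
  also have "?R *v ?\<tau> = cascade.drive i (attitude_error Rh t)"
    unfolding torque_def mult_vec_sum_right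
  proof (intro sum.cong refl)
    fix c
    show "?R *v (k i c *\<^sub>R ((transpose ?Rh *v dirs_est i c (attitude_error Rh t)) \<times> (transpose ?R *v dirs i c)))
       = k i c *\<^sub>R ((transpose (attitude_error Rh t $ i) *v dirs_est i c (attitude_error Rh t)) \<times> dirs i c)"
      by (simp add: matrix_vector_mult_scaleR cross_rotation_matrix[OF rot(1), symmetric] rotation_matrixD rot
          attitude_error_def matrix_transpose_mul matrix_vector_mul_assoc[symmetric])
  qed
  finally show "((\<lambda>s. velocity_error W s $ i) has_vector_derivative
      inertial_velocity i t \<times> velocity_error W t $ i - k\<omega> *\<^sub>R velocity_error W t $ i + cascade.drive i (attitude_error Rh t)) (at t within {0..})"
    by (simp add: velocity_error_def algebra_simps)
qed

section \<open>The position estimator\<close>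

abbreviation bearing :: "'f \<Rightarrow> 'l + 'f \<Rightarrow> real^3" where "bearing i j \<equiv> direction p (Inr i) j"

definition stiff :: "'f \<Rightarrow> real^3 \<Rightarrow> real^3" where
  "stiff i x = (\<Sum>j\<in>N i. kp i j *\<^sub>R perp_part (bearing i j) x)"

lemma bearing_unit: assumes "j \<in> N i" shows "norm (bearing i j) = 1"
proof -
  have "Inr i \<notin> N i" using neighbors_precede by blast
  then have "p j \<noteq> p (Inr i)" using assms not_collocated by (metis injD)
  then show ?thesis by (simp add: direction_sgn norm_sgn)
qed

lemma perp_part_bearing: assumes "j \<in> N i" shows "perp_part (bearing i j) (p j - p (Inr i)) = 0"
proof -
  have "p j - p (Inr i) = norm (p j - p (Inr i)) *\<^sub>R bearing i j"
    by (cases "p j = p (Inr i)") (simp_all add: direction_def)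
  moreover have "perp_part b (a *\<^sub>R b) = 0" if "norm b = 1" for a and b :: "real^3"
    using that by (simp add: perp_part_def norm_eq_1)
  ultimately show ?thesis using bearing_unit[OF assms] by metis
qed

lemma linear_stiff: "linear (stiff i)"
  by (rule linearI) (simp_all add: stiff_def linear_add[OF linear_perp_part] linear_cmul[OF linear_perp_part]
      scaleR_right_distrib sum.distrib scaleR_sum_right mult.commute)

lemma inner_perp_part: "norm b = 1 \<Longrightarrow> x \<bullet> perp_part b x = (norm (perp_part b x))\<^sup>2"
  by (simp add: norm_perp_part)
    (simp add: perp_part_def inner_diff_right power2_norm_eq_inner[of x] power2_eq_square[of "x \<bullet> b"])

text \<open>A vector annihilated by all projections is parallel to all bearings, which puts the neighbors on a line through
  the follower.\<close>

lemma stiff_pos: assumes "x \<noteq> 0" shows "0 < x \<bullet> stiff i x"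
proof -
  have eq: "x \<bullet> stiff i x = (\<Sum>j\<in>N i. kp i j * (norm (perp_part (bearing i j) x))\<^sup>2)"
    unfolding stiff_def inner_sum_right by (intro sum.cong refl) (simp add: inner_perp_part bearing_unit)
  have nn: "0 \<le> kp i j * (norm (perp_part (bearing i j) x))\<^sup>2" if "j \<in> N i" for j
    using position_gains_pos[OF that] by simp
  have "x \<bullet> stiff i x \<noteq> 0"
  proof
    assume "x \<bullet> stiff i x = 0"
    then have z: "perp_part (bearing i j) x = 0" if "j \<in> N i" for j
    proof -
      have "(\<Sum>j\<in>N i. kp i j * (norm (perp_part (bearing i j) x))\<^sup>2) = 0" using eq \<open>x \<bullet> stiff i x = 0\<close> by (simp only:)
      from sum_nonneg_0[OF finite_N nn this that] show ?thesis using position_gains_pos[OF that] by simp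
    qed
    have par: "\<exists>a. p j = p (Inr i) + a *\<^sub>R x" if j: "j \<in> N i" for j
    proof -
      have xb: "x = (x \<bullet> bearing i j) *\<^sub>R bearing i j" using z[OF j] by (simp add: perp_part_def)
      then have "x \<bullet> bearing i j \<noteq> 0" using assms by auto
      then have "bearing i j = inverse (x \<bullet> bearing i j) *\<^sub>R x" by (subst (2) xb) simp
      moreover have "p j - p (Inr i) = norm (p j - p (Inr i)) *\<^sub>R bearing i j"
    by (cases "p j = p (Inr i)") (simp_all add: direction_def)
      ultimately have "p j - p (Inr i) = (norm (p j - p (Inr i)) * inverse (x \<bullet> bearing i j)) *\<^sub>R x" by (metis scaleR_scaleR)
      then show ?thesis by (metis add.commute diff_add_cancel)
    qed
    obtain j l where jl: "j \<in> N i" "l \<in> N i" "\<not> collinear {p (Inr i), p j, p l}" using not_collinear[of i] by blast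
    have on: "\<exists>a. y = p (Inr i) + a *\<^sub>R x" if "y \<in> {p (Inr i), p j, p l}" for y
      using that par[OF jl(1)] par[OF jl(2)] by (auto intro: exI[of _ 0])
    have "collinear {p (Inr i), p j, p l}"
      unfolding collinear_def
    proof (intro exI[of _ x] ballI)
      fix y z assume "y \<in> {p (Inr i), p j, p l}" "z \<in> {p (Inr i), p j, p l}"
      then obtain a a' where "y = p (Inr i) + a *\<^sub>R x" "z = p (Inr i) + a' *\<^sub>R x" using on by blast
      then have "y - z = (a - a') *\<^sub>R x" by (simp add: scaleR_left_diff_distrib)
      then show "\<exists>c. y - z = c *\<^sub>R x" by blast
    qed
    then show False using jl(3) by simp
  qed
  moreover have "0 \<le> x \<bullet> stiff i x" unfolding eq by (rule sum_nonneg[OF nn])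
  ultimately show ?thesis by simp
qed

text \<open>Each projection annihilates \<open>p j - p (Inr i)\<close>, so every neighbor may be replaced by the position
  of the follower itself.\<close>

lemma position_f_eq: "position_f p N kp x = - (\<chi> i. stiff i ((x - follower_positions p) $ i))"
proof -
  have "perp_part (bearing i j) (x $ i - p j) = perp_part (bearing i j) (x $ i - p (Inr i))" if "j \<in> N i" for i j
    using perp_part_bearing[OF that] perp_part_diff[of "bearing i j" "x $ i - p (Inr i)" "p j - p (Inr i)"] by simp
  then show ?thesis
    by (simp add: position_f_def perp_proj_mult_vec stiff_def follower_positions_def vec_eq_iff)
qed

lemma position_iss: "input_to_state_stable (\<lambda>t. position_f p N kp) (follower_positions p)"
proof -
  define A where "A z = (\<chi> i. stiff i (z $ i))" for z :: "'f velocities"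
  have A: "linear A"
    by (rule linearI) (simp_all add: A_def vec_eq_iff linear_add[OF linear_stiff] linear_cmul[OF linear_stiff])
  obtain \<alpha> where \<alpha>: "\<alpha> > 0" "\<And>z. \<alpha> * (norm z)\<^sup>2 \<le> z \<bullet> A z"
  proof (rule positive_definite_bound[OF A])
    fix z :: "'f velocities" assume "z \<noteq> 0"
    then obtain i where i: "z $ i \<noteq> 0" by (auto simp: vec_eq_iff)
    have "0 \<le> z $ j \<bullet> stiff j (z $ j)" for j
      using stiff_pos[of "z $ j" j] by (cases "z $ j = 0") (auto simp: less_imp_le)
    then have "0 < (\<Sum>j\<in>UNIV. z $ j \<bullet> stiff j (z $ j))"
      using stiff_pos[OF i] by (intro sum_pos2[of UNIV i]) auto
    then show "0 < z \<bullet> A z" by (simp add: inner_vec_def[of z] A_def)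
  qed blast
  have "input_to_state_stable (\<lambda>t x. - A (x - follower_positions p)) (follower_positions p)"
    using A by (intro linear_input_to_state_stable[OF _ \<alpha>]) (simp add: linear_conv_bounded_linear)
  then show ?thesis by (simp add: A_def position_f_eq[abs_def])
qed

text \<open>Conjugating a projection by \<open>R\<close> rotates its axis. Expanding \<open>h\<close>, all terms with
  the true orientation cancel.\<close>

lemma position_cascade_form:
  assumes pos: "position_estimator p R N kp Rh ph" and t: "t \<ge> 0"
  shows "(ph has_vector_derivative position_f p N kp (ph t) + position_h p R N kp t (ph t) (Rh t)) (at t within {0..})"
proof (rule has_vector_derivative_vec_lambda)
  fix i
  let ?R = "R (Inr i) t" and ?Rh = "Rh t $ i" and ?x = "ph t $ i"
  let ?xa = "with_leaders (\<lambda>l. p (Inl l)) (ph t)"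
  let ?P = "\<lambda>j. perp_proj (body_direction p R (Inr i) (Inr i) j t)"
  let ?S = "\<lambda>f. \<Sum>j\<in>N i. kp i j *\<^sub>R (?P j *v f j)"
  have S_diff: "?S (\<lambda>j. f j - f' j) = ?S f - ?S f'" for f f'
    by (simp add: mult_vec_diff_right scaleR_right_diff_distrib sum_subtractf)
  have f: "position_f p N kp (ph t) $ i = - (?R *v ?S (\<lambda>j. transpose ?R *v (?x - p j)))"
  proof -
    have "?R *v (?P j *v (transpose ?R *v y)) = perp_proj (bearing i j) *v y" for j y
      by (simp add: perp_proj_mult_vec perp_part_rotation rotation[OF t] body_direction_def rotation_matrixD)
    then show ?thesis
      by (simp add: position_f_def mult_vec_sum_right matrix_vector_mult_scaleR)
  qed
  have S13: "?S (\<lambda>j. transpose ?R *v (?x - ?xa j)) = ?S (\<lambda>j. transpose ?R *v (?x - p j)) + ?S (\<lambda>j. transpose ?R *v (p j - ?xa j))"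
    using S_diff[of "\<lambda>j. transpose ?R *v (?x - ?xa j)" "\<lambda>j. transpose ?R *v (p j - ?xa j)"]
    by (simp add: mult_vec_diff_right[symmetric])
  have S2: "?S (\<lambda>j. (transpose ?Rh - transpose ?R) *v (?x - ?xa j)) = ?S (\<lambda>j. transpose ?Rh *v (?x - ?xa j)) - ?S (\<lambda>j. transpose ?R *v (?x - ?xa j))"
    unfolding mult_vec_diff_left by (rule S_diff)
  have "(position_f p N kp (ph t) + position_h p R N kp t (ph t) (Rh t)) $ i = - (?Rh *v ?S (\<lambda>j. transpose ?Rh *v (?x - ?xa j)))"
    unfolding vector_add_component f position_h_def Let_def vec_lambda_beta S2 S13
    by (simp add: mult_vec_diff_left mult_vec_diff_right matrix_vector_right_distrib)
  then show "((\<lambda>s. ph s $ i) has_vector_derivative (position_f p N kp (ph t) + position_h p R N kp t (ph t) (Rh t)) $ i) (at t within {0..})"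
    using pos t by (simp add: position_estimator_def)
qed

text \<open>The estimator projects along \<open>Q b\<close> instead of \<open>b\<close>. As \<open>Q\<close> tends to the identity, this changes the quadratic form by a
  small multiple of \<open>\<bar>e\<bar>\<^sup>2\<close>, and leaves of \<open>p j - p (Inr i)\<close> a vanishing remainder. The neighbors' errors vanish by
  induction.\<close>

lemma position_convergence:
  assumes ori: "orientation_estimator p R \<omega> N k k\<omega> Rh W" and pos: "position_estimator p R N kp Rh ph"
    and lim: "\<And>i. ((\<lambda>t. attitude_error Rh t $ i) \<longlongrightarrow> mat 1) at_top"
  shows "((\<lambda>t. ph t $ i) \<longlongrightarrow> p (Inr i)) at_top"
proof (induction i rule: finite_linorder_induct)
  case (less i)
  let ?Q = "\<lambda>t. attitude_error Rh t $ i" and ?xa = "\<lambda>t. with_leaders (\<lambda>l. p (Inl l)) (ph t)"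
  define e where "e t = ph t $ i - p (Inr i)" for t
  have nbr: "((\<lambda>t. ?xa t j - p j) \<longlongrightarrow> 0) at_top" if "j \<in> N i" for j
  proof (cases j)
    case (Inr m)
    then have "((\<lambda>t. ph t $ m) \<longlongrightarrow> p j) at_top" using less neighbors_precede that by auto
    then show ?thesis unfolding Inr by (simp add: with_leaders_def LIM_zero_iff)
  qed (simp add: with_leaders_def)
  define \<rho> where "\<rho> t = (\<Sum>j\<in>N i. kp i j * (norm (perp_part (?Q t *v bearing i j) (p j - p (Inr i))) + norm (?xa t j - p j)))" for t
  have Qb: "((\<lambda>t. ?Q t *v b) \<longlongrightarrow> b) at_top" for b
    using tendsto_mult_vec[OF lim tendsto_const, of i b] by simp
  have "((\<lambda>t. perp_part (?Q t *v bearing i j) (p j - p (Inr i))) \<longlongrightarrow> perp_part (bearing i j) (p j - p (Inr i))) at_top" for j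
    unfolding perp_part_def by (intro tendsto_intros Qb)
  then have "((\<lambda>t. perp_part (?Q t *v bearing i j) (p j - p (Inr i))) \<longlongrightarrow> 0) at_top" if "j \<in> N i" for j
    using perp_part_bearing[OF that] by metis
  then have "(\<rho> \<longlongrightarrow> (\<Sum>j\<in>N i. kp i j * (norm (0::real^3) + norm (0::real^3)))) at_top"
    unfolding \<rho>_def[abs_def] by (intro tendsto_intros nbr) auto
  then have \<rho>: "(\<rho> \<longlongrightarrow> 0) at_top" by simp
  obtain \<alpha> where \<alpha>: "\<alpha> > 0" "\<And>x. \<alpha> * (norm x)\<^sup>2 \<le> x \<bullet> stiff i x"
    by (rule positive_definite_bound[OF linear_stiff[of i] stiff_pos], assumption) (rule that)
  define K where "K = (\<Sum>j\<in>N i. kp i j)"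
  have K: "K > 0"
  proof -
    have "N i \<noteq> {}" using not_collinear[of i] by blast
    then show ?thesis unfolding K_def using finite_N position_gains_pos by (intro sum_pos) auto
  qed
  have "eventually (\<lambda>t. norm (?Q t - mat 1) < \<alpha> / (4 * K)) at_top"
    using tendstoD[OF lim[of i], of "\<alpha> / (4 * K)"] \<alpha>(1) K by (simp add: dist_norm)
  then have "eventually (\<lambda>t. \<exists>e'. (e has_vector_derivative e') (at t within {0..}) \<and>
          e t \<bullet> e' \<le> - (\<alpha> / 2) * (norm (e t))\<^sup>2 + \<rho> t * norm (e t)) at_top"
    using eventually_ge_at_top[of 0]
  proof eventually_elim
    case (elim t)
    note t = elim(2)
    have rotR: "rotation_matrix (R (Inr i) t)" by (rule rotation[OF t])
    have rotRh: "rotation_matrix (Rh t $ i)" by (rule estimator_rotation[OF ori t])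
    have rotQ: "rotation_matrix (?Q t)"
      by (simp add: attitude_error_def rotation_matrix_mult rotation_matrix_transpose rotR rotRh)
    let ?b = "\<lambda>j. ?Q t *v bearing i j"
    let ?e' = "- (\<Sum>j\<in>N i. kp i j *\<^sub>R perp_part (?b j) (ph t $ i - ?xa t j))"
    have "((\<lambda>s. ph s $ i) has_vector_derivative ?e') (at t within {0..})"
    proof -
      have r: "Rh t $ i *v (perp_proj (body_direction p R (Inr i) (Inr i) j t) *v (transpose (Rh t $ i) *v y)) = perp_part (?b j) y" for j y
        by (simp add: perp_proj_mult_vec perp_part_rotation rotRh body_direction_def attitude_error_def matrix_vector_mul_assoc[symmetric])
      have "((\<lambda>s. ph s $ i) has_vector_derivative - (Rh t $ i *v (\<Sum>j\<in>N i. kp i j *\<^sub>R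
          (perp_proj (body_direction p R (Inr i) (Inr i) j t) *v (transpose (Rh t $ i) *v (ph t $ i - ?xa t j)))))) (at t within {0..})"
        using pos t unfolding position_estimator_def by blast
      then show ?thesis unfolding mult_vec_sum_right matrix_vector_mult_scaleR r .
    qed
    then have d: "(e has_vector_derivative ?e') (at t within {0..})"
      unfolding e_def[abs_def] by (simp add: has_vector_derivative_diff_const)
    have bound: "- (e t \<bullet> perp_part (?b j) (ph t $ i - ?xa t j)) \<le> - (e t \<bullet> perp_part (bearing i j) (e t)) + (\<alpha> / (2 * K)) * (norm (e t))\<^sup>2
        + norm (e t) * (norm (perp_part (?b j) (p j - p (Inr i))) + norm (?xa t j - p j))" if j: "j \<in> N i" for j
    proof -
      let ?c = "bearing i j"
      have u: "norm ?c = 1" "norm (?b j) = 1"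
        using bearing_unit[OF j] by (simp_all add: norm_rotation_mult_vec rotQ)
      have split: "ph t $ i - ?xa t j = e t - (p j - p (Inr i)) - (?xa t j - p j)" by (simp add: e_def)
      have "- (e t \<bullet> perp_part (?b j) (ph t $ i - ?xa t j)) = - (e t \<bullet> perp_part (?b j) (e t)) + e t \<bullet> perp_part (?b j) (p j - p (Inr i))
          + e t \<bullet> perp_part (?b j) (?xa t j - p j)"
        unfolding split perp_part_diff inner_diff_right by simp
      moreover have "e t \<bullet> perp_part (?b j) (p j - p (Inr i)) \<le> norm (e t) * norm (perp_part (?b j) (p j - p (Inr i)))"
        by (rule norm_cauchy_schwarz)
      moreover have "e t \<bullet> perp_part (?b j) (?xa t j - p j) \<le> norm (e t) * norm (?xa t j - p j)"
        by (rule order_trans[OF norm_cauchy_schwarz mult_left_mono[OF norm_perp_part_le[OF u(2)]]]) simp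
      moreover have "- (e t \<bullet> perp_part (?b j) (e t)) + e t \<bullet> perp_part ?c (e t) \<le> (\<alpha> / (2 * K)) * (norm (e t))\<^sup>2"
      proof -
        have "- (e t \<bullet> perp_part (?b j) (e t)) + e t \<bullet> perp_part ?c (e t) = (e t \<bullet> (?b j - ?c)) * (e t \<bullet> (?b j + ?c))"
          by (simp add: perp_part_def inner_diff_right inner_add_right algebra_simps)
        also have "\<dots> \<le> \<bar>e t \<bullet> (?b j - ?c)\<bar> * \<bar>e t \<bullet> (?b j + ?c)\<bar>" by (simp flip: abs_mult)
        also have "\<dots> \<le> (norm (e t) * (\<alpha> / (4 * K))) * (norm (e t) * 2)"
        proof (rule mult_mono)
          have "?b j - ?c = (?Q t - mat 1) *v ?c" by (simp add: mult_vec_diff_left)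
          then have "norm (?b j - ?c) \<le> \<alpha> / (4 * K)"
            using norm_mult_vec_le[of "?Q t - mat 1" ?c] u elim(1) by simp
          then show "\<bar>e t \<bullet> (?b j - ?c)\<bar> \<le> norm (e t) * (\<alpha> / (4 * K))"
            by (intro order_trans[OF Cauchy_Schwarz_ineq2] mult_left_mono) auto
          have "norm (?b j + ?c) \<le> 2" using norm_triangle_ineq[of "?b j" ?c] u by simp
          then show "\<bar>e t \<bullet> (?b j + ?c)\<bar> \<le> norm (e t) * 2"
            by (intro order_trans[OF Cauchy_Schwarz_ineq2] mult_left_mono) auto
        qed (use \<alpha> K in auto)
        finally show ?thesis by (simp add: power2_eq_square)
      qed
      ultimately show ?thesis unfolding distrib_left by linarith
    qed
    have "e t \<bullet> ?e' = (\<Sum>j\<in>N i. kp i j * - (e t \<bullet> perp_part (?b j) (ph t $ i - ?xa t j)))"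
      by (simp add: inner_sum_right sum_negf)
    also have "\<dots> \<le> (\<Sum>j\<in>N i. kp i j * (- (e t \<bullet> perp_part (bearing i j) (e t)) + (\<alpha> / (2 * K)) * (norm (e t))\<^sup>2
        + norm (e t) * (norm (perp_part (?b j) (p j - p (Inr i))) + norm (?xa t j - p j))))"
      using position_gains_pos by (intro sum_mono mult_left_mono bound) (auto simp: less_imp_le)
    also have "\<dots> = - (e t \<bullet> stiff i (e t)) + K * ((\<alpha> / (2 * K)) * (norm (e t))\<^sup>2) + \<rho> t * norm (e t)"
      unfolding stiff_def K_def \<rho>_def inner_sum_right sum_distrib_right sum_negf[symmetric] sum.distrib[symmetric]
      by (intro sum.cong refl) (simp add: algebra_simps)
    also have "K * ((\<alpha> / (2 * K)) * (norm (e t))\<^sup>2) = \<alpha> / 2 * (norm (e t))\<^sup>2" using K by simp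
    finally have "e t \<bullet> ?e' \<le> - (\<alpha> / 2) * (norm (e t))\<^sup>2 + \<rho> t * norm (e t)" using \<alpha>(2)[of "e t"] by simp
    with d show ?case by blast
  qed
  then have "(e \<longlongrightarrow> 0) at_top"
    by (rule vanishing_forcing_tendsto_0[OF _ \<rho>, rotated]) (use \<alpha> in auto)
  then show ?case by (simp add: e_def[abs_def] LIM_zero_iff)
qed

section \<open>The exceptional set\<close>

definition initial_error :: "'f orientations \<Rightarrow> 'f velocities \<Rightarrow> 'f orientations \<times> 'f velocities" where
  "initial_error Q w = ((\<chi> i. Q $ i ** transpose (R (Inr i) 0)), (\<chi> i. R (Inr i) 0 *v w $ i))"

text \<open>In the Cayley chart around \<open>Q\<close> the map from initial estimates to initial errors is expansive on bounded sets. The position estimate is a free additional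
  coordinate.\<close>

lemma null_initial_errors:
  assumes S: "lipschitz_hypersurface S TYPE('f velocities \<times> 'f velocities)" and Q: "\<And>i. rotation_matrix (Q $ i)"
  shows "negligible {(v :: 'f velocities, w :: 'f velocities, x :: 'f velocities).
     initial_error (\<chi> i. Q $ i ** cayley (v $ i)) w \<in> S}"
proof -
  define \<phi> where "\<phi> = (\<lambda>(v :: 'f velocities, w :: 'f velocities, x :: 'f velocities). (initial_error (\<chi> i. Q $ i ** cayley (v $ i)) w, x))"
  have rotR: "rotation_matrix (R a 0)" for a by (rule rotation) simp
  have "negligible {z. \<phi> z \<in> Sigma S (\<lambda>_. UNIV)}"
  proof (rule negligible_preimage_hypersurface[OF lipschitz_hypersurface_Times[OF S]])
    show "DIM(('f velocities \<times> 'f velocities) \<times> 'f velocities) \<le> DIM('f velocities \<times> 'f velocities \<times> 'f velocities)" by simp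
    fix m :: nat
    define c where "c = (2 + 2 * real m)\<^sup>2"
    have c: "c \<ge> 0" by (simp add: c_def)
    have "dist z z' \<le> (c + 2) * dist (\<phi> z) (\<phi> z')" if m: "norm z \<le> m" "norm z' \<le> m" for z z'
    proof -
      obtain v w x where z: "z = (v, w, x)" by (cases z)
      obtain v' w' x' where z': "z' = (v', w', x')" by (cases z')
      let ?E = "initial_error (\<chi> i. Q $ i ** cayley (v $ i)) w" and ?E' = "initial_error (\<chi> i. Q $ i ** cayley (v' $ i)) w'"
      have vm: "norm (v $ i) \<le> m" "norm (v' $ i) \<le> m" for i
      proof -
        have "norm v \<le> norm z" "norm v' \<le> norm z'" unfolding z z' by (rule norm_fst_le)+
        then show "norm (v $ i) \<le> m" "norm (v' $ i) \<le> m"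
          using m Finite_Cartesian_Product.norm_nth_le[of v i] Finite_Cartesian_Product.norm_nth_le[of v' i] by linarith+
      qed
      have "norm (v - v') \<le> c * norm (fst ?E - fst ?E')"
      proof (rule norm_vec_scale_le[OF _ c])
        fix i
        have "(fst ?E - fst ?E') $ i = Q $ i ** (cayley (v $ i) - cayley (v' $ i)) ** transpose (R (Inr i) 0)"
          by (simp add: initial_error_def matrix_diff_left matrix_diff_right)
        then have "norm ((fst ?E - fst ?E') $ i) = norm (cayley (v $ i) - cayley (v' $ i))"
          by (simp add: norm_mult_rotation norm_rotation_mult rotation_matrix_transpose rotR Q)
        then show "norm ((v - v') $ i) \<le> c * norm ((fst ?E - fst ?E') $ i)"
          using cayley_expansive[OF vm[of i]] by (simp add: c_def)
      qed
      moreover have "norm (w - w') \<le> 1 * norm (snd ?E - snd ?E')"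
      proof (rule norm_vec_scale_le)
        fix i
        have "(snd ?E - snd ?E') $ i = R (Inr i) 0 *v (w $ i - w' $ i)" by (simp add: initial_error_def mult_vec_diff_right)
        then show "norm ((w - w') $ i) \<le> 1 * norm ((snd ?E - snd ?E') $ i)" by (simp add: norm_rotation_mult_vec rotR)
      qed simp
      moreover have "norm (fst ?E - fst ?E') \<le> dist (\<phi> z) (\<phi> z')" "norm (snd ?E - snd ?E') \<le> dist (\<phi> z) (\<phi> z')" "norm (x - x') \<le> dist (\<phi> z) (\<phi> z')"
      proof -
        have comp: "norm (fst D) \<le> norm D" "norm (snd D) \<le> norm D" for D :: "'f orientations \<times> 'f velocities"
          using norm_fst_le[of "fst D" "snd D"] norm_snd_le[of "snd D" "fst D"] by simp_all
        have d: "dist (\<phi> z) (\<phi> z') = norm (?E - ?E', x - x')" by (simp add: \<phi>_def z z' dist_norm)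
        have "norm (?E - ?E') \<le> dist (\<phi> z) (\<phi> z')" "norm (x - x') \<le> dist (\<phi> z) (\<phi> z')" unfolding d by (simp_all add: norm_Pair)
        then show "norm (fst ?E - fst ?E') \<le> dist (\<phi> z) (\<phi> z')" "norm (snd ?E - snd ?E') \<le> dist (\<phi> z) (\<phi> z')" "norm (x - x') \<le> dist (\<phi> z) (\<phi> z')"
          using comp[of "?E - ?E'"] unfolding fst_diff snd_diff by linarith+
      qed
      moreover have "c * norm (fst ?E - fst ?E') \<le> c * dist (\<phi> z) (\<phi> z')"
        using c calculation(3) by (intro mult_left_mono)
      moreover have "dist z z' \<le> norm (v - v') + (norm (w - w') + norm (x - x'))"
      proof -
        have "dist z z' = norm (v - v', w - w', x - x')" by (simp add: z z' dist_norm)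
        also have "\<dots> \<le> norm (v - v') + norm (w - w', x - x')" by (rule norm_Pair_le)
        also have "norm (w - w', x - x') \<le> norm (w - w') + norm (x - x')" by (rule norm_Pair_le)
        finally show ?thesis by simp
      qed
      ultimately show ?thesis unfolding distrib_right by linarith
    qed
    then show "\<exists>B\<ge>0. \<forall>z z'. norm z \<le> m \<longrightarrow> norm z' \<le> m \<longrightarrow> dist z z' \<le> B * dist (\<phi> z) (\<phi> z')"
      using c by (intro exI[of _ "c + 2"]) auto
  qed
  moreover have "{z. \<phi> z \<in> Sigma S (\<lambda>_. UNIV)} = {(v, w, x). initial_error (\<chi> i. Q $ i ** cayley (v $ i)) w \<in> S}"
    by (auto simp: \<phi>_def)
  ultimately show ?thesis by simp
qed

theorem almost_global_position_convergence:
  "\<exists>Z. null_initial_conditions Z \<and>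
     (\<forall>Rh W ph. orientation_estimator p R \<omega> N k k\<omega> Rh W \<longrightarrow> position_estimator p R N kp Rh ph \<longrightarrow>
        (Rh 0, W 0, ph 0) \<notin> Z \<longrightarrow> (ph \<longlongrightarrow> follower_positions p) at_top)"
proof -
  obtain F where F: "countable F" "\<forall>S\<in>F. lipschitz_hypersurface S TYPE('f velocities \<times> 'f velocities)"
    "\<forall>Q u. cascade.solution Q u \<longrightarrow> (Q 0, u 0) \<notin> \<Union>F \<longrightarrow> (\<forall>i. ((\<lambda>t. Q t $ i) \<longlongrightarrow> mat 1) at_top)"
    using cascade.almost_global_convergence by (elim exE conjE) (rule that)
  define Z where "Z = {(Q, w, x :: 'f velocities). initial_error Q w \<in> \<Union>F}"
  have "null_initial_conditions Z"
    unfolding null_initial_conditions_def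
  proof (intro allI impI)
    fix Q :: "'f orientations" assume Q: "\<forall>i. rotation_matrix (Q $ i)"
    have "negligible (\<Union>S\<in>F. {(v, w, x :: 'f velocities). initial_error (\<chi> i. Q $ i ** cayley (v $ i)) w \<in> S})"
      using F(1,2) Q by (intro negligible_Union_image null_initial_errors) auto
    moreover have "(\<Union>S\<in>F. {(v, w, x :: 'f velocities). initial_error (\<chi> i. Q $ i ** cayley (v $ i)) w \<in> S})
       = {(v, w, x). ((\<chi> i. Q $ i ** cayley (v $ i)), w, x) \<in> Z}" by (auto simp: Z_def)
    ultimately show "negligible {(v, w, x). ((\<chi> i. Q $ i ** cayley (v $ i)), w, x) \<in> Z}" by simp
  qed
  moreover have "(ph \<longlongrightarrow> follower_positions p) at_top"
    if ori: "orientation_estimator p R \<omega> N k k\<omega> Rh W" and pos: "position_estimator p R N kp Rh ph" and out: "(Rh 0, W 0, ph 0) \<notin> Z" for Rh W ph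
  proof (rule vec_tendstoI)
    fix i
    have "initial_error (Rh 0) (W 0) = (attitude_error Rh 0, velocity_error W 0)"
      by (simp add: initial_error_def attitude_error_def velocity_error_def)
    then have "(attitude_error Rh 0, velocity_error W 0) \<notin> \<Union>F" using out by (simp add: Z_def)
    then have "((\<lambda>t. attitude_error Rh t $ i) \<longlongrightarrow> mat 1) at_top" for i
      using F(3) estimator_solution[OF ori] by blast
    from position_convergence[OF ori pos this]
    show "((\<lambda>t. ph t $ i) \<longlongrightarrow> follower_positions p $ i) at_top" by (simp add: follower_positions_def)
  qed
  ultimately show ?thesis by blast
qed

end

unbundle no cross3_syntax

theorem theorem3:
  fixes p :: "'l::finite + 'f::{finite,linorder} \<Rightarrow> real^3"
    and R :: "'l + 'f \<Rightarrow> real \<Rightarrow> real^3^3"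
    and \<omega> :: "'l + 'f \<Rightarrow> real \<Rightarrow> real^3"
    and N :: "'f \<Rightarrow> ('l + 'f) set"
    and k :: "'f \<Rightarrow> ('l + 'f) option \<Rightarrow> real"
    and k\<omega> :: real
    and kp :: "'f \<Rightarrow> 'l + 'f \<Rightarrow> real"
  assumes two_leaders: "CARD('l) \<ge> 2"
    and rotation: "\<And>a t. t \<ge> 0 \<Longrightarrow> rotation_matrix (R a t)"
    and kinematics: "\<And>a t. t \<ge> 0 \<Longrightarrow>
          (R a has_vector_derivative R a t ** hat (\<omega> a t)) (at t within {0..})"
    and velocity_bounded: "\<And>a. bounded (\<omega> a ` {0..})"
    and acceleration_bounded: "\<And>a. \<exists>\<omega>'. bounded (\<omega>' ` {0..}) \<and>
          (\<forall>t\<ge>0. (\<omega> a has_vector_derivative \<omega>' t) (at t within {0..}))"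
    and two_neighbors: "\<And>i. card (N i) \<ge> 2"
    and neighbors_precede: "\<And>i j. Inr j \<in> N i \<Longrightarrow> j < i"
    and not_collocated: "inj p"
    and not_collinear: "\<And>i. \<exists>j\<in>N i. \<exists>l\<in>N i. \<not> collinear {p (Inr i), p j, p l}"
    and gains_pos: "\<And>i c. c \<in> orient_index (N i) \<Longrightarrow> k i c > 0"
    and k\<omega>_pos: "k\<omega> > 0"
    and not_coplanar: "\<And>i. \<not> coplanar (insert 0 (orient_dir p (N i) (Inr i) ` orient_index (N i)))"
    and distinct_eigenvalues: "\<And>i. card {c::real. \<exists>v. v \<noteq> 0 \<and>
          gain_matrix p (N i) (k i) (Inr i) *v v = c *\<^sub>R v} = 3"
    and position_gains_pos: "\<And>i j. j \<in> N i \<Longrightarrow> kp i j > 0"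
  shows "input_to_state_stable (\<lambda>t. position_f p N kp) (follower_positions p) \<and>
    (\<forall>Rh W ph. orientation_estimator p R \<omega> N k k\<omega> Rh W \<longrightarrow> position_estimator p R N kp Rh ph \<longrightarrow>
       (\<forall>t\<ge>0. (ph has_vector_derivative
          position_f p N kp (ph t) + position_h p R N kp t (ph t) (Rh t)) (at t within {0..}))) \<and>
    (\<exists>Z. null_initial_conditions Z \<and>
       (\<forall>Rh W ph. orientation_estimator p R \<omega> N k k\<omega> Rh W \<longrightarrow> position_estimator p R N kp Rh ph \<longrightarrow>
          (Rh 0, W 0, ph 0) \<notin> Z \<longrightarrow> (ph \<longlongrightarrow> follower_positions p) at_top))"
proof -
  interpret leader_follower_network p R \<omega> N k k\<omega> kp
    by (rule leader_follower_network.intro)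
      (fact rotation kinematics velocity_bounded two_neighbors neighbors_precede not_collocated not_collinear
        gains_pos k\<omega>_pos not_coplanar distinct_eigenvalues position_gains_pos)+
  show ?thesis
    using position_iss position_cascade_form almost_global_position_convergence by blast
qed

end
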